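(* Let $B^3\subset\mathbb{R}^3$ be the closed unit ball with Euclidean metric $d$, let $S^2$ be its boundary sphere and $\mathrm{int}(B^3)$ its interior. Let $h$ be any function in $\mathrm{H}^2=\mathrm{H}^2(\mathbb{R}^3)$ such that $h\equiv1$ on a neighbourhood of $B^3$, and for each $\mathbf{b}\in\mathrm{int}(B^3)$ choose $k_{\mathbf{b}}\in\mathrm{H}^2$ such that $k_{\mathbf{b}}=d(\mathbf{b},-)$ on a neighbourhood of $S^2$. Then the microscopic weighting $\widehat w\in\mathrm{H}^{-2}$ on $B^3$ satisfies $$\langle h,\widehat w\rangle=1\quad\text{and}\quad\langle k_{\mathbf{b}},\widehat w\rangle=M(B^3)\ \text{ for all }\mathbf{b}\in\mathrm{int}(B^3).$$
   Context: $\mathrm{H}^2$ is the Sobolev (Bessel potential) space of $f\in L^2(\mathbb{R}^3)$ whose weak partial derivatives of order at most $2$ lie in $L^2(\mathbb{R}^3)$; $\mathrm{H}^{-2}$ is its dual, a space of distributions on $\mathbb{R}^3$, and $\langle f,u\rangle$ denotes the pairing of $f\in\mathrm{H}^2$ with $u\in\mathrm{H}^{-2}$. Elements of $\mathrm{H}^2(\mathbb{R}^3)$ are continuous functions, so finitely supported signed measures on $\mathbb{R}^3$ are elements of $\mathrm{H}^{-2}$. For a compact set $Y\subset\mathbb{R}^3$ and $t>0$, let $tY$ be $Y$ with the metric multiplied by $t$. The weighting on $tY$ is the unique $w_t\in\mathrm{H}^{-2}$ lying in the closure in $\mathrm{H}^{-2}$ of the finitely supported signed measures on $Y$ and satisfying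 $\langle e^{-t\|\mathbf{y}-\cdot\|},w_t\rangle=1$ for every $\mathbf{y}\in Y$ (it exists and is unique by a theorem of Meckes). A microscopic weighting on $Y$ is $\widehat w\in\mathrm{H}^{-2}$ such that $\langle f,\widehat w\rangle=\lim_{t\to0^+}\langle f,w_t\rangle$ for every $f\in\mathrm{H}^2$. For $Y=B^3$ it exists and is given by $$\langle f,\widehat w\rangle=\int_{S^2}f\,\mathrm{d}\bar s+\int_{S^2}\tfrac{\partial f}{\partial\mathbf{n}}\,\mathrm{d}\bar s,$$ where $\bar s$ is the uniform measure on $S^2$ of total mass $1$ and $\partial/\partial\mathbf{n}$ is the outward normal derivative (in the sense of traces). The maximal energy of a compact metric space $Y$ is $M(Y)=\sup_\nu\iint_{Y\times Y}d(y,y')\,\mathrm{d}\nu(y)\,\mathrm{d}\nu(y')$, the supremum being over finite signed Borel measures $\nu$ on $Y$ with $\nu(Y)=1$. By a theorem of Alexander, $M(B^3)=2$. *)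

theory Defs
  imports "HOL-Analysis.Analysis"
begin

section \<open>Square-integrable functions\<close>

definition square_integrable :: "(real^3 \<Rightarrow> real) \<Rightarrow> bool" where
  "square_integrable f \<longleftrightarrow>
     f \<in> borel_measurable lborel \<and> integrable lborel (\<lambda>x. (f x)\<^sup>2)"

definition L2_norm :: "(real^3 \<Rightarrow> real) \<Rightarrow> real" where
  "L2_norm f = sqrt (\<integral>x. (f x)\<^sup>2 \<partial>lborel)"

lemma square_integrable_mult:
  assumes "square_integrable f" "square_integrable g"
  shows "integrable lborel (\<lambda>x. f x * g x)"
proof (rule Bochner_Integration.integrable_bound)
  show "integrable lborel (\<lambda>x. (f x)\<^sup>2 + (g x)\<^sup>2)"
    using assms by (auto simp: square_integrable_def)
  show "(\<lambda>x. f x * g x) \<in> borel_measurable lborel"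
    using assms by (auto simp: square_integrable_def)
  have "\<bar>a * b\<bar> \<le> \<bar>a\<^sup>2 + b\<^sup>2\<bar>" for a b :: real
  proof -
    have "0 \<le> (\<bar>a\<bar> - \<bar>b\<bar>)\<^sup>2" by simp
    then have "2 * (\<bar>a\<bar> * \<bar>b\<bar>) \<le> a\<^sup>2 + b\<^sup>2"
      by (simp add: power2_eq_square algebra_simps)
    then show ?thesis
      by (simp add: abs_mult) (smt (verit) mult_nonneg_nonneg abs_ge_zero)
  qed
  then show "AE x in lborel. norm (f x * g x) \<le> norm ((f x)\<^sup>2 + (g x)\<^sup>2)"
    by simp
qed

lemma square_integrable_add:
  assumes "square_integrable f" "square_integrable g"
  shows "square_integrable (\<lambda>x. f x + g x)"
  using assms square_integrable_mult[OF assms]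
  by (auto simp: square_integrable_def power2_sum mult.assoc)

lemma square_integrable_scale:
  "square_integrable f \<Longrightarrow> square_integrable (\<lambda>x. c * f x)"
  by (auto simp: square_integrable_def power_mult_distrib)

lemma L2_norm_nonneg [simp]: "0 \<le> L2_norm f"
  by (simp add: L2_norm_def)

lemma L2_norm_scale: "L2_norm (\<lambda>x. c * f x) = \<bar>c\<bar> * L2_norm f"
  by (simp add: L2_norm_def power_mult_distrib real_sqrt_mult)

lemma L2_norm_triangle:
  assumes "square_integrable f" "square_integrable g"
  shows "L2_norm (\<lambda>x. f x + g x) \<le> L2_norm f + L2_norm g"
proof (rule field_le_epsilon)
  fix e :: real assume "0 < e"
  define a where "a = L2_norm f + e / 2"
  define b where "b = L2_norm g + e / 2"
  have ab: "0 < a" "0 < b" "L2_norm f \<le> a" "L2_norm g \<le> b"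
    using \<open>0 < e\<close> by (simp_all add: a_def b_def add_nonneg_pos)
  have sq: "(\<integral>x. (f x)\<^sup>2 \<partial>lborel) \<le> a\<^sup>2" "(\<integral>x. (g x)\<^sup>2 \<partial>lborel) \<le> b\<^sup>2"
    using ab by (simp_all add: L2_norm_def sqrt_le_D)
  have int: "integrable lborel (\<lambda>x. (f x)\<^sup>2)" "integrable lborel (\<lambda>x. (g x)\<^sup>2)"
    using assms by (auto simp: square_integrable_def)
  have young: "(u + v)\<^sup>2 \<le> (1 + b / a) * u\<^sup>2 + (1 + a / b) * v\<^sup>2" for u v
  proof -
    have "0 \<le> (b * u - a * v)\<^sup>2 / (a * b)" using ab by simp
    also have "\<dots> = (b / a) * u\<^sup>2 + (a / b) * v\<^sup>2 - 2 * u * v"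
      using ab by (simp add: power2_eq_square field_simps)
    finally show ?thesis by (simp add: power2_eq_square algebra_simps)
  qed
  have "(\<integral>x. (f x + g x)\<^sup>2 \<partial>lborel)
      \<le> (\<integral>x. (1 + b / a) * (f x)\<^sup>2 + (1 + a / b) * (g x)\<^sup>2 \<partial>lborel)"
    using int square_integrable_add[OF assms] young
    by (intro integral_mono) (auto simp: square_integrable_def)
  also have "\<dots> = (1 + b / a) * (\<integral>x. (f x)\<^sup>2 \<partial>lborel) + (1 + a / b) * (\<integral>x. (g x)\<^sup>2 \<partial>lborel)"
    using int by simp
  also have "\<dots> \<le> (1 + b / a) * a\<^sup>2 + (1 + a / b) * b\<^sup>2"
    using ab sq by (intro add_mono mult_left_mono) auto
  also have "\<dots> = (a + b)\<^sup>2"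
    using ab by (simp add: power2_eq_square field_simps)
  finally have "L2_norm (\<lambda>x. f x + g x) \<le> a + b"
    using ab by (auto simp: L2_norm_def intro!: real_le_lsqrt)
  then show "L2_norm (\<lambda>x. f x + g x) \<le> L2_norm f + L2_norm g + e"
    by (simp add: a_def b_def)
qed

section \<open>Test functions and weak derivatives\<close>

definition partial_deriv :: "3 \<Rightarrow> (real^3 \<Rightarrow> real) \<Rightarrow> real^3 \<Rightarrow> real" where
  "partial_deriv i \<phi> = (\<lambda>x. frechet_derivative \<phi> (at x) (axis i 1))"

text \<open>A list of indices is used as a multi-index; its length is the order of the derivative.\<close>

abbreviation partial_derivs :: "3 list \<Rightarrow> (real^3 \<Rightarrow> real) \<Rightarrow> real^3 \<Rightarrow> real" where
  "partial_derivs is \<phi> \<equiv> foldr partial_deriv is \<phi>"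

text \<open>Compactly supported smooth functions: differentiability of all iterated partial derivatives
  makes all of them continuous.\<close>

definition test_function :: "(real^3 \<Rightarrow> real) \<Rightarrow> bool" where
  "test_function \<phi> \<longleftrightarrow>
     (\<forall>is x. partial_derivs is \<phi> differentiable (at x)) \<and> compact (closure {x. \<phi> x \<noteq> 0})"

definition weak_deriv :: "3 list \<Rightarrow> (real^3 \<Rightarrow> real) \<Rightarrow> (real^3 \<Rightarrow> real) \<Rightarrow> bool" where
  "weak_deriv is f g \<longleftrightarrow>
     (\<forall>\<phi>. test_function \<phi> \<longrightarrow>
        (\<integral>x. f x * partial_derivs is \<phi> x \<partial>lborel) = (-1) ^ length is * (\<integral>x. g x * \<phi> x \<partial>lborel))"

lemma partial_deriv_eq_0:
  assumes "closed K" "x \<notin> K" "\<And>y. y \<notin> K \<Longrightarrow> \<psi> y = 0"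
  shows "partial_deriv i \<psi> x = 0"
proof -
  have "(\<psi> has_derivative (\<lambda>_. 0)) (at x)"
    by (rule has_derivative_transform_within_open[of "\<lambda>_. 0" _ x UNIV "- K"])
       (use assms in auto)
  then have "frechet_derivative \<psi> (at x) = (\<lambda>_. 0)"
    by (metis frechet_derivative_at)
  then show ?thesis by (simp add: partial_deriv_def)
qed

lemma partial_derivs_eq_0:
  assumes "closed K" "\<And>y. y \<notin> K \<Longrightarrow> \<phi> y = 0" "x \<notin> K"
  shows "partial_derivs is \<phi> x = 0"
  using assms(3)
  by (induction "is" arbitrary: x) (auto intro: assms partial_deriv_eq_0)

lemma square_integrable_test:
  assumes "test_function \<phi>"
  shows "square_integrable (partial_derivs is \<phi>)"
proof -
  let ?K = "closure {x. \<phi> x \<noteq> 0}" and ?\<psi> = "partial_derivs is \<phi>"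
  have K: "compact ?K" using assms by (simp add: test_function_def)
  have cont: "continuous_on UNIV ?\<psi>"
    using assms
    by (auto simp: test_function_def continuous_on_eq_continuous_at differentiable_imp_continuous_within)
  have "?\<psi> x = 0" if "x \<notin> ?K" for x
  proof (rule partial_derivs_eq_0[OF _ _ that])
    show "\<phi> y = 0" if "y \<notin> ?K" for y
      using that closure_subset[of "{x. \<phi> x \<noteq> 0}"] by blast
  qed simp
  then have "(\<lambda>x. indicator ?K x *\<^sub>R (?\<psi> x)\<^sup>2) = (\<lambda>x. (?\<psi> x)\<^sup>2)"
    by (fastforce simp: indicator_def)
  moreover have "integrable lborel (\<lambda>x. indicator ?K x *\<^sub>R (?\<psi> x)\<^sup>2)"
    by (intro borel_integrable_compact K continuous_intros continuous_on_subset[OF cont]) auto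
  ultimately show ?thesis
    using cont by (auto simp: square_integrable_def intro: borel_measurable_continuous_onI)
qed

lemma weak_deriv_add:
  assumes "square_integrable f" "square_integrable f'" "square_integrable g" "square_integrable g'"
    and "weak_deriv is f g" "weak_deriv is f' g'"
  shows "weak_deriv is (\<lambda>x. f x + f' x) (\<lambda>x. g x + g' x)"
  unfolding weak_deriv_def
proof (intro allI impI)
  fix \<phi> assume \<phi>: "test_function \<phi>"
  note sq = square_integrable_test[OF \<phi>]
  have sq0: "square_integrable \<phi>" using sq[of "[]"] by simp
  show "(\<integral>x. (f x + f' x) * partial_derivs is \<phi> x \<partial>lborel)
      = (-1) ^ length is * (\<integral>x. (g x + g' x) * \<phi> x \<partial>lborel)"
    using assms(5,6) \<phi>
    by (simp add: weak_deriv_def distrib_right distrib_left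
        square_integrable_mult assms(1-4) sq sq0)
qed

lemma weak_deriv_scale:
  "weak_deriv is f g \<Longrightarrow> weak_deriv is (\<lambda>x. c * f x) (\<lambda>x. c * g x)"
  by (simp add: weak_deriv_def mult.assoc)

section \<open>The Sobolev space of order two\<close>

text \<open>Every class in the Sobolev space has exactly one continuous representative; the elements of
  \<open>H2\<close> are these representatives, so that point values are meaningful.\<close>

definition sobolev2 :: "(real^3 \<Rightarrow> real) set" where
  "sobolev2 = {f. continuous_on UNIV f \<and> square_integrable f \<and>
     (\<forall>is. length is \<le> 2 \<longrightarrow> (\<exists>g. square_integrable g \<and> weak_deriv is f g))}"

lemma sobolev2_zero: "(\<lambda>_. 0) \<in> sobolev2"
  by (force simp: sobolev2_def square_integrable_def weak_deriv_def intro: exI[of _ "\<lambda>_. 0"])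

lemma sobolev2_add:
  assumes "f \<in> sobolev2" "g \<in> sobolev2"
  shows "(\<lambda>x. f x + g x) \<in> sobolev2"
proof -
  have "\<exists>u. square_integrable u \<and> weak_deriv is (\<lambda>x. f x + g x) u" if "length is \<le> 2" for "is"
  proof -
    obtain u where "square_integrable u" "weak_deriv is f u"
      using assms(1) \<open>length is \<le> 2\<close> unfolding sobolev2_def by blast
    moreover obtain v where "square_integrable v" "weak_deriv is g v"
      using assms(2) \<open>length is \<le> 2\<close> unfolding sobolev2_def by blast
    ultimately show ?thesis using assms
      by (intro exI[of _ "\<lambda>x. u x + v x"])
         (simp add: sobolev2_def square_integrable_add weak_deriv_add)
  qed
  with assms show ?thesis
    by (simp add: sobolev2_def square_integrable_add continuous_on_add)
qed

lemma sobolev2_scale: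
  assumes "f \<in> sobolev2"
  shows "(\<lambda>x. c * f x) \<in> sobolev2"
proof -
  have "\<exists>u. square_integrable u \<and> weak_deriv is (\<lambda>x. c * f x) u" if "length is \<le> 2" for "is"
  proof -
    obtain u where "square_integrable u" "weak_deriv is f u"
      using assms \<open>length is \<le> 2\<close> unfolding sobolev2_def by blast
    then show ?thesis
      by (intro exI[of _ "\<lambda>x. c * u x"]) (simp add: square_integrable_scale weak_deriv_scale)
  qed
  with assms show ?thesis
    by (simp add: sobolev2_def square_integrable_scale continuous_on_mult_left)
qed

typedef H2 = sobolev2
  morphisms H2_fun Abs_H2
  using sobolev2_zero by blast

lemma H2_eqI: "(\<And>x. H2_fun f x = H2_fun g x) \<Longrightarrow> f = g"
  by (metis H2_fun_inject ext)

lemma H2_square_integrable: "square_integrable (H2_fun f)"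
  and H2_continuous: "continuous_on UNIV (H2_fun f)"
  using H2_fun[of f] by (auto simp: sobolev2_def)

lemma H2_weak_deriv:
  "length is \<le> 2 \<Longrightarrow> \<exists>g. square_integrable g \<and> weak_deriv is (H2_fun f) g"
  using H2_fun[of f] by (auto simp: sobolev2_def)

text \<open>The norm of a weak derivative. Weak derivatives are unique up to null sets, so the infimum is
  taken over a set with a single element; it only saves choosing a representative.\<close>

definition weak_deriv_norm :: "3 list \<Rightarrow> (real^3 \<Rightarrow> real) \<Rightarrow> real" where
  "weak_deriv_norm is f = Inf {L2_norm g |g. square_integrable g \<and> weak_deriv is f g}"

lemma weak_deriv_norm_bdd:
  "bdd_below {L2_norm g |g. square_integrable g \<and> weak_deriv is f g}"
  by (rule bdd_belowI[of _ 0]) auto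

lemma weak_deriv_norm_le:
  "square_integrable g \<Longrightarrow> weak_deriv is f g \<Longrightarrow> weak_deriv_norm is f \<le> L2_norm g"
  unfolding weak_deriv_norm_def by (rule cInf_lower[OF _ weak_deriv_norm_bdd]) auto

lemma weak_deriv_norm_nonneg:
  "length is \<le> 2 \<Longrightarrow> 0 \<le> weak_deriv_norm is (H2_fun f)"
  unfolding weak_deriv_norm_def using H2_weak_deriv by (intro cInf_greatest) auto

lemma weak_deriv_norm_approx:
  assumes "length is \<le> 2" "0 < e"
  obtains g where "square_integrable g" "weak_deriv is (H2_fun f) g"
    "L2_norm g < weak_deriv_norm is (H2_fun f) + e"
proof -
  let ?S = "{L2_norm g |g. square_integrable g \<and> weak_deriv is (H2_fun f) g}"
  have "?S \<noteq> {}" using H2_weak_deriv assms(1) by blast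
  moreover have "Inf ?S < weak_deriv_norm is (H2_fun f) + e"
    using assms(2) by (simp add: weak_deriv_norm_def)
  ultimately show ?thesis using that cInf_lessD[of ?S] by blast
qed

lemma weak_deriv_norm_triangle:
  assumes l: "length is \<le> 2"
  shows "weak_deriv_norm is (\<lambda>x. H2_fun f x + H2_fun g x)
       \<le> weak_deriv_norm is (H2_fun f) + weak_deriv_norm is (H2_fun g)"
proof (rule field_le_epsilon)
  fix e :: real assume "0 < e"
  then have "0 < e / 2" by simp
  obtain u where u: "square_integrable u" "weak_deriv is (H2_fun f) u"
      "L2_norm u < weak_deriv_norm is (H2_fun f) + e / 2"
    by (rule weak_deriv_norm_approx[OF l \<open>0 < e / 2\<close>])
  obtain v where v: "square_integrable v" "weak_deriv is (H2_fun g) v"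
      "L2_norm v < weak_deriv_norm is (H2_fun g) + e / 2"
    by (rule weak_deriv_norm_approx[OF l \<open>0 < e / 2\<close>])
  have "weak_deriv_norm is (\<lambda>x. H2_fun f x + H2_fun g x) \<le> L2_norm (\<lambda>x. u x + v x)"
    using u v by (intro weak_deriv_norm_le square_integrable_add weak_deriv_add H2_square_integrable)
  also have "\<dots> \<le> L2_norm u + L2_norm v"
    using u v by (intro L2_norm_triangle)
  finally show "weak_deriv_norm is (\<lambda>x. H2_fun f x + H2_fun g x)
       \<le> weak_deriv_norm is (H2_fun f) + weak_deriv_norm is (H2_fun g) + e"
    using u(3) v(3) by simp
qed

lemma weak_deriv_norm_scale_le:
  assumes l: "length is \<le> 2"
  shows "weak_deriv_norm is (\<lambda>x. c * H2_fun f x) \<le> \<bar>c\<bar> * weak_deriv_norm is (H2_fun f)"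
proof (rule field_le_epsilon)
  fix e :: real assume "0 < e"
  then have "0 < e / (\<bar>c\<bar> + 1)" by (simp add: add_nonneg_pos)
  then obtain u where u: "square_integrable u" "weak_deriv is (H2_fun f) u"
      "L2_norm u < weak_deriv_norm is (H2_fun f) + e / (\<bar>c\<bar> + 1)"
    by (rule weak_deriv_norm_approx[OF l])
  have "weak_deriv_norm is (\<lambda>x. c * H2_fun f x) \<le> L2_norm (\<lambda>x. c * u x)"
    using u by (intro weak_deriv_norm_le square_integrable_scale weak_deriv_scale)
  also have "\<dots> \<le> \<bar>c\<bar> * (weak_deriv_norm is (H2_fun f) + e / (\<bar>c\<bar> + 1))"
    using u(3) by (simp add: L2_norm_scale mult_left_mono)
  also have "\<dots> \<le> \<bar>c\<bar> * weak_deriv_norm is (H2_fun f) + e"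
    using \<open>0 < e\<close> by (simp add: distrib_left field_simps add_nonneg_pos)
  finally show "weak_deriv_norm is (\<lambda>x. c * H2_fun f x) \<le> \<bar>c\<bar> * weak_deriv_norm is (H2_fun f) + e" .
qed

instantiation H2 :: real_vector
begin

definition zero_H2 :: H2 where "zero_H2 = Abs_H2 (\<lambda>_. 0)"
definition plus_H2 :: "H2 \<Rightarrow> H2 \<Rightarrow> H2" where
  "plus_H2 f g = Abs_H2 (\<lambda>x. H2_fun f x + H2_fun g x)"
definition scaleR_H2 :: "real \<Rightarrow> H2 \<Rightarrow> H2" where
  "scaleR_H2 c f = Abs_H2 (\<lambda>x. c * H2_fun f x)"
definition uminus_H2 :: "H2 \<Rightarrow> H2" where
  "uminus_H2 f = Abs_H2 (\<lambda>x. (-1) * H2_fun f x)"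
definition minus_H2 :: "H2 \<Rightarrow> H2 \<Rightarrow> H2" where
  "minus_H2 f g = f + (- g)"

lemma H2_fun_zero [simp]: "H2_fun 0 = (\<lambda>_. 0)"
  by (simp add: zero_H2_def Abs_H2_inverse sobolev2_zero)
lemma H2_fun_plus [simp]: "H2_fun (f + g) = (\<lambda>x. H2_fun f x + H2_fun g x)"
  by (simp add: plus_H2_def Abs_H2_inverse sobolev2_add H2_fun)
lemma H2_fun_scaleR [simp]: "H2_fun (c *\<^sub>R f) = (\<lambda>x. c * H2_fun f x)"
  by (simp add: scaleR_H2_def Abs_H2_inverse sobolev2_scale H2_fun)
lemma H2_fun_uminus [simp]: "H2_fun (- f) = (\<lambda>x. - H2_fun f x)"
  using sobolev2_scale[OF H2_fun, of "-1" f] by (simp add: uminus_H2_def Abs_H2_inverse)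
lemma H2_fun_minus [simp]: "H2_fun (f - g) = (\<lambda>x. H2_fun f x - H2_fun g x)"
  by (simp add: minus_H2_def)

instance
  by standard (auto intro!: H2_eqI simp: algebra_simps)

end

instantiation H2 :: real_normed_vector
begin

definition norm_H2 :: "H2 \<Rightarrow> real" where
  "norm_H2 f = sqrt ((L2_norm (H2_fun f))\<^sup>2
     + (\<Sum>is | length is \<in> {1, 2}. (weak_deriv_norm is (H2_fun f))\<^sup>2))"
definition dist_H2 :: "H2 \<Rightarrow> H2 \<Rightarrow> real" where
  "dist_H2 f g = norm (f - g)"
definition sgn_H2 :: "H2 \<Rightarrow> H2" where
  "sgn_H2 f = inverse (norm f) *\<^sub>R f"
definition uniformity_H2 :: "(H2 \<times> H2) filter" where
  "uniformity_H2 = (INF e\<in>{0<..}. principal {(x, y). dist x y < e})"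
definition open_H2 :: "H2 set \<Rightarrow> bool" where
  "open_H2 U = (\<forall>x\<in>U. \<forall>\<^sub>F (x', y) in uniformity. x' = x \<longrightarrow> y \<in> U)"

lemma finite_multi_indices: "finite {is :: 3 list. length is \<in> {1, 2}}"
proof -
  have "{is :: 3 list. length is \<in> {1, 2}} \<subseteq> {is. set is \<subseteq> UNIV \<and> length is \<le> 2}" by auto
  then show ?thesis by (rule finite_subset) (rule finite_lists_length_le[OF finite])
qed

lemma L2_norm_le_norm_H2: "L2_norm (H2_fun f) \<le> norm f"
  unfolding norm_H2_def by (rule real_le_rsqrt) (auto intro: sum_nonneg)

lemma norm_H2_triangle: "norm (f + g) \<le> norm f + norm (g :: H2)"
proof -
  let ?I = "{is :: 3 list. length is \<in> {1, 2}}"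
  define S where "S f = L2_set (\<lambda>is. weak_deriv_norm is (H2_fun f)) ?I" for f
  have n: "norm f = sqrt ((L2_norm (H2_fun f))\<^sup>2 + (S f)\<^sup>2)" for f
    by (simp add: norm_H2_def S_def L2_set_def sum_nonneg)
  have S0: "0 \<le> S f" for f by (simp add: S_def)
  have "S (f + g) \<le> L2_set (\<lambda>is. weak_deriv_norm is (H2_fun f) + weak_deriv_norm is (H2_fun g)) ?I"
    unfolding S_def H2_fun_plus
    using weak_deriv_norm_nonneg[of _ "f + g"]
    by (intro L2_set_mono weak_deriv_norm_triangle) auto
  also have "\<dots> \<le> S f + S g"
    unfolding S_def by (rule L2_set_triangle_ineq)
  finally have S: "S (f + g) \<le> S f + S g" .
  have L: "L2_norm (H2_fun (f + g)) \<le> L2_norm (H2_fun f) + L2_norm (H2_fun g)"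
    by (simp add: L2_norm_triangle H2_square_integrable)
  have "norm (f + g) \<le> sqrt ((L2_norm (H2_fun f) + L2_norm (H2_fun g))\<^sup>2 + (S f + S g)\<^sup>2)"
    unfolding n using S L S0 by (intro real_sqrt_le_mono add_mono power_mono) auto
  also have "\<dots> \<le> norm f + norm g"
    unfolding n by (rule real_sqrt_sum_squares_triangle_ineq)
  finally show ?thesis .
qed

lemma norm_H2_scaleR_le: "norm (c *\<^sub>R f) \<le> \<bar>c\<bar> * norm (f :: H2)"
proof -
  let ?I = "{is :: 3 list. length is \<in> {1, 2}}"
  have "(\<Sum>is\<in>?I. (weak_deriv_norm is (H2_fun (c *\<^sub>R f)))\<^sup>2)
      \<le> (\<Sum>is\<in>?I. (\<bar>c\<bar> * weak_deriv_norm is (H2_fun f))\<^sup>2)"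
    using weak_deriv_norm_nonneg[of _ "c *\<^sub>R f"] weak_deriv_norm_scale_le[of _ c f]
    by (intro sum_mono power_mono) auto
  then have "norm (c *\<^sub>R f) \<le> sqrt (\<bar>c\<bar>\<^sup>2 * ((L2_norm (H2_fun f))\<^sup>2
      + (\<Sum>is\<in>?I. (weak_deriv_norm is (H2_fun f))\<^sup>2)))"
    unfolding norm_H2_def
    by (intro real_sqrt_le_mono)
       (simp add: L2_norm_scale power_mult_distrib distrib_left sum_distrib_left)
  also have "\<dots> = \<bar>c\<bar> * norm f"
    by (simp only: real_sqrt_mult real_sqrt_abs abs_abs norm_H2_def)
  finally show ?thesis .
qed

lemma norm_H2_scaleR: "norm (c *\<^sub>R f) = \<bar>c\<bar> * norm (f :: H2)"
proof (cases "c = 0")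
  case True
  have "0 \<le> norm (c *\<^sub>R f)" using L2_norm_le_norm_H2 L2_norm_nonneg order_trans by blast
  then show ?thesis using norm_H2_scaleR_le[of c f] True by simp
next
  case False
  have "\<bar>c\<bar> * norm f = \<bar>c\<bar> * norm (inverse c *\<^sub>R (c *\<^sub>R f))"
    using False by simp
  also have "\<dots> \<le> \<bar>c\<bar> * (\<bar>inverse c\<bar> * norm (c *\<^sub>R f))"
    by (intro mult_left_mono norm_H2_scaleR_le) simp
  also have "\<dots> = norm (c *\<^sub>R f)" using False by (simp add: abs_inverse)
  finally show ?thesis using norm_H2_scaleR_le[of c f] by simp
qed

lemma norm_H2_eq_0_iff: "norm f = 0 \<longleftrightarrow> f = (0 :: H2)"
proof
  assume "f = 0"
  then show "norm f = 0" using norm_H2_scaleR[of 0 f] by simp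
next
  assume "norm f = 0"
  then have "L2_norm (H2_fun f) = 0"
    using L2_norm_le_norm_H2[of f] L2_norm_nonneg[of "H2_fun f"] by simp
  then have "(\<integral>x. (H2_fun f x)\<^sup>2 \<partial>lborel) = 0" by (simp add: L2_norm_def)
  then have ae: "AE x in lborel. (H2_fun f x)\<^sup>2 = 0"
    using H2_square_integrable[of f]
    by (subst (asm) integral_nonneg_eq_0_iff_AE) (auto simp: square_integrable_def)
  have "{x. H2_fun f x \<noteq> 0} \<in> null_sets lborel"
  proof (rule AE_iff_null_sets[THEN iffD2])
    have "open {x. H2_fun f x \<noteq> 0}"
      by (rule open_Collect_neq) (auto intro: H2_continuous)
    then show "{x. H2_fun f x \<noteq> 0} \<in> sets lborel" by simp
    show "AE x in lborel. x \<notin> {x. H2_fun f x \<noteq> 0}" using ae by simp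
  qed
  then have "negligible {x. H2_fun f x \<noteq> 0}"
    by (simp add: negligible_iff_null_sets null_sets_completionI)
  moreover have "open {x. H2_fun f x \<noteq> 0}"
    by (rule open_Collect_neq) (auto intro: H2_continuous)
  ultimately have "{x. H2_fun f x \<noteq> 0} = {}"
    using open_not_negligible by blast
  then show "f = 0" by (intro H2_eqI) auto
qed

instance
proof
  fix x y :: H2 and a :: real
  show "dist x y = norm (x - y)" by (rule dist_H2_def)
  show "sgn x = inverse (norm x) *\<^sub>R x" by (rule sgn_H2_def)
  show "uniformity = (INF e\<in>{0<..}. principal {(x :: H2, y). dist x y < e})"
    by (rule uniformity_H2_def)
  show "open U = (\<forall>x\<in>U. \<forall>\<^sub>F (x', y) in uniformity. x' = x \<longrightarrow> y \<in> U)" for U :: "H2 set"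
    by (rule open_H2_def)
  show "norm x = 0 \<longleftrightarrow> x = 0" by (rule norm_H2_eq_0_iff)
  show "norm (x + y) \<le> norm x + norm y" by (rule norm_H2_triangle)
  show "norm (a *\<^sub>R x) = \<bar>a\<bar> * norm x" by (rule norm_H2_scaleR)
qed

end

section \<open>Weightings and maximal energy\<close>

text \<open>The dual of \<open>H2\<close>, with the operator norm; the pairing of \<open>f\<close> with \<open>u\<close> is
  \<open>blinfun_apply u f\<close>.\<close>

type_synonym Hm2 = "H2 \<Rightarrow>\<^sub>L real"

text \<open>Point evaluations are bounded on \<open>H2\<close> (Sobolev embedding), so every finitely supported signed
  measure, with mass \<open>c x\<close> at \<open>x\<close>, is such a functional.\<close>

definition fin_supp_measures :: "(real^3) set \<Rightarrow> Hm2 set" where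
  "fin_supp_measures Y = {u. \<exists>S c. finite S \<and> S \<subseteq> Y \<and>
     (\<forall>f. blinfun_apply u f = (\<Sum>x\<in>S. c x * H2_fun f x))}"

text \<open>Weightings on \<open>Y\<close> with its metric multiplied by \<open>t\<close>. The exponentials belong to the Sobolev
  space, so the element \<open>e\<close> always exists; it is determined by its values.\<close>

definition is_weighting :: "real \<Rightarrow> (real^3) set \<Rightarrow> Hm2 \<Rightarrow> bool" where
  "is_weighting t Y w \<longleftrightarrow>
     w \<in> closure (fin_supp_measures Y) \<and>
     (\<forall>y\<in>Y. \<exists>e. (\<forall>x. H2_fun e x = exp (- (t * norm (y - x)))) \<and> blinfun_apply w e = 1)"

definition is_microscopic_weighting :: "(real^3) set \<Rightarrow> Hm2 \<Rightarrow> bool" where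
  "is_microscopic_weighting Y w' \<longleftrightarrow>
     (\<exists>w. (\<forall>t>0. is_weighting t Y (w t)) \<and>
       (\<forall>f. ((\<lambda>t. blinfun_apply (w t) f) \<longlongrightarrow> blinfun_apply w' f) (at_right 0)))"

definition finite_borel_measure_on :: "'a::metric_space set \<Rightarrow> 'a measure \<Rightarrow> bool" where
  "finite_borel_measure_on Y \<mu> \<longleftrightarrow> finite_measure \<mu> \<and> sets \<mu> = sets (restrict_space borel Y)"

definition mutual_energy :: "'a::metric_space measure \<Rightarrow> 'a measure \<Rightarrow> real" where
  "mutual_energy \<mu> \<nu> = (\<integral>x. (\<integral>y. dist x y \<partial>\<nu>) \<partial>\<mu>)"

text \<open>A finite signed Borel measure is a difference \<open>\<mu> - \<nu>\<close> of finite positive ones (Jordan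
  decomposition), and its double integral is obtained by bilinearity; the value does not depend on
  the chosen \<open>\<mu>\<close> and \<open>\<nu>\<close>. For a general compact \<open>Y\<close> the supremum may be infinite.\<close>

definition max_energy :: "'a::metric_space set \<Rightarrow> ereal" where
  "max_energy Y = Sup {ereal (mutual_energy \<mu> \<mu> - mutual_energy \<mu> \<nu> - mutual_energy \<nu> \<mu> + mutual_energy \<nu> \<nu>)
     |\<mu> \<nu>. finite_borel_measure_on Y \<mu> \<and> finite_borel_measure_on Y \<nu> \<and>
        measure \<mu> Y - measure \<nu> Y = 1}"

end

theory Submission
  imports Defs
begin

text \<open>Let \<open>w t\<close> be the weighting on the ball \<open>B\<close> with metric multiplied by \<open>t\<close>. Since \<open>w t\<close> is a norm limit of finitely
  supported measures and all functions \<open>exp (- t |y - \<cdot>|)\<close> have the same norm, a function in \<open>H2\<close> that agrees on \<open>B\<close> with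
  \<open>\<integral> exp (- t |y - \<cdot>|) d\<mu>(y)\<close>, for a finite signed measure \<open>\<mu>\<close> on \<open>B\<close>, pairs with \<open>w t\<close> to \<open>\<mu>(B)\<close>. In \<open>\<real>\<^sup>3\<close>, the kernel
  \<open>exp (- t |\<cdot>|)\<close> is, up to the factor \<open>8 \<pi> t\<close>, the fundamental solution of \<open>(t\<^sup>2 - \<Delta>)\<^sup>2\<close>, and for radial functions everything
  reduces to an ordinary differential equation. This yields \<open>\<langle>h, w t\<rangle> = 1 + 2 t + t\<^sup>2 + t\<^sup>3 / 6\<close>, and
  \<open>\<langle>g, w t\<rangle> = t\<^sup>3 / (8 \<pi>) \<integral>\<^sub>B g\<close> when \<open>g\<close> vanishes near the sphere.

  Let \<open>r\<close> be the distance to \<open>b\<close>. Expanding \<open>exp (- t r) = 1 - t r + t\<^sup>2 R\<close> and pairing with \<open>w t\<close>, whose value on the left is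
  \<open>1\<close>, gives \<open>\<langle>r, w t\<rangle> = (\<langle>h, w t\<rangle> - 1) / t + t \<langle>R, w t\<rangle> \<longrightarrow> 2\<close>, because the pairings with the remainders \<open>R\<close> are bounded
  by a gliding hump argument.

  Finally, by Crofton's formula the energy of a signed measure \<open>m\<close> of mass \<open>1\<close> is an average of \<open>4 m(H) (1 - m(H)) \<le> 1\<close> over the
  half-spaces \<open>H\<close> whose boundary meets \<open>B\<close>, times \<open>2\<close>; this gives \<open>2\<close> as the supremum, approached by radial measures
  with \<open>m(H)\<close> close to \<open>1 / 2\<close>.\<close>

section \<open>Cylindrical and bipolar coordinates\<close>

text \<open>The two sides of the energy equation meet only in the number 2: the pairing and
  \<open>max_energy\<close> are evaluated separately. A function \<open>g\<close> in
  \<open>H2\<close> has two weak derivatives, but (t^2 - Laplacian)^2 needs four, so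
  \<open>g\<close> need not be the potential of a density. When \<open>g\<close> vanishes near the
  sphere, it is therefore averaged against small bumps that are potentials of densities on small
  balls; only the mass of these densities enters. The result has order t^3, so what
  \<open>k b\<close> does inside the ball disappears in the limit. The distance to \<open>b\<close>
  has unbounded second derivatives at \<open>b\<close>, while the remainder R has bounded ones on
  the ball, uniformly in t. Hence membership in \<open>H2\<close> is proved only for functions with
  bounded, compactly supported derivatives; exponentials come with the definition of a weighting,
  and the distance is recovered as 1 - exp (- r) + R at t = 1. For the energy, the microscopic
  weighting itself is extremal: the mean of f plus the mean of its normal derivative over the sphere
  formally gives mass 1/2 to every half-space whose boundary cuts the open ball. It is not a
  measure; the radial measures of the last part approximate it.\<close>

lemma Basis_real_vec: "(Basis :: (real^'n) set) = range (\<lambda>i. axis i 1)"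
  by (auto simp: Basis_vec_def)

lemma prod_Basis_real3: "(\<Prod>b\<in>Basis. (x :: real^3) \<bullet> b) = x$1 * x$2 * x$3"
proof -
  have "(\<Prod>b\<in>Basis. x \<bullet> b) = (\<Prod>i\<in>UNIV. x \<bullet> axis i 1)"
    unfolding Basis_real_vec by (subst prod.reindex) (auto simp: inj_on_def axis_eq_axis)
  also have "\<dots> = (\<Prod>i\<in>UNIV. x $ i)" by (simp add: inner_axis)
  also have "\<dots> = x$1 * x$2 * x$3" unfolding UNIV_3 by (simp add: mult.assoc)
  finally show ?thesis .
qed

text \<open>The height comes first, so that the horizontal plane is the second factor of a product
  and can be integrated out in one step.\<close>

definition cyl :: "real \<times> real \<times> real \<Rightarrow> real^3" where
  "cyl p = fst (snd p) *\<^sub>R axis 1 1 + snd (snd p) *\<^sub>R axis 2 1 + fst p *\<^sub>R axis 3 1"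

lemma cyl_nth [simp]: "cyl p $ 1 = fst (snd p)" "cyl p $ 2 = snd (snd p)" "cyl p $ 3 = fst p"
  by (simp_all add: cyl_def axis_def)

lemma cyl_measurable [measurable]: "cyl \<in> borel \<rightarrow>\<^sub>M borel"
  unfolding cyl_def[abs_def] by (rule borel_measurable_continuous_onI) (intro continuous_intros)

lemma emeasure_lborel_Times:
  assumes "A \<in> sets borel" "C \<in> sets borel"
  shows "emeasure (lborel :: ('a::euclidean_space \<times> 'b::euclidean_space) measure) (A \<times> C)
    = emeasure lborel A * emeasure lborel C"
  using assms by (simp add: lborel_prod[symmetric] lborel.emeasure_pair_measure_Times)

lemma distr_cylinder:
  "distr lborel borel cyl = (lborel :: (real^3) measure)" (is "?M = _")
proof (rule lborel_eqI[symmetric])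
  fix l u :: "real^3" assume "\<And>b. b \<in> Basis \<Longrightarrow> l \<bullet> b \<le> u \<bullet> b"
  then have le: "l$i \<le> u$i" for i
    by (metis Basis_real_vec cart_eq_inner_axis rangeI)
  have eq: "cyl -` box l u
      = box (l$3) (u$3) \<times> (box (l$1) (u$1) \<times> box (l$2) (u$2))"
    by (auto simp: mem_box_cart forall_3)
  have "emeasure ?M (box l u) = emeasure (lborel \<Otimes>\<^sub>M (lborel \<Otimes>\<^sub>M lborel))
      (box (l$3) (u$3) \<times> (box (l$1) (u$1) \<times> box (l$2) (u$2)))"
    by (simp add: emeasure_distr eq lborel_prod)
  also have "\<dots> = emeasure lborel (box (l$3) (u$3)) * (emeasure lborel (box (l$1) (u$1))
      * emeasure lborel (box (l$2) (u$2)))"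
    by (simp add: lborel_prod emeasure_lborel_Times borel_prod[symmetric])
  also have "\<dots> = (\<Prod>b\<in>Basis. (u - l) \<bullet> b)"
    using le by (simp add: prod_Basis_real3 ennreal_mult[symmetric] mult_ac)
  finally show "emeasure ?M (box l u) = (\<Prod>b\<in>Basis. (u - l) \<bullet> b)" .
qed simp

lemma distr_lborel_orthogonal:
  fixes f :: "real^3 \<Rightarrow> real^3"
  assumes f: "orthogonal_transformation f"
  shows "distr lborel borel f = lborel"
proof (rule lborel_eqI[symmetric])
  have cont: "continuous_on UNIV f"
    using f orthogonal_transformation_linear linear_continuous_on linear_conv_bounded_linear by blast
  then have [measurable]: "f \<in> borel \<rightarrow>\<^sub>M borel" by (rule borel_measurable_continuous_onI)
  fix l u :: "real^3" assume le: "\<And>b. b \<in> Basis \<Longrightarrow> l \<bullet> b \<le> u \<bullet> b"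
  have inv: "orthogonal_transformation (inv f)" by (rule orthogonal_transformation_inv[OF f])
  have eq: "f -` box l u = inv f ` box l u"
    using f by (simp add: bij_vimage_eq_inv_image orthogonal_transformation_bij)
  have B: "f -` box l u \<in> sets borel" using measurable_sets[of f borel borel "box l u"] by simp
  have lm: "f -` box l u \<in> lmeasurable" unfolding eq
    using inv by (intro measurable_orthogonal_image) simp_all
  have "emeasure (distr lborel borel f) (box l u) = emeasure lebesgue (f -` box l u)"
    using B by (simp add: emeasure_distr)
  also have "\<dots> = measure lebesgue (f -` box l u)" using lm by (simp add: emeasure_eq_measure2)
  also have "\<dots> = measure lebesgue (box l u)" unfolding eq
    using inv by (intro arg_cong[where f=ennreal] measure_orthogonal_image) simp_all
  also have "\<dots> = (\<Prod>b\<in>Basis. (u - l) \<bullet> b)" using le by (simp add: measure_lborel_box)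
  finally show "emeasure (distr lborel borel f) (box l u) = (\<Prod>b\<in>Basis. (u - l) \<bullet> b)" .
qed simp

lemma nn_integral_orthogonal:
  fixes f :: "real^3 \<Rightarrow> real^3"
  assumes "orthogonal_transformation f" and [measurable]: "F \<in> borel_measurable borel"
  shows "(\<integral>\<^sup>+x. F (f x) \<partial>lborel) = (\<integral>\<^sup>+x. F x \<partial>lborel)"
proof -
  have "continuous_on UNIV f"
    using assms orthogonal_transformation_linear linear_continuous_on linear_conv_bounded_linear by blast
  then have [measurable]: "f \<in> borel \<rightarrow>\<^sub>M borel" by (rule borel_measurable_continuous_onI)
  show ?thesis
    by (subst (2) distr_lborel_orthogonal[OF assms(1), symmetric]) (simp add: nn_integral_distr)
qed

lemma emeasure_disc: "0 \<le> r \<Longrightarrow> emeasure lborel (cball (0::real\<times>real) r) = ennreal (pi * r\<^sup>2)"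
  by (simp add: emeasure_cball unit_ball_vol_2 power2_eq_square)

text \<open>A disc of squared radius v has area pi * v, which is linear in v. This is why squared
  distances, not distances, are the variables used below: no Jacobian factor appears.\<close>

lemma distr_norm_square_plane:
  "distr lborel borel (\<lambda>p::real\<times>real. (fst p)\<^sup>2 + (snd p)\<^sup>2)
     = density lborel (\<lambda>v. ennreal pi * indicator {0..} v)" (is "?M = ?N")
proof (rule measure_eqI_generator_eq)
  let ?E = "range (\<lambda>a::real. {..a})"
  show "Int_stable ?E" by (auto simp: Int_stable_def)
  show "?E \<subseteq> Pow UNIV" "sets ?M = sigma_sets UNIV ?E" "sets ?N = sigma_sets UNIV ?E"
    by (simp_all add: borel_eq_atMost)
  show "range (\<lambda>n::nat. {..real n}) \<subseteq> ?E" "(\<Union>n::nat. {..real n}) = UNIV"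
    by (auto intro: real_arch_simple)
  have M: "emeasure ?M {..v} = ennreal (pi * max 0 v)" for v
  proof -
    have "emeasure ?M {..v} = emeasure lborel ((\<lambda>p::real\<times>real. (fst p)\<^sup>2 + (snd p)\<^sup>2) -` {..v})"
      by (subst emeasure_distr) (auto simp: space_pair_measure borel_prod[symmetric])
    also have "\<dots> = ennreal (pi * max 0 v)"
    proof (cases "0 \<le> v")
      case True
      have "(\<lambda>p::real\<times>real. (fst p)\<^sup>2 + (snd p)\<^sup>2) -` {..v} = cball 0 (sqrt v)"
        using True by (auto simp: norm_prod_def)
      with True show ?thesis by (simp add: emeasure_disc)
    next
      case False
      then have "(\<lambda>p::real\<times>real. (fst p)\<^sup>2 + (snd p)\<^sup>2) -` {..v} = {}"
        by (auto simp: not_le) (smt (verit) zero_le_power2)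
      with False show ?thesis by simp
    qed
    finally show ?thesis .
  qed
  show "emeasure ?M {..real n} \<noteq> \<infinity>" for n by (simp add: M)
  have N: "emeasure ?N {..v} = ennreal (pi * max 0 v)" for v
  proof -
    have "emeasure ?N {..v} = (\<integral>\<^sup>+x. ennreal pi * indicator {0..v} x \<partial>lborel)"
      by (subst emeasure_density) (auto intro!: nn_integral_cong split: split_indicator)
    also have "\<dots> = ennreal (pi * max 0 v)"
      by (cases "0 \<le> v") (auto simp: nn_integral_cmult ennreal_mult max_def)
    finally show ?thesis .
  qed
  fix X assume "X \<in> ?E"
  then show "emeasure ?M X = emeasure ?N X" using M N by auto
qed

lemma nn_integral_cylinder:
  fixes F :: "real \<Rightarrow> real \<Rightarrow> ennreal"
  assumes [measurable]: "(\<lambda>p. F (fst p) (snd p)) \<in> borel_measurable borel"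
  shows "(\<integral>\<^sup>+y. F ((y::real^3)$3) ((y$1)\<^sup>2 + (y$2)\<^sup>2) \<partial>lborel)
     = (\<integral>\<^sup>+z. \<integral>\<^sup>+v. ennreal pi * indicator {0..} v * F z v \<partial>lborel \<partial>lborel)"
proof -
  have [measurable]: "(\<lambda>p. F (f p) (g p)) \<in> borel_measurable M" 
    if [measurable]: "f \<in> borel_measurable M" "g \<in> borel_measurable M" for f g and M :: "'m measure"
  proof -
    have "(\<lambda>p. (f p, g p)) \<in> M \<rightarrow>\<^sub>M borel" by simp
    from measurable_compose[OF this assms] show ?thesis by simp
  qed
  have F2: "(\<lambda>y. F ((y::real^3)$3) ((y$1)\<^sup>2 + (y$2)\<^sup>2)) \<in> borel_measurable borel" by measurable
  have q [measurable]: "(\<lambda>p::real\<times>real. (fst p)\<^sup>2 + (snd p)\<^sup>2) \<in> borel \<rightarrow>\<^sub>M borel"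
    by (intro borel_measurable_continuous_onI continuous_intros)
  have q' [measurable]: "(\<lambda>x. (fst (snd x))\<^sup>2
      + (snd (snd x))\<^sup>2) \<in> borel_measurable (lborel \<Otimes>\<^sub>M (lborel :: (real\<times>real) measure))"
    by (rule measurable_compose[OF measurable_snd]) (simp add: q)
  have F3: "(\<lambda>(z, p). F z ((fst p)\<^sup>2
      + (snd p)\<^sup>2)) \<in> borel_measurable (lborel \<Otimes>\<^sub>M (lborel :: (real\<times>real) measure))"
    unfolding case_prod_unfold by measurable
  have "(\<integral>\<^sup>+y. F ((y::real^3)$3) ((y$1)\<^sup>2 + (y$2)\<^sup>2) \<partial>lborel)
     = (\<integral>\<^sup>+y. F ((y::real^3)$3) ((y$1)\<^sup>2 + (y$2)\<^sup>2) \<partial>distr lborel borel cyl)"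
    by (simp only: distr_cylinder)
  also have "\<dots> = (\<integral>\<^sup>+p. F (cyl p $ 3) ((cyl p $ 1)\<^sup>2 + (cyl p $ 2)\<^sup>2) \<partial>lborel)"
    by (rule nn_integral_distr) (use F2 in simp_all)
  also have "\<dots> = (\<integral>\<^sup>+p. (\<lambda>(z, p). F z ((fst p)\<^sup>2 + (snd p)\<^sup>2)) p \<partial>(lborel \<Otimes>\<^sub>M lborel))"
    unfolding lborel_prod by (simp add: case_prod_unfold)
  also have "\<dots> = (\<integral>\<^sup>+z. \<integral>\<^sup>+p. F z ((fst p)\<^sup>2 + (snd p)\<^sup>2) \<partial>lborel \<partial>lborel)"
    using lborel.nn_integral_fst[OF F3] by simp
  also have "\<dots> = (\<integral>\<^sup>+z. \<integral>\<^sup>+v. F z v \<partial>(distr lborel borel (\<lambda>p::real\<times>real. (fst p)\<^sup>2 + (snd p)\<^sup>2)) \<partial>lborel)"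
    by (intro nn_integral_cong nn_integral_distr[symmetric]) (simp_all add: q)
  also have "\<dots> = (\<integral>\<^sup>+z. \<integral>\<^sup>+v. ennreal pi * indicator {0..} v * F z v \<partial>lborel \<partial>lborel)"
    unfolding distr_norm_square_plane by (intro nn_integral_cong nn_integral_density) simp_all
  finally show ?thesis .
qed

lemma norm_real3_square: "(norm (y::real^3))\<^sup>2 = (y$1)\<^sup>2 + (y$2)\<^sup>2 + (y$3)\<^sup>2"
  unfolding norm_vec_def L2_set_def sum_3 by (simp add: sum_nonneg)

lemma measurable_curried:
  assumes "(\<lambda>p. F (fst p) (snd p)) \<in> borel_measurable (borel :: (real \<times> real) measure)"
    and "f \<in> borel_measurable M" "g \<in> borel_measurable M"
  shows "(\<lambda>x. F (f x) (g x)) \<in> borel_measurable M"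
proof -
  have "(\<lambda>p. (f p, g p)) \<in> M \<rightarrow>\<^sub>M borel" using assms(2,3) by simp
  from measurable_compose[OF this assms(1)] show ?thesis by simp
qed

text \<open>With P = |y|^2, Q = |y - x|^2 and \<rho> = |x|, the quotient on the left is the
  component of y along x, so the left side says that it is at most |y| in absolute value. The right
  side is the triangle inequality for the three distances. For negative P both sides fail.\<close>

lemma bipolar_range_iff:
  assumes "\<rho> > 0"
  shows "((P + \<rho>\<^sup>2 - Q) / (2 * \<rho>))\<^sup>2 \<le> P \<longleftrightarrow> 0 \<le> P \<and> (sqrt P - \<rho>)\<^sup>2 \<le> Q \<and> Q \<le> (sqrt P + \<rho>)\<^sup>2"
proof (cases "0 \<le> P")
  case True
  define p where "p = sqrt P"
  have p: "0 \<le> p" "P = p\<^sup>2" using True by (simp_all add: p_def)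
  have "((P + \<rho>\<^sup>2 - Q) / (2 * \<rho>))\<^sup>2 \<le> P \<longleftrightarrow> \<bar>(P + \<rho>\<^sup>2 - Q) / (2 * \<rho>)\<bar> \<le> p"
    using p(1) by (simp add: p(2) abs_le_square_iff[symmetric])
  also have "\<dots> \<longleftrightarrow> \<bar>P + \<rho>\<^sup>2 - Q\<bar> \<le> 2 * \<rho> * p"
    using assms by (simp add: field_simps abs_if) 
  also have "\<dots> \<longleftrightarrow> (p - \<rho>)\<^sup>2 \<le> Q \<and> Q \<le> (p + \<rho>)\<^sup>2"
    by (auto simp: p(2) power2_eq_square algebra_simps abs_le_iff)
  finally show ?thesis using True by (simp add: p_def)
next
  case False
  then show ?thesis using zero_le_power2[of "(P + \<rho>\<^sup>2 - Q) / (2 * \<rho>)"] by linarith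
qed

lemma measurable_indicator_atLeast:
  fixes g h :: "'a \<Rightarrow> real"
  assumes [measurable]: "g \<in> borel_measurable M" "h \<in> borel_measurable M"
  shows "(\<lambda>x. indicator {g x..} (h x) :: ennreal) \<in> borel_measurable M"
proof -
  have "(\<lambda>x. indicator {g x..} (h x) :: ennreal) = (\<lambda>x. if g x \<le> h x then 1 else 0)"
    by (auto simp: indicator_def)
  then show ?thesis by simp
qed

text \<open>Bipolar coordinates, in the variables \<open>P = |y|\<^sup>2\<close> and \<open>Q = |y - x|\<^sup>2\<close>, for which the Jacobian
  is constant.\<close>

lemma nn_integral_bipolar:
  fixes F :: "real \<Rightarrow> real \<Rightarrow> ennreal" and x :: "real^3"
  assumes F: "(\<lambda>p. F (fst p) (snd p)) \<in> borel_measurable borel" and x: "x \<noteq> 0"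
  shows "(\<integral>\<^sup>+y. F ((norm y)\<^sup>2) ((norm (y - x))\<^sup>2) \<partial>lborel)
     = (\<integral>\<^sup>+P. \<integral>\<^sup>+Q. ennreal (pi / (2 * norm x)) * indicator {0..} P *
          indicator {(sqrt P - norm x)\<^sup>2..(sqrt P + norm x)\<^sup>2} Q * F P Q \<partial>lborel \<partial>lborel)"
proof -
  note [measurable] = measurable_curried[OF F] measurable_indicator_atLeast
  define \<rho> where "\<rho> = norm x"
  have \<rho>: "\<rho> > 0" using x by (simp add: \<rho>_def)
  let ?e = "\<rho> *\<^sub>R (axis 3 1 :: real^3)"
  \<comment> \<open>Rotating x onto the third axis makes both distances functions of the height and
    of the squared distance to the axis.\<close>
  obtain f where f: "orthogonal_transformation f" "f x = ?e"
    using orthogonal_transformation_exists[of x ?e] \<rho> by (auto simp: \<rho>_def)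
  have nf: "norm (f y - ?e) = norm (y - x)" "norm (f y) = norm y" for y
    using f by (metis orthogonal_transformation_norm orthogonal_transformation_linear linear_diff)+
  let ?G = "\<lambda>y. F ((norm y)\<^sup>2) ((norm (y - ?e))\<^sup>2)"
  have "(\<integral>\<^sup>+y. F ((norm y)\<^sup>2) ((norm (y - x))\<^sup>2) \<partial>lborel) = (\<integral>\<^sup>+y. ?G (f y) \<partial>lborel)"
    by (simp add: nf)
  also have "\<dots> = (\<integral>\<^sup>+y. ?G y \<partial>lborel)"
    by (rule nn_integral_orthogonal[OF f(1)]) measurable
  also have "\<dots> = (\<integral>\<^sup>+y. F (((y::real^3)$1)\<^sup>2 + (y$2)\<^sup>2 + (y$3)\<^sup>2) ((y$1)\<^sup>2 + (y$2)\<^sup>2 + (y$3 - \<rho>)\<^sup>2) \<partial>lborel)"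
    by (simp add: norm_real3_square axis_def)
  also have "\<dots> = (\<integral>\<^sup>+z. \<integral>\<^sup>+v. ennreal pi * indicator {0..} v * F (v + z\<^sup>2) (v + (z - \<rho>)\<^sup>2) \<partial>lborel \<partial>lborel)"
  proof (rule nn_integral_cylinder[where F = "\<lambda>z v. F (v + z\<^sup>2) (v + (z - \<rho>)\<^sup>2)"])
    show "(\<lambda>p. F (snd p + (fst p)\<^sup>2) (snd p + (fst p - \<rho>)\<^sup>2)) \<in> borel_measurable borel"
      by (intro measurable_curried[OF F] borel_measurable_continuous_onI continuous_intros)
  qed
  \<comment> \<open>For a fixed height z the variable P = v + z^2 replaces v. Then |y - x|^2 = P +
    \<rho>^2 - 2 * \<rho> * z is affine in z, so after exchanging the integrals the passage from z
    to Q is affine as well.\<close>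
  also have "\<dots> = (\<integral>\<^sup>+z. \<integral>\<^sup>+P. ennreal pi * indicator {z\<^sup>2..} P * F P (P + \<rho>\<^sup>2 - 2 * \<rho> * z) \<partial>lborel \<partial>lborel)"
  proof (rule nn_integral_cong)
    fix z :: real
    show "(\<integral>\<^sup>+v. ennreal pi * indicator {0..} v * F (v + z\<^sup>2) (v + (z - \<rho>)\<^sup>2) \<partial>lborel)
      = (\<integral>\<^sup>+P. ennreal pi * indicator {z\<^sup>2..} P * F P (P + \<rho>\<^sup>2 - 2 * \<rho> * z) \<partial>lborel)"
    proof -
      have "(\<lambda>P. ennreal pi * indicator {z\<^sup>2..} P * F P (P + \<rho>\<^sup>2 - 2 * \<rho> * z)) \<in> borel_measurable borel"
        by measurable
      from nn_integral_real_affine[OF this, of 1 "z\<^sup>2"]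
      have "(\<integral>\<^sup>+P. ennreal pi * indicator {z\<^sup>2..} P * F P (P + \<rho>\<^sup>2 - 2 * \<rho> * z) \<partial>lborel)
        = (\<integral>\<^sup>+v. ennreal pi * indicator {z\<^sup>2..} (z\<^sup>2 + v) * F (z\<^sup>2 + v) (z\<^sup>2 + v + \<rho>\<^sup>2 - 2 * \<rho> * z) \<partial>lborel)"
        by simp
      also have "\<dots> = (\<integral>\<^sup>+v. ennreal pi * indicator {0..} v * F (v + z\<^sup>2) (v + (z - \<rho>)\<^sup>2) \<partial>lborel)"
      proof (rule nn_integral_cong)
        fix v :: real
        have "indicator {z\<^sup>2..} (z\<^sup>2 + v) = (indicator {0..} v :: ennreal)" by (simp add: indicator_def)
        moreover have "z\<^sup>2 + v + \<rho>\<^sup>2 - 2 * \<rho> * z = v + (z - \<rho>)\<^sup>2" by (simp add: power2_diff)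
        ultimately show "ennreal pi * indicator {z\<^sup>2..} (z\<^sup>2 + v) * F (z\<^sup>2 + v) (z\<^sup>2 + v + \<rho>\<^sup>2 - 2 * \<rho> * z)
          = ennreal pi * indicator {0..} v * F (v + z\<^sup>2) (v + (z - \<rho>)\<^sup>2)" by (simp only: add.commute[of v])
      qed
      finally show ?thesis by (rule sym)
    qed
  qed
  also have "\<dots> = (\<integral>\<^sup>+P. \<integral>\<^sup>+z. ennreal pi * indicator {z\<^sup>2..} P * F P (P + \<rho>\<^sup>2 - 2 * \<rho> * z) \<partial>lborel \<partial>lborel)"
  proof (rule lborel_pair.Fubini'[symmetric])
    show "(\<lambda>(z, P). ennreal pi * indicator {z\<^sup>2..} P * F P (P + \<rho>\<^sup>2 - 2 * \<rho> * z))
        \<in> borel_measurable (lborel \<Otimes>\<^sub>M lborel)"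
      unfolding case_prod_unfold by measurable
  qed
  also have "\<dots> = (\<integral>\<^sup>+P. \<integral>\<^sup>+Q. ennreal (pi / (2 * \<rho>)) * indicator {0..} P *
          indicator {(sqrt P - \<rho>)\<^sup>2..(sqrt P + \<rho>)\<^sup>2} Q * F P Q \<partial>lborel \<partial>lborel)"
  proof (rule nn_integral_cong)
    fix P :: real
    have m: "(\<lambda>z. ennreal pi * indicator {z\<^sup>2..} P * F P (P + \<rho>\<^sup>2 - 2 * \<rho> * z)) \<in> borel_measurable borel"
      by measurable
    have "(\<integral>\<^sup>+z. ennreal pi * indicator {z\<^sup>2..} P * F P (P + \<rho>\<^sup>2 - 2 * \<rho> * z) \<partial>lborel)
      = ennreal (1 / (2 * \<rho>)) * (\<integral>\<^sup>+Q. ennreal pi * indicator {((P + \<rho>\<^sup>2 - Q) / (2 * \<rho>))\<^sup>2..} P * F P Q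
          \<partial>lborel)"
    proof -
      have e: "(P + \<rho>\<^sup>2) / (2 * \<rho>) + - (1 / (2 * \<rho>)) * Q = (P + \<rho>\<^sup>2 - Q) / (2 * \<rho>)"
        "P + \<rho>\<^sup>2 - 2 * \<rho> * ((P + \<rho>\<^sup>2 - Q) / (2 * \<rho>)) = Q" for Q
        using \<rho> by (simp add: diff_divide_distrib, simp)
      have c: "- (1 / (2 * \<rho>)) \<noteq> 0" "\<bar>- (1 / (2 * \<rho>))\<bar> = 1 / (2 * \<rho>)" using \<rho> by simp_all
      show ?thesis
        using nn_integral_real_affine[OF m c(1), of "(P + \<rho>\<^sup>2) / (2 * \<rho>)"] unfolding e c(2) .
    qed
    also have "\<dots> = (\<integral>\<^sup>+Q. ennreal (1 / (2 * \<rho>)) * (ennreal pi * indicator {((P + \<rho>\<^sup>2 - Q) / (2 * \<rho>))\<^sup>2..} P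
        * F P Q) \<partial>lborel)"
    proof (rule nn_integral_cmult[symmetric])
      show "(\<lambda>Q. ennreal pi * indicator {((P + \<rho>\<^sup>2 - Q) / (2 * \<rho>))\<^sup>2..} P * F P Q) \<in> borel_measurable lborel"
        by measurable
    qed
    also have "\<dots> = (\<integral>\<^sup>+Q. ennreal (pi / (2 * \<rho>)) * indicator {0..} P *
          indicator {(sqrt P - \<rho>)\<^sup>2..(sqrt P + \<rho>)\<^sup>2} Q * F P Q \<partial>lborel)"
    proof (rule nn_integral_cong)
      fix Q
      have "ennreal (pi / (2 * \<rho>)) = ennreal (1 / (2 * \<rho>)) * ennreal pi"
        using \<rho> by (simp add: ennreal_mult[symmetric])
      moreover have "indicator {((P + \<rho>\<^sup>2 - Q) / (2 * \<rho>))\<^sup>2..} P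
         = (indicator {0..} P * indicator {(sqrt P - \<rho>)\<^sup>2..(sqrt P + \<rho>)\<^sup>2} Q :: ennreal)"
        using bipolar_range_iff[OF \<rho>, of P Q] by (auto simp: indicator_def)
      ultimately show "ennreal (1 / (2 * \<rho>)) * (ennreal pi * indicator {((P + \<rho>\<^sup>2 - Q) / (2 * \<rho>))\<^sup>2..} P
          * F P Q)
         = ennreal (pi / (2 * \<rho>)) * indicator {0..} P * indicator {(sqrt P - \<rho>)\<^sup>2..(sqrt P + \<rho>)\<^sup>2} Q * F P Q"
        by (simp add: mult_ac)
    qed
    finally show "(\<integral>\<^sup>+z. ennreal pi * indicator {z\<^sup>2..} P * F P (P + \<rho>\<^sup>2 - 2 * \<rho> * z) \<partial>lborel)
      = (\<integral>\<^sup>+Q. ennreal (pi / (2 * \<rho>)) * indicator {0..} P *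
          indicator {(sqrt P - \<rho>)\<^sup>2..(sqrt P + \<rho>)\<^sup>2} Q * F P Q \<partial>lborel)" .
  qed
  finally show ?thesis by (simp only: \<rho>_def)
qed

text \<open>The inner integral over Q is assumed known as \<open>J\<close>. Only \<open>a\<close>
  may change sign, so the nonnegative formula is applied to \<open>a\<close> and to its negative,
  which yields integrability and value together.\<close>

lemma integral_bipolar:
  fixes a b J :: "real \<Rightarrow> real" and x :: "real^3"
  assumes [measurable]: "a \<in> borel_measurable borel" "b \<in> borel_measurable borel" "J \<in> borel_measurable borel"
    and x: "x \<noteq> 0" and b: "\<And>Q. 0 \<le> b Q" and J0: "\<And>P. 0 \<le> J P"
    and J: "\<And>P. 0 \<le> P \<Longrightarrow>
      (\<integral>\<^sup>+Q. indicator {(sqrt P - norm x)\<^sup>2..(sqrt P + norm x)\<^sup>2} Q * ennreal (b Q) \<partial>lborel) = ennreal (J P)"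
    and int: "integrable lborel (\<lambda>P. indicator {0..} P * (a P * J P))"
  shows "integrable lborel (\<lambda>y. a ((norm y)\<^sup>2) * b ((norm (y - x))\<^sup>2))" (is ?A)
    and "(\<integral>y. a ((norm y)\<^sup>2) * b ((norm (y - x))\<^sup>2) \<partial>lborel)
      = pi / (2 * norm x) * (\<integral>P. indicator {0..} P * (a P * J P) \<partial>lborel)" (is ?B)
proof -
  let ?c = "pi / (2 * norm x)"
  have c: "0 \<le> ?c" by simp
  have N: "(\<integral>\<^sup>+y. ennreal (a ((norm y)\<^sup>2) * b ((norm (y - x))\<^sup>2)) \<partial>lborel)
      = (\<integral>\<^sup>+P. ennreal (?c * (indicator {0..} P * (a P * J P))) \<partial>lborel)"
    if [measurable]: "a \<in> borel_measurable borel" for a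
  proof -
    have "(\<integral>\<^sup>+y. ennreal (a ((norm y)\<^sup>2) * b ((norm (y - x))\<^sup>2)) \<partial>lborel)
      = (\<integral>\<^sup>+P. \<integral>\<^sup>+Q. ennreal ?c * indicator {0..} P *
          indicator {(sqrt P - norm x)\<^sup>2..(sqrt P + norm x)\<^sup>2} Q * ennreal (a P * b Q) \<partial>lborel \<partial>lborel)"
      by (rule nn_integral_bipolar[where F = "\<lambda>P Q. ennreal (a P * b Q)", OF _ x])
         (unfold borel_prod[symmetric], measurable)
    also have "\<dots> = (\<integral>\<^sup>+P. ennreal (?c * (indicator {0..} P * (a P * J P))) \<partial>lborel)"
    proof (rule nn_integral_cong)
      fix P :: real
      have "(\<integral>\<^sup>+Q. ennreal ?c * indicator {0..} P *
          indicator {(sqrt P - norm x)\<^sup>2..(sqrt P + norm x)\<^sup>2} Q * ennreal (a P * b Q) \<partial>lborel)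
        = (\<integral>\<^sup>+Q. (ennreal ?c * indicator {0..} P * ennreal (a P)) *
          (indicator {(sqrt P - norm x)\<^sup>2..(sqrt P + norm x)\<^sup>2} Q * ennreal (b Q)) \<partial>lborel)"
        by (intro nn_integral_cong) (simp add: ennreal_mult'' b mult_ac)
      also have "\<dots> = (ennreal ?c * indicator {0..} P * ennreal (a P)) *
          (\<integral>\<^sup>+Q. indicator {(sqrt P - norm x)\<^sup>2..(sqrt P + norm x)\<^sup>2} Q * ennreal (b Q) \<partial>lborel)"
        by (rule nn_integral_cmult) simp
      also have "\<dots> = ennreal (?c * (indicator {0..} P * (a P * J P)))"
        unfolding ennreal_mult'[OF c]
        using J[of P] ennreal_mult''[OF J0, of "a P" P] by (cases "0 \<le> P") (simp_all add: mult_ac)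
      finally show "(\<integral>\<^sup>+Q. ennreal ?c * indicator {0..} P *
          indicator {(sqrt P - norm x)\<^sup>2..(sqrt P + norm x)\<^sup>2} Q * ennreal (a P * b Q) \<partial>lborel)
        = ennreal (?c * (indicator {0..} P * (a P * J P)))" .
    qed
    finally show ?thesis .
  qed
  have N': "(\<integral>\<^sup>+y. ennreal (- (a ((norm y)\<^sup>2) * b ((norm (y - x))\<^sup>2))) \<partial>lborel)
      = (\<integral>\<^sup>+P. ennreal (- (?c * (indicator {0..} P * (a P * J P)))) \<partial>lborel)"
    using N[of "\<lambda>P. - a P"] by simp
  have int': "integrable lborel (\<lambda>P. ?c * (indicator {0..} P * (a P * J P)))"
    using int by simp
  from int' have fin: "(\<integral>\<^sup>+P. ennreal (?c * (indicator {0..} P * (a P * J P))) \<partial>lborel) \<noteq> \<infinity>"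
    "(\<integral>\<^sup>+P. ennreal (- (?c * (indicator {0..} P * (a P * J P)))) \<partial>lborel) \<noteq> \<infinity>"
    unfolding real_integrable_def by auto
  show ?A unfolding real_integrable_def using N[of a] N' fin by simp
  then have "(\<integral>y. a ((norm y)\<^sup>2) * b ((norm (y - x))\<^sup>2) \<partial>lborel)
     = (\<integral>P. ?c * (indicator {0..} P * (a P * J P)) \<partial>lborel)"
    using int' by (simp only: real_lebesgue_integral_def N[OF assms(1)] N')
  then show ?B by simp
qed

text \<open>The case b = 1 of bipolar coordinates around a unit vector: the range of Q has length
  (sqrt P + 1)^2 - (sqrt P - 1)^2 = 4 * sqrt P.\<close>

lemma integral_polar:
  fixes a :: "real \<Rightarrow> real"
  assumes [measurable]: "a \<in> borel_measurable borel"
    and int: "integrable lborel (\<lambda>P. indicator {0..} P * (a P * sqrt P))"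
  shows "integrable lborel (\<lambda>y::real^3. a ((norm y)\<^sup>2))" (is ?A)
    and "(\<integral>y. a ((norm (y::real^3))\<^sup>2) \<partial>lborel) = 2 * pi
        * (\<integral>P. indicator {0..} P * (a P * sqrt P) \<partial>lborel)" (is ?B)
proof -
  define e where "e = (axis 1 1 :: real^3)"
  have e: "e \<noteq> 0" "norm e = 1" by (simp_all add: e_def axis_eq_0_iff)
  \<comment> \<open>\<open>integral_bipolar\<close> wants a weight that is nonnegative for every
    real P, and \<open>sqrt\<close> is negative at negative arguments; hence the absolute
    value.\<close>
  have J: "(\<integral>\<^sup>+Q. indicator {(sqrt P - norm e)\<^sup>2..(sqrt P + norm e)\<^sup>2} Q * ennreal 1 \<partial>lborel)
      = ennreal (4 * \<bar>sqrt P\<bar>)"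
    if "0 \<le> P" for P
  proof -
    have le: "(sqrt P - 1)\<^sup>2 \<le> (sqrt P + 1)\<^sup>2" using that by (simp add: power2_eq_square algebra_simps)
    then show ?thesis using that by (simp add: e power2_eq_square algebra_simps)
  qed
  have eq: "(\<lambda>P. indicator {0..} P * (a P * (4 * \<bar>sqrt P\<bar>))) = (\<lambda>P. 4 * (indicator {0..} P * (a P * sqrt P)))"
    by (auto simp: indicator_def)
  have "integrable lborel (\<lambda>P. indicator {0..} P * (a P * (4 * \<bar>sqrt P\<bar>)))"
    unfolding eq using int by simp
  from integral_bipolar[where b = "\<lambda>_. 1" and a = a, OF _ _ _ e(1) _ _ J this]
  show ?A ?B unfolding eq by (simp_all add: e)
qed

lemma integral_sqrt_substitution:
  fixes g :: "real \<Rightarrow> real"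
  assumes g: "continuous_on {0..R} g" and R: "0 \<le> R"
  shows "integrable lborel (\<lambda>P. indicator {0..R\<^sup>2} P * (g (sqrt P) / sqrt P))" (is ?A)
    and "(\<integral>P. indicator {0..R\<^sup>2} P * (g (sqrt P) / sqrt P) \<partial>lborel) = 2 * integral {0..R} g" (is ?B)
proof -
  have sq: "sqrt P \<in> {0..R}" if "P \<in> {0..R\<^sup>2}" for P
  proof -
    have "sqrt P \<le> R" by (rule real_le_lsqrt) (use that R in simp_all)
    then show ?thesis using that by simp
  qed
  \<comment> \<open>Stated for an arbitrary \<open>k\<close>, because it is used twice: for |g|, to
    get absolute integrability in spite of the singularity at P = 0, and for g, to get the
    value.\<close>
  have hi: "((\<lambda>P. k (sqrt P) / sqrt P) has_integral 2 * integral {0..R} k) {0..R\<^sup>2}"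
    if k: "continuous_on {0..R} k" for k :: "real \<Rightarrow> real"
  proof -
    define G where "G u = integral {0..u} k" for u
    have G: "(G has_vector_derivative k u) (at u within {0..R})" if "u \<in> {0..R}" for u
      unfolding G_def by (rule integral_has_vector_derivative[OF k that])
    then have Gc: "continuous_on {0..R} G"
      by (meson continuous_on_eq_continuous_within has_vector_derivative_continuous)
    have "((\<lambda>P. k (sqrt P) / sqrt P) has_integral 2 * G (sqrt (R\<^sup>2)) - 2 * G (sqrt 0)) {0..R\<^sup>2}"
    proof (rule fundamental_theorem_of_calculus_interior)
      show "continuous_on {0..R\<^sup>2} (\<lambda>P. 2 * G (sqrt P))"
        using sq by (intro continuous_on_mult continuous_on_const continuous_on_compose2[OF Gc, of
            "{0..R\<^sup>2}" sqrt] continuous_on_real_sqrt continuous_on_id) blast+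
      fix P assume P: "P \<in> {0<..<R\<^sup>2}"
      then have s: "sqrt P \<in> {0<..<R}" 
      proof -
        have "sqrt P < R" by (rule real_less_lsqrt) (use P R in simp_all)
        then show ?thesis using P by simp
      qed
      then have "(G has_real_derivative k (sqrt P)) (at (sqrt P))"
        using G[of "sqrt P"] at_within_Icc_at[of 0 "sqrt P" R]
        by (simp add: has_real_derivative_iff_has_vector_derivative)
      moreover have "(sqrt has_real_derivative inverse (sqrt P) / 2) (at P)"
        using P by (intro DERIV_real_sqrt) auto
      ultimately have "((\<lambda>P. G (sqrt P)) has_real_derivative k (sqrt P) * (inverse (sqrt P) / 2)) (at P)"
        by (rule DERIV_chain2)
      then have "((\<lambda>P. 2 * G (sqrt P)) has_real_derivative 2 * (k (sqrt P) * (inverse (sqrt P) / 2))) (at P)"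
        by (rule DERIV_cmult)
      then show "((\<lambda>P. 2 * G (sqrt P)) has_vector_derivative k (sqrt P) / sqrt P) (at P)"
        unfolding has_real_derivative_iff_has_vector_derivative[symmetric] by (simp add: field_simps)
    qed simp
    then show ?thesis using R by (simp add: G_def)
  qed
  have kc: "continuous_on {0..R\<^sup>2} (\<lambda>P. k (sqrt P))" if "continuous_on {0..R} k" for k :: "real \<Rightarrow> real"
    using sq by (intro continuous_on_compose2[OF that, of
        "{0..R\<^sup>2}" sqrt] continuous_on_real_sqrt continuous_on_id) blast+
  have meas: "(\<lambda>P. indicator {0..R\<^sup>2} P * (g (sqrt P) / sqrt P)) \<in> borel_measurable borel"
  proof -
    have m: "(\<lambda>P. indicator {0..R\<^sup>2} P *\<^sub>R g (sqrt P)) \<in> borel_measurable borel"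
      by (rule borel_measurable_continuous_on_indicator[OF _ kc[OF g]]) simp
    have "(\<lambda>P. indicator {0..R\<^sup>2} P * (g (sqrt P) / sqrt P))
        = (\<lambda>P. (indicator {0..R\<^sup>2} P *\<^sub>R g (sqrt P)) / sqrt P)"
      by auto
    then show ?thesis using borel_measurable_divide[OF m borel_measurable_sqrt]
      by (simp only:)
  qed
  have abs: "((\<lambda>P. \<bar>g (sqrt P)\<bar> / sqrt P) has_integral 2 * integral {0..R} (\<lambda>u. \<bar>g u\<bar>)) {0..R\<^sup>2}"
    by (rule hi[of "\<lambda>u. \<bar>g u\<bar>"]) (intro continuous_on_rabs g)
  show ?A
  proof (rule integrableI_bounded)
    have "(\<integral>\<^sup>+P. ennreal (norm (indicator {0..R\<^sup>2} P * (g (sqrt P) / sqrt P))) \<partial>lborel)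
      = (\<integral>\<^sup>+P. ennreal (indicator {0..R\<^sup>2} P * (\<bar>g (sqrt P)\<bar> / sqrt P)) \<partial>lborel)"
      by (intro nn_integral_cong) (auto simp: indicator_def)
    also have "\<dots> = ennreal (2 * integral {0..R} (\<lambda>u. \<bar>g u\<bar>))"
      by (rule nn_integral_has_integral_lebesgue[OF _ abs]) auto
    finally show "(\<integral>\<^sup>+P. ennreal (norm (indicator {0..R\<^sup>2} P * (g (sqrt P) / sqrt P))) \<partial>lborel) < \<infinity>" by simp
  qed (use meas in simp)
  then have "((\<lambda>P. indicator {0..R\<^sup>2} P * (g (sqrt P) / sqrt P)) has_integral
      (\<integral>P. indicator {0..R\<^sup>2} P * (g (sqrt P) / sqrt P) \<partial>lborel)) UNIV"
    by (rule has_integral_integral_lborel)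
  moreover have "((\<lambda>P. indicator {0..R\<^sup>2} P * (g (sqrt P) / sqrt P)) has_integral 2 * integral {0..R} g) UNIV"
  proof -
    have "(\<lambda>P. indicator {0..R\<^sup>2} P * (g (sqrt P) / sqrt P))
      = (\<lambda>P. if P \<in> {0..R\<^sup>2} then g (sqrt P) / sqrt P else 0)"
      by (auto simp: indicator_def)
    then show ?thesis using hi[OF g] by (simp only: has_integral_restrict_UNIV)
  qed
  ultimately show ?B by (rule has_integral_unique)
qed

section \<open>Exponential potentials of radial densities\<close>

text \<open>Index i stands for the i-th derivative in u of (u / t + 1 / t^2) * exp (- t u), an
  antiderivative of - u * exp (- t u). Integrating exp (- t |x - y|) over a sphere centred at 0
  produces differences of its values. The last branch is the case i = 4, the highest one
  needed.\<close>

definition exp_kernel :: "nat \<Rightarrow> real \<Rightarrow> real \<Rightarrow> real" where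
  "exp_kernel i t u = (case i of
      0 \<Rightarrow> u / t + 1 / t\<^sup>2 | Suc 0 \<Rightarrow> - u | Suc (Suc 0) \<Rightarrow> t * u - 1
    | Suc (Suc (Suc 0)) \<Rightarrow> 2 * t - t\<^sup>2 * u | _ \<Rightarrow> t^3 * u - 3 * t\<^sup>2) * exp (- (t * u))"

lemma exp_kernel_simps:
  "exp_kernel 0 t u = (u / t + 1 / t\<^sup>2) * exp (- (t * u))"
  "exp_kernel 1 t u = - u * exp (- (t * u))"
  "exp_kernel 2 t u = (t * u - 1) * exp (- (t * u))"
  "exp_kernel 3 t u = (2 * t - t\<^sup>2 * u) * exp (- (t * u))"
  "exp_kernel 4 t u = (t^3 * u - 3 * t\<^sup>2) * exp (- (t * u))"
  by (simp_all add: exp_kernel_def numeral_eq_Suc)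

lemma exp_kernel_DERIV:
  assumes "t > 0"
  shows "(exp_kernel 0 t has_real_derivative exp_kernel 1 t u) (at u)"
    "(exp_kernel 1 t has_real_derivative exp_kernel 2 t u) (at u)"
    "(exp_kernel 2 t has_real_derivative exp_kernel 3 t u) (at u)"
    "(exp_kernel 3 t has_real_derivative exp_kernel 4 t u) (at u)"
  unfolding exp_kernel_simps[abs_def]
  using assms by (auto intro!: derivative_eq_intros simp: field_simps power2_eq_square power3_eq_cube)

lemma exp_kernel_ode: "t > 0 \<Longrightarrow> exp_kernel 4 t u = 2 * t\<^sup>2 * exp_kernel 2 t u - t^4 * exp_kernel 0 t u"
  by (simp add: exp_kernel_simps field_simps power2_eq_square power3_eq_cube power4_eq_xxxx)

text \<open>Lagrange's identity for the self-adjoint operator L = (D^2 - t^2)^2: k * L f - f * L k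
  is the derivative of a bilinear concomitant, and the assumption \<open>ode\<close> says that L k
  vanishes.\<close>

lemma concomitant_DERIV:
  fixes k f :: "nat \<Rightarrow> real \<Rightarrow> real"
  assumes k: "\<And>i. i < 4 \<Longrightarrow> (k i has_real_derivative k (Suc i) p) (at p within S)"
    and f: "\<And>i. i < 4 \<Longrightarrow> (f i has_real_derivative f (Suc i) p) (at p within S)"
    and ode: "k 4 p = 2 * t\<^sup>2 * k 2 p - t^4 * k 0 p"
  shows "((\<lambda>p. k 0 p * f 3 p - k 1 p * f 2 p + k 2 p * f 1 p - k 3 p * f 0 p
      - 2 * t\<^sup>2 * (k 0 p * f 1 p - k 1 p * f 0 p))
      has_real_derivative (t^4 * f 0 p - 2 * t\<^sup>2 * f 2 p + f 4 p) * k 0 p) (at p within S)"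
proof -
  have K: "(k 0 has_real_derivative k 1 p) (at p within S)" "(k 1 has_real_derivative k 2 p) (at p within S)"
      "(k 2 has_real_derivative k 3 p) (at p within S)" "(k 3 has_real_derivative k 4 p) (at p within S)"
    using k[of 0] k[of 1] k[of 2] k[of 3] by (simp_all add: eval_nat_numeral)
  have F: "(f 0 has_real_derivative f 1 p) (at p within S)" "(f 1 has_real_derivative f 2 p) (at p within S)"
      "(f 2 has_real_derivative f 3 p) (at p within S)" "(f 3 has_real_derivative f 4 p) (at p within S)"
    using f[of 0] f[of 1] f[of 2] f[of 3] by (simp_all add: eval_nat_numeral)
  show ?thesis
    by (rule derivative_eq_intros K F refl)+ (simp add: ode algebra_simps)
qed

lemma exp_kernel_antimono:
  assumes t: "t > 0" and "0 \<le> u" "u \<le> v"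
  shows "exp_kernel 0 t v \<le> exp_kernel 0 t u"
proof (rule DERIV_nonpos_imp_nonincreasing[OF assms(3)])
  fix x assume "u \<le> x" "x \<le> v"
  then show "\<exists>y. (exp_kernel 0 t has_real_derivative y) (at x) \<and> y \<le> 0"
    using exp_kernel_DERIV(1)[OF t, of x] assms(2)
    by (intro exI[of _ "exp_kernel 1 t x"]) (auto simp: exp_kernel_simps(2)[unfolded One_nat_def])
qed

lemma continuous_on_exp_kernel: "t > 0 \<Longrightarrow> continuous_on S (exp_kernel 0 t)"
  by (meson DERIV_continuous continuous_at_imp_continuous_on exp_kernel_DERIV(1))

lemma nn_integral_exp_sqrt:
  assumes t: "t > 0" and ab: "0 \<le> \<alpha>" "\<alpha> \<le> \<beta>"
  shows "(\<integral>\<^sup>+Q. indicator {\<alpha>\<^sup>2..\<beta>\<^sup>2} Q * ennreal (exp (- (t * sqrt Q))) \<partial>lborel)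
    = ennreal (2 * (exp_kernel 0 t \<alpha> - exp_kernel 0 t \<beta>))"
proof -
  have "((\<lambda>Q. exp (- (t * sqrt Q))) has_integral
      (- 2 * exp_kernel 0 t (sqrt (\<beta>\<^sup>2))) - (- 2 * exp_kernel 0 t (sqrt (\<alpha>\<^sup>2)))) {\<alpha>\<^sup>2..\<beta>\<^sup>2}"
  proof (rule fundamental_theorem_of_calculus_interior)
    show "\<alpha>\<^sup>2 \<le> \<beta>\<^sup>2" using ab by (simp add: power_mono)
    show "continuous_on {\<alpha>\<^sup>2..\<beta>\<^sup>2} (\<lambda>Q. - 2 * exp_kernel 0 t (sqrt Q))"
      by (intro continuous_on_mult continuous_on_const
          continuous_on_compose2[OF continuous_on_exp_kernel[OF t, of UNIV], of _ sqrt]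
          continuous_on_real_sqrt continuous_on_id) simp
    fix Q assume "Q \<in> {\<alpha>\<^sup>2<..<\<beta>\<^sup>2}"
    then have Q: "Q > 0" using le_less_trans[OF zero_le_power2[of \<alpha>], of Q] by simp
    have "((\<lambda>Q. exp_kernel 0 t (sqrt Q)) has_real_derivative
        exp_kernel 1 t (sqrt Q) * (inverse (sqrt Q) / 2)) (at Q)"
      by (rule DERIV_chain2[OF exp_kernel_DERIV(1)[OF t] DERIV_real_sqrt[OF Q]])
    then have "((\<lambda>Q. - 2 * exp_kernel 0 t (sqrt Q)) has_real_derivative
        - 2 * (exp_kernel 1 t (sqrt Q) * (inverse (sqrt Q) / 2))) (at Q)"
      by (rule DERIV_cmult)
    moreover have "- 2 * (exp_kernel 1 t (sqrt Q) * (inverse (sqrt Q) / 2)) = exp (- (t * sqrt Q))"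
      using Q unfolding exp_kernel_simps(2) by simp
    ultimately show "((\<lambda>Q. - 2 * exp_kernel 0 t (sqrt Q)) has_vector_derivative exp (- (t * sqrt Q))) (at Q)"
      unfolding has_real_derivative_iff_has_vector_derivative[symmetric] by simp
  qed
  then have I: "((\<lambda>Q. exp (- (t * sqrt Q))) has_integral 2 * (exp_kernel 0 t \<alpha> - exp_kernel 0 t \<beta>)) {\<alpha>\<^sup>2..\<beta>\<^sup>2}"
    using ab by (simp add: algebra_simps)
  have "(\<integral>\<^sup>+Q. indicator {\<alpha>\<^sup>2..\<beta>\<^sup>2} Q * ennreal (exp (- (t * sqrt Q))) \<partial>lborel)
    = (\<integral>\<^sup>+Q. ennreal (indicator {\<alpha>\<^sup>2..\<beta>\<^sup>2} Q * exp (- (t * sqrt Q))) \<partial>lborel)"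
    by (intro nn_integral_cong) (auto simp: indicator_def)
  also have "\<dots> = ennreal (2 * (exp_kernel 0 t \<alpha> - exp_kernel 0 t \<beta>))"
    by (rule nn_integral_has_integral_lebesgue[OF _ I]) simp
  finally show ?thesis .
qed

text \<open>The quotient by the norm reflects the radial Laplacian, under which p * F(p) is
  differentiated twice as a function of one variable. At the origin the quotient is 0 by convention,
  which affects only a null set.\<close>

definition radial_density :: "real \<Rightarrow> (real \<Rightarrow> real) \<Rightarrow> real^3 \<Rightarrow> real" where
  "radial_density R g y = indicator {0..R} (norm y) * (g (norm y) / norm y)"

lemma radial_density_sqr:
  assumes "0 \<le> R"
  shows "radial_density R g y = (\<lambda>P. indicator {0..R\<^sup>2} P * (g (sqrt P) / sqrt P)) ((norm y)\<^sup>2)"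
proof -
  have "(norm y)\<^sup>2 \<le> R\<^sup>2 \<longleftrightarrow> norm y \<le> R"
    using assms abs_le_square_iff[of "norm y" R] by simp
  then show ?thesis by (simp add: radial_density_def indicator_def)
qed

lemma radial_profile_measurable:
  assumes "continuous_on {0..R} g" "0 \<le> R"
  shows "(\<lambda>P. indicator {0..R\<^sup>2} P * (g (sqrt P) / sqrt P)) \<in> borel_measurable borel"
  using borel_measurable_integrable[OF integral_sqrt_substitution(1)[OF assms]] by simp

lemma radial_density_mass:
  assumes g: "continuous_on {0..R} g" and R: "0 \<le> R"
  shows "integrable lborel (radial_density R g)"
    and "(\<integral>y. radial_density R g y \<partial>lborel) = 4 * pi * integral {0..R} (\<lambda>p. g p * p)"
proof -
  let ?a = "\<lambda>P. indicator {0..R\<^sup>2} P * (g (sqrt P) / sqrt P)"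
  have gp: "continuous_on {0..R} (\<lambda>p. g p * p)" by (intro continuous_intros g)
  have eq: "(\<lambda>P. indicator {0..} P * (?a P * sqrt P))
      = (\<lambda>P. indicator {0..R\<^sup>2} P * ((g (sqrt P) * sqrt P) / sqrt P))"
    by (auto simp: indicator_def)
  have int: "integrable lborel (\<lambda>P. indicator {0..} P * (?a P * sqrt P))"
    unfolding eq by (rule integral_sqrt_substitution(1)[OF gp R])
  note pol = integral_polar[OF radial_profile_measurable[OF g R] int]
  show "integrable lborel (radial_density R g)"
    using pol(1) by (simp only: radial_density_sqr[OF R, abs_def])
  show "(\<integral>y. radial_density R g y \<partial>lborel) = 4 * pi * integral {0..R} (\<lambda>p. g p * p)"
    using pol(2) unfolding eq integral_sqrt_substitution(2)[OF gp R]
    by (simp only: radial_density_sqr[OF R, abs_def])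
qed

text \<open>In bipolar coordinates the integral over Q, with Q = u^2, becomes twice the integral of
  u * exp (- t u) from |p - |x|| to p + |x|; this turns the potential into a one-dimensional
  integral.\<close>

lemma radial_density_potential:
  assumes g: "continuous_on {0..R} g" and R: "0 \<le> R" and t: "t > 0" and x: "x \<noteq> 0"
  shows "(\<integral>y. radial_density R g y * exp (- (t * norm (x - y))) \<partial>lborel)
    = 2 * pi / norm x * integral {0..R} (\<lambda>p. g p * (exp_kernel 0 t \<bar>p - norm x\<bar> - exp_kernel 0 t (p + norm x)))"
proof -
  define \<kappa> where "\<kappa> p = exp_kernel 0 t \<bar>p - norm x\<bar> - exp_kernel 0 t (p + norm x)" for p
  let ?a = "\<lambda>P. indicator {0..R\<^sup>2} P * (g (sqrt P) / sqrt P)"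
  let ?J = "\<lambda>P. 2 * \<kappa> \<bar>sqrt P\<bar>"
  have kc: "continuous_on S \<kappa>" for S
    unfolding \<kappa>_def by (intro continuous_intros continuous_on_compose2[OF
        continuous_on_exp_kernel[OF t, of UNIV]]) auto
  have k0: "0 \<le> \<kappa> p" if "0 \<le> p" for p
  proof -
    have "\<bar>p - norm x\<bar> \<le> p + norm x" using that norm_ge_zero[of x] by linarith
    then show ?thesis
      using exp_kernel_antimono[OF t, of "\<bar>p - norm x\<bar>" "p + norm x"] by (simp add: \<kappa>_def)
  qed
  have kg: "continuous_on {0..R} (\<lambda>p. g p * (2 * \<kappa> p))" by (intro continuous_intros g kc)
  have eq: "(\<lambda>P. indicator {0..} P * (?a P * ?J P))
      = (\<lambda>P. indicator {0..R\<^sup>2} P * ((g (sqrt P) * (2 * \<kappa> (sqrt P))) / sqrt P))"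
    by (auto simp: indicator_def)
  have int: "integrable lborel (\<lambda>P. indicator {0..} P * (?a P * ?J P))"
    unfolding eq by (rule integral_sqrt_substitution(1)[OF kg R])
  have km: "\<kappa> \<in> borel_measurable borel" using kc by (rule borel_measurable_continuous_onI)
  have Jm: "?J \<in> borel_measurable borel"
    using measurable_compose[OF _ km, of "\<lambda>P. \<bar>sqrt P\<bar>" borel] by simp
  have bm: "(\<lambda>Q. exp (- (t * sqrt Q))) \<in> borel_measurable borel" by simp
  have J: "(\<integral>\<^sup>+Q. indicator {(sqrt P - norm x)\<^sup>2..(sqrt P + norm x)\<^sup>2} Q
      * ennreal (exp (- (t * sqrt Q))) \<partial>lborel) = ennreal (?J P)"
    if "0 \<le> P" for P
  proof -
    have "0 \<le> sqrt P" using that by simp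
    then have "\<bar>sqrt P - norm x\<bar> \<le> sqrt P + norm x" using norm_ge_zero[of x] by linarith
    then show ?thesis
      using nn_integral_exp_sqrt[OF t, of "\<bar>sqrt P - norm x\<bar>" "sqrt P + norm x"] that
      by (simp add: \<kappa>_def)
  qed
  have "(\<integral>y. ?a ((norm y)\<^sup>2) * exp (- (t * sqrt ((norm (y - x))\<^sup>2))) \<partial>lborel)
      = pi / (2 * norm x) * (\<integral>P. indicator {0..} P * (?a P * ?J P) \<partial>lborel)"
    by (rule integral_bipolar(2)[OF radial_profile_measurable[OF g R] bm Jm x _ _ J int]) (simp_all add: k0)
  also have "\<dots> = pi / (2 * norm x) * (2 * integral {0..R} (\<lambda>p. 2 * (g p * \<kappa> p)))"
    unfolding eq integral_sqrt_substitution(2)[OF kg R] by (simp add: mult.left_commute)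
  also have "\<dots> = 2 * pi / norm x * integral {0..R} (\<lambda>p. g p * \<kappa> p)" by simp
  finally show ?thesis
    by (simp add: radial_density_sqr[OF R] \<kappa>_def norm_minus_commute)
qed

text \<open>The kernel solves the fourth order equation on both sides of \<rho>, so Lagrange's
  identity reduces the integral to values of the concomitant at 0, \<rho> and R. The conditions
  \<open>bc\<close> say that (D + t)^2 f vanishes to first order at R, that is, f fits up to its
  third derivative to a solution (A + B p) * exp (- t p); no layer on the sphere of radius R is then
  required.\<close>

lemma integral_exp_kernel_inside:
  fixes f :: "nat \<Rightarrow> real \<Rightarrow> real"
  assumes t: "t > 0" and \<rho>: "0 < \<rho>" "\<rho> \<le> R"
    and f: "\<And>i p. i < 4 \<Longrightarrow> p \<in> {0..R} \<Longrightarrow> (f i has_real_derivative f (Suc i) p) (at p within {0..R})"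
    and f0: "f 0 0 = 0" "f 2 0 = 0"
    and bc: "f 2 R = - 2 * t * f 1 R - t\<^sup>2 * f 0 R" "f 3 R = 3 * t\<^sup>2 * f 1 R + 2 * t^3 * f 0 R"
  shows "((\<lambda>p. (t^4 * f 0 p - 2 * t\<^sup>2 * f 2 p + f 4 p) * (exp_kernel 0 t \<bar>p - \<rho>\<bar> - exp_kernel 0 t (p + \<rho>)))
      has_integral 4 * t * f 0 \<rho>) {0..R}"
proof -
  define L where "L p = t^4 * f 0 p - 2 * t\<^sup>2 * f 2 p + f 4 p" for p
  \<comment> \<open>\<open>k1\<close> and \<open>k2\<close> are the kernel and its derivatives to
    the left and to the right of \<rho>. The sign comes from differentiating in p a function of
    \<rho> - p.\<close>
  define k1 where "k1 i p = (-1)^i * exp_kernel i t (\<rho> - p) - exp_kernel i t (p + \<rho>)" for i p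
  define k2 where "k2 i p = exp_kernel i t (p - \<rho>) - exp_kernel i t (p + \<rho>)" for i p
  define W where "W (k :: nat \<Rightarrow> real \<Rightarrow> real) p = k 0 p * f 3 p - k 1 p * f 2 p + k 2 p * f 1 p - k 3 p * f 0 p
      - 2 * t\<^sup>2 * (k 0 p * f 1 p - k 1 p * f 0 p)" for k p
  have D: "(exp_kernel i t has_real_derivative exp_kernel (Suc i) t u) (at u)" if "i < 4" for i u
  proof -
    from that have "i = 0 \<or> i = 1 \<or> i = 2 \<or> i = 3" by auto
    then show ?thesis using exp_kernel_DERIV[OF t, of u] by (auto simp: eval_nat_numeral)
  qed
  have D1: "(k1 i has_real_derivative k1 (Suc i) p) (at p within S)" if "i < 4" for i p S
    unfolding k1_def by (rule derivative_eq_intros DERIV_chain2[OF D[OF that]] | simp)+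
  have D2: "(k2 i has_real_derivative k2 (Suc i) p) (at p within S)" if "i < 4" for i p S
    unfolding k2_def by (rule derivative_eq_intros DERIV_chain2[OF D[OF that]] | simp)+
  have ode: "k1 4 p = 2 * t\<^sup>2 * k1 2 p - t^4 * k1 0 p" "k2 4 p = 2 * t\<^sup>2 * k2 2 p - t^4 * k2 0 p" for p
    unfolding k1_def k2_def exp_kernel_ode[OF t] by (simp_all add: algebra_simps)
  have I1: "((\<lambda>p. L p * k1 0 p) has_integral W k1 \<rho> - W k1 0) {0..\<rho>}"
    unfolding L_def W_def has_real_derivative_iff_has_vector_derivative[symmetric]
    apply (rule fundamental_theorem_of_calculus)
    subgoal using \<rho> by simp
    unfolding has_real_derivative_iff_has_vector_derivative[symmetric]
    apply (rule concomitant_DERIV[OF D1 _ ode(1)])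
     apply simp
    apply (rule DERIV_subset[OF f])
    using \<rho> by auto
  have I2: "((\<lambda>p. L p * k2 0 p) has_integral W k2 R - W k2 \<rho>) {\<rho>..R}"
    unfolding L_def W_def
    apply (rule fundamental_theorem_of_calculus)
    subgoal using \<rho> by simp
    unfolding has_real_derivative_iff_has_vector_derivative[symmetric]
    apply (rule concomitant_DERIV[OF D2 _ ode(2)])
     apply simp
    apply (rule DERIV_subset[OF f])
    using \<rho> by auto
  have J1: "((\<lambda>p. L p * (exp_kernel 0 t \<bar>p - \<rho>\<bar> - exp_kernel 0 t (p + \<rho>))) has_integral W k1 \<rho> - W k1 0) {0..\<rho>}"
    by (rule has_integral_eq[OF _ I1]) (auto simp: k1_def)
  have J2: "((\<lambda>p. L p * (exp_kernel 0 t \<bar>p - \<rho>\<bar> - exp_kernel 0 t (p + \<rho>))) has_integral W k2 R - W k2 \<rho>) {\<rho>..R}"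
    by (rule has_integral_eq[OF _ I2]) (auto simp: k2_def)
  \<comment> \<open>At p = 0 the even derivatives of the kernel cancel, and the odd ones are
    multiplied by \<open>f 0 0\<close> or \<open>f 2 0\<close>.\<close>
  have W10: "W k1 0 = 0"
    using f0 by (simp add: W_def k1_def)
  \<comment> \<open>Near R both terms of \<open>k2\<close> and, to third order, \<open>f\<close> are
    of the form (A + B p) * exp (- t p). The concomitant of two such solutions is constant and
    decays, hence is 0.\<close>
  have W2R: "W k2 R = 0"
  proof -
    have "W (\<lambda>i p. exp_kernel i t (p + c)) R = 0" for c
      using t by (simp add: W_def bc exp_kernel_simps[simplified] field_simps power2_eq_square power3_eq_cube)
    from this[of "-\<rho>"] this[of \<rho>] show ?thesis
      by (simp add: W_def k2_def algebra_simps)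
  qed
  \<comment> \<open>Only odd derivatives jump at \<rho>, by - 2 times their value at 0. This value
    is 0 for the first and 2 * t for the third derivative, which leaves 4 * t * f(\<rho>).\<close>
  have "W k1 \<rho> - W k2 \<rho> = 4 * t * f 0 \<rho>"
    by (simp add: W_def k1_def k2_def exp_kernel_simps[simplified] algebra_simps)
  with has_integral_combine[OF _ _ J1 J2] \<rho> W10 W2R show ?thesis
    by (simp add: L_def)
qed

text \<open>Now \<rho> is not interior to the interval, so there is no jump; the boundary term at R
  disappears because f has a fourfold zero there.\<close>

lemma integral_exp_kernel_outside:
  fixes f :: "nat \<Rightarrow> real \<Rightarrow> real"
  assumes t: "t > 0" and \<rho>: "0 \<le> R" "R \<le> \<rho>"
    and f: "\<And>i p. i < 4 \<Longrightarrow> p \<in> {0..R} \<Longrightarrow> (f i has_real_derivative f (Suc i) p) (at p within {0..R})"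
    and f0: "f 0 0 = 0" "f 2 0 = 0" and fR: "\<And>i. i < 4 \<Longrightarrow> f i R = 0"
  shows "((\<lambda>p. (t^4 * f 0 p - 2 * t\<^sup>2 * f 2 p + f 4 p) * (exp_kernel 0 t \<bar>p - \<rho>\<bar> - exp_kernel 0 t (p + \<rho>)))
      has_integral 0) {0..R}"
proof -
  define L where "L p = t^4 * f 0 p - 2 * t\<^sup>2 * f 2 p + f 4 p" for p
  define k1 where "k1 i p = (-1)^i * exp_kernel i t (\<rho> - p) - exp_kernel i t (p + \<rho>)" for i p
  define W where "W (k :: nat \<Rightarrow> real \<Rightarrow> real) p = k 0 p * f 3 p - k 1 p * f 2 p + k 2 p * f 1 p - k 3 p * f 0 p
      - 2 * t\<^sup>2 * (k 0 p * f 1 p - k 1 p * f 0 p)" for k p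
  have D: "(exp_kernel i t has_real_derivative exp_kernel (Suc i) t u) (at u)" if "i < 4" for i u
  proof -
    from that have "i = 0 \<or> i = 1 \<or> i = 2 \<or> i = 3" by auto
    then show ?thesis using exp_kernel_DERIV[OF t, of u] by (auto simp: eval_nat_numeral)
  qed
  have D1: "(k1 i has_real_derivative k1 (Suc i) p) (at p within S)" if "i < 4" for i p S
    unfolding k1_def by (rule derivative_eq_intros DERIV_chain2[OF D[OF that]] | simp)+
  have ode: "k1 4 p = 2 * t\<^sup>2 * k1 2 p - t^4 * k1 0 p" for p
    unfolding k1_def exp_kernel_ode[OF t] by (simp add: algebra_simps)
  have I1: "((\<lambda>p. L p * k1 0 p) has_integral W k1 R - W k1 0) {0..R}"
    unfolding L_def W_def
    apply (rule fundamental_theorem_of_calculus)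
    subgoal using \<rho> by simp
    unfolding has_real_derivative_iff_has_vector_derivative[symmetric]
    apply (rule concomitant_DERIV[OF D1 _ ode(1)])
     apply simp
    apply (rule f)
    using \<rho> by auto
  have "W k1 0 = 0" using f0 by (simp add: W_def k1_def)
  moreover have "W k1 R = 0" by (simp add: W_def fR)
  ultimately have "((\<lambda>p. L p * k1 0 p) has_integral 0) {0..R}" using I1 by simp
  then show ?thesis unfolding L_def
    by (rule has_integral_eq[rotated]) (use \<rho> in \<open>auto simp: k1_def\<close>)
qed

text \<open>For a potential f(p) / p, this quotient, divided once more by p as in
  \<open>radial_density\<close>, is (t^2 - Laplacian)^2 of the potential over 8 * pi * t.\<close>

definition ode_density :: "real \<Rightarrow> (nat \<Rightarrow> real \<Rightarrow> real) \<Rightarrow> real \<Rightarrow> real" where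
  "ode_density t f p = (t^4 * f 0 p - 2 * t\<^sup>2 * f 2 p + f 4 p) / (8 * pi * t)"

context
  fixes f :: "nat \<Rightarrow> real \<Rightarrow> real" and t R :: real
  assumes t: "t > 0" and R: "0 \<le> R"
    and f: "\<And>i p. i < 4 \<Longrightarrow> p \<in> {0..R} \<Longrightarrow> (f i has_real_derivative f (Suc i) p) (at p within {0..R})"
    and f4: "continuous_on {0..R} (f 4)"
    and f0: "f 0 0 = 0" "f 2 0 = 0"
begin

lemma profile_continuous: "i < 4 \<Longrightarrow> continuous_on {0..R} (f i)"
  using f by (meson DERIV_continuous continuous_on_eq_continuous_within)

lemma ode_density_continuous: "continuous_on {0..R} (ode_density t f)"
  unfolding ode_density_def by (intro continuous_intros f4 profile_continuous) (use t in auto)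

lemma ode_density_integrable: "integrable lborel (radial_density R (ode_density t f))"
  by (rule radial_density_mass(1)[OF ode_density_continuous R])

text \<open>Integration by parts: p * f'''' and p * f'' have the antiderivatives p * f''' - f'' and
  p * f' - f, whose values at 0 vanish by \<open>f0\<close>.\<close>

lemma ode_density_mass:
  "(\<integral>y. radial_density R (ode_density t f) y \<partial>lborel)
    = (t^4 * integral {0..R} (\<lambda>p. p * f 0 p) + (R * f 3 R - f 2 R) - 2 * t\<^sup>2 * (R * f 1 R - f 0 R)) / (2 * t)"
proof -
  have F: "(f 0 has_real_derivative f 1 p) (at p within {0..R})"
      "(f 1 has_real_derivative f 2 p) (at p within {0..R})"
      "(f 2 has_real_derivative f 3 p) (at p within {0..R})"
          "(f 3 has_real_derivative f 4 p) (at p within {0..R})"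
    if "p \<in> {0..R}" for p
    using f[of 0 p] f[of 1 p] f[of 2 p] f[of 3 p] that by (simp_all add: eval_nat_numeral)
  let ?G = "\<lambda>p. (p * f 3 p - f 2 p) - 2 * t\<^sup>2 * (p * f 1 p - f 0 p)"
  have "((\<lambda>p. p * (f 4 p - 2 * t\<^sup>2 * f 2 p)) has_integral ?G R - ?G 0) {0..R}"
  proof (rule fundamental_theorem_of_calculus[OF R])
    fix p assume p: "p \<in> {0..R}"
    show "(?G has_vector_derivative p * (f 4 p - 2 * t\<^sup>2 * f 2 p)) (at p within {0..R})"
      unfolding has_real_derivative_iff_has_vector_derivative[symmetric]
      by (rule derivative_eq_intros F[OF p] refl)+ (simp add: algebra_simps)
  qed
  moreover have "((\<lambda>p. p * f 0 p) has_integral integral {0..R} (\<lambda>p. p * f 0 p)) {0..R}"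
    by (intro integrable_integral integrable_continuous_real continuous_intros profile_continuous) simp
  then have "((\<lambda>p. t^4 * (p * f 0 p)) has_integral t^4 * integral {0..R} (\<lambda>p. p * f 0 p)) {0..R}"
    by (rule has_integral_mult_right)
  ultimately have "((\<lambda>p. t^4 * (p * f 0 p) + p * (f 4 p - 2 * t\<^sup>2 * f 2 p)) has_integral
      t^4 * integral {0..R} (\<lambda>p. p * f 0 p) + (?G R - ?G 0)) {0..R}"
    by (rule has_integral_add[rotated])
  from has_integral_mult_right[OF this, of "1 / (8 * pi * t)"]
  have "((\<lambda>p. ode_density t f p * p) has_integral
      1 / (8 * pi * t) * (t^4 * integral {0..R} (\<lambda>p. p * f 0 p) + (?G R - ?G 0))) {0..R}"
    by (rule has_integral_eq[rotated]) (simp add: ode_density_def field_simps)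
  from integral_unique[OF this]
  have "(\<integral>y. radial_density R (ode_density t f) y \<partial>lborel)
    = 4 * pi * (1 / (8 * pi * t) * (t^4 * integral {0..R} (\<lambda>p. p * f 0 p) + (?G R - ?G 0)))"
    unfolding radial_density_mass(2)[OF ode_density_continuous R] by (simp only:)
  moreover have eq: "4 * pi * (1 / (8 * pi * t) * X) = X / (2 * t)" for X
    using t by simp
  ultimately show ?thesis unfolding eq by (simp only: f0) simp
qed

lemma ode_density_potential_inside:
  assumes bc: "f 2 R = - 2 * t * f 1 R - t\<^sup>2 * f 0 R" "f 3 R = 3 * t\<^sup>2 * f 1 R + 2 * t^3 * f 0 R"
    and x: "x \<noteq> 0" "norm x \<le> R"
  shows "(\<integral>y. radial_density R (ode_density t f) y * exp (- (t * norm (x - y))) \<partial>lborel)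
      = f 0 (norm x) / norm x"
proof -
  have x0: "0 < norm x" using x by simp
  have "((\<lambda>p. ode_density t f p * (exp_kernel 0 t \<bar>p - norm x\<bar> - exp_kernel 0 t (p + norm x)))
      has_integral 1 / (8 * pi * t) * (4 * t * f 0 (norm x))) {0..R}"
    by (rule has_integral_eq[OF _ has_integral_mult_right[OF integral_exp_kernel_inside[OF t x0 x(2) f f0 bc],
        of "1 / (8 * pi * t)"]])
       (simp_all add: ode_density_def)
  then show ?thesis
    unfolding radial_density_potential[OF ode_density_continuous R t x(1)]
    using t by (simp add: integral_unique)
qed

lemma ode_density_potential_outside:
  assumes fR: "\<And>i. i < 4 \<Longrightarrow> f i R = 0" and x: "x \<noteq> 0" "R \<le> norm x"
  shows "(\<integral>y. radial_density R (ode_density t f) y * exp (- (t * norm (x - y))) \<partial>lborel) = 0"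
proof -
  have "((\<lambda>p. ode_density t f p * (exp_kernel 0 t \<bar>p - norm x\<bar> - exp_kernel 0 t (p + norm x)))
      has_integral 1 / (8 * pi * t) * 0) {0..R}"
    by (rule has_integral_eq[OF _ has_integral_mult_right[OF integral_exp_kernel_outside[OF t R x(2) f f0 fR],
        of "1 / (8 * pi * t)"]])
       (simp_all add: ode_density_def)
  then show ?thesis
    unfolding radial_density_potential[OF ode_density_continuous R t x(1)]
    by (simp add: integral_unique)
qed

end

lemma exp_dist_lipschitz:
  assumes "t > 0"
  shows "\<bar>exp (- (t * norm (x - y))) - exp (- (t * norm (x' - y)))\<bar> \<le> t * norm (x - x' :: real^3)"
proof -
  have le: "\<bar>exp (- a) - exp (- b)\<bar> \<le> \<bar>a - b\<bar>" if "0 \<le> a" "0 \<le> b" for a b :: real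
  proof -
    have *: "exp (- a) - exp (- b) \<le> b - a" if "0 \<le> a" "a \<le> b" for a b :: real
    proof -
      have "1 - exp (- (b - a)) \<le> b - a" using exp_ge_add_one_self[of "- (b - a)"] by linarith
      then have "exp (- a) * (1 - exp (- (b - a))) \<le> 1 * (b - a)"
        using that by (intro mult_mono) auto
      then show ?thesis by (simp add: right_diff_distrib exp_add[symmetric] algebra_simps)
    qed
    show ?thesis using *[of a b] *[of b a] that by (cases "a \<le> b") auto
  qed
  have "\<bar>exp (- (t * norm (x - y))) - exp (- (t * norm (x' - y)))\<bar> \<le> \<bar>t * norm (x - y) - t * norm (x' - y)\<bar>"
    using assms by (intro le) auto
  also have "\<dots> = t * \<bar>norm (x - y) - norm (x' - y)\<bar>"
    using assms by (simp add: abs_mult right_diff_distrib[symmetric])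
  also have "\<dots> \<le> t * norm (x - x')"
    using assms norm_triangle_ineq3[of "x - y" "x' - y"] by (intro mult_left_mono) auto
  finally show ?thesis .
qed

lemma integrable_mult_exp_dist:
  fixes v :: "real^3 \<Rightarrow> real"
  assumes "integrable lborel v" "t > 0"
  shows "integrable lborel (\<lambda>y. v y * exp (- (t * norm (x - y))))"
  by (rule Bochner_Integration.integrable_bound[OF assms(1)])
     (use assms in \<open>auto simp: abs_mult intro!: mult_left_le\<close>)

text \<open>The kernel is Lipschitz with constant t, uniformly in y. Continuity is what extends the
  radial formulas, valid for x different from 0, to the centre.\<close>

lemma continuous_potential:
  fixes v :: "real^3 \<Rightarrow> real"
  assumes v: "integrable lborel v" and t: "t > 0"
  shows "continuous_on UNIV (\<lambda>x. \<integral>y. v y * exp (- (t * norm (x - y))) \<partial>lborel)"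
proof -
  define C where "C = (\<integral>y. \<bar>v y\<bar> \<partial>lborel)"
  let ?p = "\<lambda>x. \<integral>y. v y * exp (- (t * norm (x - y))) \<partial>lborel"
  have C: "0 \<le> C" by (simp add: C_def)
  have "\<bar>?p x - ?p x'\<bar> \<le> C * t * norm (x - x')" for x x'
  proof -
    have "?p x - ?p x' = (\<integral>y. v y * (exp (- (t * norm (x - y))) - exp (- (t * norm (x' - y)))) \<partial>lborel)"
      using integrable_mult_exp_dist[OF v t] by (simp add: right_diff_distrib)
    also have "\<bar>\<dots>\<bar> \<le> (\<integral>y. \<bar>v y\<bar> * (t * norm (x - x')) \<partial>lborel)"
    proof (rule integral_abs_bound_integral)
      show "integrable lborel (\<lambda>y. v y * (exp (- (t * norm (x - y))) - exp (- (t * norm (x' - y)))))"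
        using integrable_mult_exp_dist[OF v t] by (simp add: right_diff_distrib)
      show "integrable lborel (\<lambda>y. \<bar>v y\<bar> * (t * norm (x - x')))" using v by simp
    qed (use exp_dist_lipschitz[OF t] in \<open>auto simp: abs_mult intro!: mult_left_mono\<close>)
    finally show ?thesis by (simp add: C_def mult.assoc)
  qed
  then have "(C * t)-lipschitz_on UNIV ?p"
    using C t by (auto simp: lipschitz_on_def dist_norm)
  then show ?thesis by (rule lipschitz_on_continuous_on)
qed

section \<open>Translations and dominated functions in H2\<close>

lemma has_derivative_shift:
  fixes \<phi> :: "'a::real_normed_vector \<Rightarrow> 'b::real_normed_vector"
  shows "((\<lambda>x. \<phi> (x + a)) has_derivative D) (at x) \<longleftrightarrow> (\<phi> has_derivative D) (at (x + a))"
proof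
  assume *: "((\<lambda>x. \<phi> (x + a)) has_derivative D) (at x)"
  have "((\<lambda>y. y - a) has_derivative (\<lambda>y. y)) (at (x + a))"
    by (auto intro!: derivative_eq_intros)
  from has_derivative_compose[OF this, of "\<lambda>x. \<phi> (x + a)" D] * show "(\<phi> has_derivative D) (at (x + a))"
    by simp
next
  assume *: "(\<phi> has_derivative D) (at (x + a))"
  have "((\<lambda>y. y + a) has_derivative (\<lambda>y. y)) (at x)"
    by (auto intro!: derivative_eq_intros)
  from has_derivative_compose[OF this *] show "((\<lambda>x. \<phi> (x + a)) has_derivative D) (at x)" .
qed

lemma partial_derivs_shift:
  "partial_derivs is (\<lambda>x. \<phi> (x + a)) = (\<lambda>x. partial_derivs is \<phi> (x + a))"
proof (induction "is")
  case (Cons i "is")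
  then show ?case
    by (simp add: partial_deriv_def frechet_derivative_def has_derivative_shift)
qed simp

lemma test_function_shift:
  assumes "test_function \<phi>"
  shows "test_function (\<lambda>x. \<phi> (x + a))"
proof -
  have eq: "{x. \<phi> (x + a) \<noteq> 0} = (+) (- a) ` {x. \<phi> x \<noteq> 0}"
    by (auto simp: image_iff) (metis add_diff_cancel_right')
  have "compact (closure {x. \<phi> (x + a) \<noteq> 0})"
    unfolding eq closure_translation using assms
    by (intro compact_translation) (simp add: test_function_def)
  moreover have "partial_derivs is (\<lambda>x. \<phi> (x + a)) differentiable (at x)" for "is" x
    using assms unfolding partial_derivs_shift test_function_def differentiable_def has_derivative_shift
      by blast
  ultimately show ?thesis by (simp add: test_function_def)
qed

lemma integral_lborel_shift:
  fixes f :: "'a::euclidean_space \<Rightarrow> real"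
  assumes "f \<in> borel_measurable borel"
  shows "(\<integral>x. f (x + a) \<partial>lborel) = (\<integral>x. f x \<partial>lborel)"
  by (subst (2) lborel_distr_plus[of a, symmetric], subst integral_distr)
     (use assms in \<open>simp_all add: add.commute\<close>)

lemma integrable_lborel_shift:
  fixes f :: "'a::euclidean_space \<Rightarrow> real"
  assumes "integrable lborel f"
  shows "integrable lborel (\<lambda>x. f (x + a))"
proof -
  have "integrable (distr lborel borel ((+) a)) f" using assms by (simp add: lborel_distr_plus)
  then show ?thesis
    by (subst (asm) integrable_distr_eq) (use assms in \<open>simp_all add: add.commute\<close>)
qed

lemma square_integrable_shift:
  assumes "square_integrable f"
  shows "square_integrable (\<lambda>x. f (x + a))"
proof -
  have [measurable]: "f \<in> borel_measurable borel" using assms by (simp add: square_integrable_def)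
  show ?thesis
    using assms integrable_lborel_shift[of "\<lambda>x. (f x)\<^sup>2" a] by (simp add: square_integrable_def)
qed

lemma L2_norm_shift: "square_integrable f \<Longrightarrow> L2_norm (\<lambda>x. f (x + a)) = L2_norm f"
  unfolding L2_norm_def square_integrable_def by (subst integral_lborel_shift[of "\<lambda>x. (f x)\<^sup>2" a]) auto

lemma weak_deriv_shift:
  assumes "square_integrable f" "square_integrable g" "weak_deriv is f g"
  shows "weak_deriv is (\<lambda>x. f (x + a)) (\<lambda>x. g (x + a))"
  unfolding weak_deriv_def
proof (intro allI impI)
  fix \<phi> assume \<phi>: "test_function \<phi>"
  have [measurable]: "f \<in> borel_measurable borel" "g \<in> borel_measurable borel"
    "partial_derivs is \<phi> \<in> borel_measurable borel" "\<phi> \<in> borel_measurable borel"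
    using assms(1,2) square_integrable_test[OF \<phi>, of "is"] square_integrable_test[OF \<phi>, of "[]"]
    by (simp_all add: square_integrable_def)
  let ?\<psi> = "\<lambda>x. \<phi> (x + (- a))"
  have \<psi>: "test_function ?\<psi>" by (rule test_function_shift[OF \<phi>])
  have [measurable]: "partial_derivs is ?\<psi> \<in> borel_measurable borel"
    using square_integrable_test[OF \<psi>, of "is"] by (simp add: square_integrable_def)
  have "(\<integral>x. f (x + a) * partial_derivs is \<phi> x \<partial>lborel)
      = (\<integral>x. f (x + a) * partial_derivs is ?\<psi> (x + a) \<partial>lborel)"
    unfolding partial_derivs_shift by simp
  also have "\<dots> = (\<integral>x. f x * partial_derivs is ?\<psi> x \<partial>lborel)"
    by (rule integral_lborel_shift[where f = "\<lambda>x. f x * partial_derivs is ?\<psi> x"]) measurable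
  also have "\<dots> = (-1) ^ length is * (\<integral>x. g x * ?\<psi> x \<partial>lborel)"
    using assms(3) \<psi> by (simp add: weak_deriv_def)
  also have "(\<integral>x. g x * ?\<psi> x \<partial>lborel) = (\<integral>x. g (x + a) * \<phi> x \<partial>lborel)"
    using integral_lborel_shift[where f = "\<lambda>x. g x * ?\<psi> x" and a = a] by simp
  finally show "(\<integral>x. f (x + a) * partial_derivs is \<phi> x \<partial>lborel)
      = (-1) ^ length is * (\<integral>x. g (x + a) * \<phi> x \<partial>lborel)" .
qed

lemma sobolev2_shift:
  assumes "f \<in> sobolev2"
  shows "(\<lambda>x. f (x + a)) \<in> sobolev2"
proof -
  have f: "continuous_on UNIV f" "square_integrable f"
    "\<And>is. length is \<le> 2 \<Longrightarrow> \<exists>g. square_integrable g \<and> weak_deriv is f g"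
    using assms by (auto simp: sobolev2_def)
  have "continuous_on UNIV (\<lambda>x. f (x + a))"
    by (rule continuous_on_compose2[OF f(1)]) (auto intro: continuous_intros)
  moreover have "\<exists>u. square_integrable u \<and> weak_deriv is (\<lambda>x. f (x + a)) u" if "length is \<le> 2" for "is"
    using f(3)[OF that] square_integrable_shift weak_deriv_shift[OF f(2)] by blast
  ultimately show ?thesis using f(2) by (simp add: sobolev2_def square_integrable_shift)
qed

definition H2_shift :: "real^3 \<Rightarrow> H2 \<Rightarrow> H2" where
  "H2_shift a f = Abs_H2 (\<lambda>x. H2_fun f (x + a))"

lemma H2_fun_shift [simp]: "H2_fun (H2_shift a f) = (\<lambda>x. H2_fun f (x + a))"
  by (simp add: H2_shift_def Abs_H2_inverse sobolev2_shift H2_fun)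

text \<open>Shifting a nearly optimal weak derivative gives a competitor for the shifted function
  with the same norm. The inequality is all that is used, since it bounds all exponentials by a
  single one.\<close>

lemma norm_H2_shift_le: "norm (H2_shift a f) \<le> norm f"
proof -
  have w: "weak_deriv_norm is (H2_fun (H2_shift a f)) \<le> weak_deriv_norm is (H2_fun f)" if l: "length is \<le> 2"
      for "is"
  proof (rule field_le_epsilon)
    fix e :: real assume "0 < e"
    then obtain g where g: "square_integrable g" "weak_deriv is (H2_fun f) g"
        "L2_norm g < weak_deriv_norm is (H2_fun f) + e"
      by (rule weak_deriv_norm_approx[OF l])
    have "weak_deriv_norm is (H2_fun (H2_shift a f)) \<le> L2_norm (\<lambda>x. g (x + a))"
      using g by (intro weak_deriv_norm_le) (simp_all add: square_integrable_shift weak_deriv_shift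
          H2_square_integrable)
    with g show "weak_deriv_norm is (H2_fun (H2_shift a f)) \<le> weak_deriv_norm is (H2_fun f) + e"
      by (simp add: L2_norm_shift)
  qed
  show ?thesis unfolding norm_H2_def
    using w weak_deriv_norm_nonneg[of _ "H2_shift a f"]
    by (intro real_sqrt_le_mono add_mono sum_mono power_mono)
       (auto simp: L2_norm_shift H2_square_integrable simp del: H2_fun_shift intro: order_refl,
        simp add: L2_norm_shift H2_square_integrable)
qed

text \<open>A pointwise substitute for a ball of \<open>H2\<close>: one bound for the function and
  its weak derivatives, on one fixed ball. Unlike the norm, this condition visibly survives
  absolutely convergent series, and it yields membership in \<open>sobolev2\<close> as well as a
  norm bound.\<close>

definition dominated_H2 :: "real \<Rightarrow> real \<Rightarrow> (real^3 \<Rightarrow> real) \<Rightarrow> bool" where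
  "dominated_H2 R L f \<longleftrightarrow> continuous_on UNIV f \<and> (\<forall>x. \<bar>f x\<bar> \<le> L * indicator (cball 0 R) x) \<and>
     (\<forall>is. length is \<in> {1, 2} \<longrightarrow> (\<exists>g. g \<in> borel_measurable borel \<and> weak_deriv is f g \<and>
        (\<forall>x. \<bar>g x\<bar> \<le> L * indicator (cball 0 R) x)))"

lemma square_integrable_ball: "square_integrable (\<lambda>x. L * indicator (cball 0 R) x)"
proof -
  have "(\<lambda>x. (L * indicator (cball 0 R) x)\<^sup>2) = (\<lambda>x::real^3. L\<^sup>2 * indicator (cball 0 R) x)"
    by (auto simp: indicator_def)
  moreover have "integrable lborel (\<lambda>x::real^3. L\<^sup>2 * indicator (cball 0 R) x)"
    by (intro integrable_mult_right integrable_real_indicator) (use emeasure_bounded_finite[OF bounded_cball, of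
        "0::real^3" R] in auto)
  moreover have "(\<lambda>x::real^3. L * indicator (cball 0 R) x) \<in> borel_measurable borel"
    by (intro borel_measurable_times borel_measurable_const borel_measurable_indicator) simp
  ultimately show ?thesis by (simp add: square_integrable_def)
qed

lemma square_integrable_dominated:
  assumes "g \<in> borel_measurable borel" "\<And>x. \<bar>g x\<bar> \<le> D x" "square_integrable D"
  shows "square_integrable g"
proof -
  have "integrable lborel (\<lambda>x. (g x)\<^sup>2)"
  proof (rule Bochner_Integration.integrable_bound)
    show "integrable lborel (\<lambda>x. (D x)\<^sup>2)" using assms(3) by (simp add: square_integrable_def)
    have "(g x)\<^sup>2 \<le> (D x)\<^sup>2" for x
      using assms(2)[of x] by (metis abs_ge_zero abs_le_square_iff abs_of_nonneg order_trans)
    then show "AE x in lborel. norm ((g x)\<^sup>2) \<le> norm ((D x)\<^sup>2)" by simp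
  qed (use assms in simp)
  then show ?thesis using assms by (simp add: square_integrable_def)
qed

lemma dominated_H2_sobolev2:
  assumes "dominated_H2 R L f"
  shows "f \<in> sobolev2"
proof -
  have f: "f \<in> borel_measurable borel"
    using assms by (simp add: dominated_H2_def borel_measurable_continuous_onI)
  have sf: "square_integrable f"
    by (rule square_integrable_dominated[OF f _ square_integrable_ball[of L R]])
        (use assms in \<open>simp add: dominated_H2_def\<close>)
  have "\<exists>g. square_integrable g \<and> weak_deriv is f g" if "length is \<le> 2" for "is"
  proof (cases "is")
    case Nil
    then show ?thesis using sf by (auto simp: weak_deriv_def)
  next
    case (Cons i is')
    with that have "length is \<in> {1, 2}" by (cases is') auto
    then obtain g where g: "g \<in> borel_measurable borel" "weak_deriv is f g"
        "\<And>x. \<bar>g x\<bar> \<le> L * indicator (cball 0 R) x"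
      using assms unfolding dominated_H2_def by blast
    with square_integrable_dominated[OF g(1,3) square_integrable_ball] show ?thesis by blast
  qed
  with assms sf show ?thesis by (simp add: sobolev2_def dominated_H2_def)
qed

lemma L2_norm_dominated:
  assumes "g \<in> borel_measurable borel" "\<And>x. \<bar>g x\<bar> \<le> L * indicator (cball 0 R) x"
  shows "(L2_norm g)\<^sup>2 \<le> L\<^sup>2 * measure lborel (cball (0::real^3) R)"
proof -
  have sq: "square_integrable g" by (rule square_integrable_dominated[OF assms square_integrable_ball])
  have "(L2_norm g)\<^sup>2 = (\<integral>x. (g x)\<^sup>2 \<partial>lborel)" by (simp add: L2_norm_def)
  also have "\<dots> \<le> (\<integral>x. (L * indicator (cball (0::real^3) R) x)\<^sup>2 \<partial>lborel)"
  proof (rule integral_mono)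
    show "(g x)\<^sup>2 \<le> (L * indicator (cball 0 R) x)\<^sup>2" for x
      using assms(2)[of x] by (metis abs_ge_zero abs_le_square_iff abs_of_nonneg order_trans)
  qed (use sq square_integrable_ball in \<open>auto simp: square_integrable_def\<close>)
  also have "(\<lambda>x::real^3. (L * indicator (cball 0 R) x)\<^sup>2) = (\<lambda>x. L\<^sup>2 * indicator (cball 0 R) x)"
    by (auto simp: indicator_def)
  also have "(\<integral>x. L\<^sup>2 * indicator (cball (0::real^3) R) x \<partial>lborel) = L\<^sup>2 * measure lborel (cball (0::real^3) R)"
    by simp
  finally show ?thesis .
qed

definition ball_const :: "real \<Rightarrow> real" where
  "ball_const R = sqrt ((1 + real (card {is :: 3 list. length is \<in> {1, 2}}))
      * measure lborel (cball (0::real^3) R))"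

lemma dominated_H2_norm:
  assumes "dominated_H2 R L (H2_fun f)" "0 \<le> L"
  shows "norm f \<le> ball_const R * L"
proof -
  let ?I = "{is :: 3 list. length is \<in> {1, 2}}" and ?V = "measure lborel (cball (0::real^3) R)"
  have "(L2_norm (H2_fun f))\<^sup>2 \<le> L\<^sup>2 * ?V"
    using assms H2_square_integrable[of f]
    by (intro L2_norm_dominated) (auto simp: dominated_H2_def square_integrable_def)
  moreover have "(weak_deriv_norm is (H2_fun f))\<^sup>2 \<le> L\<^sup>2 * ?V" if l: "is \<in> ?I" for "is"
  proof -
    obtain g where g: "g \<in> borel_measurable borel" "weak_deriv is (H2_fun f) g"
        "\<And>x. \<bar>g x\<bar> \<le> L * indicator (cball 0 R) x"
      using assms l unfolding dominated_H2_def by blast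
    have "weak_deriv_norm is (H2_fun f) \<le> L2_norm g"
      by (rule weak_deriv_norm_le[OF square_integrable_dominated[OF g(1,3) square_integrable_ball] g(2)])
    moreover have "0 \<le> weak_deriv_norm is (H2_fun f)" using l by (intro weak_deriv_norm_nonneg) auto
    ultimately have "(weak_deriv_norm is (H2_fun f))\<^sup>2 \<le> (L2_norm g)\<^sup>2" by (rule power_mono)
    also have "\<dots> \<le> L\<^sup>2 * ?V" by (rule L2_norm_dominated[OF g(1,3)])
    finally show ?thesis .
  qed
  then have "(\<Sum>is\<in>?I. (weak_deriv_norm is (H2_fun f))\<^sup>2) \<le> real (card ?I) * (L\<^sup>2 * ?V)"
    by (rule sum_bounded_above)
  ultimately have "norm f \<le> sqrt (L\<^sup>2 * ((1 + real (card ?I)) * ?V))"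
    unfolding norm_H2_def by (intro real_sqrt_le_mono) (simp add: algebra_simps)
  also have "\<dots> = ball_const R * L" using assms(2)
    by (simp add: ball_const_def real_sqrt_mult)
  finally show ?thesis .
qed

text \<open>The n-th term is at most |a n| times the fixed integral of D * |\<psi>|, so the series
  converges absolutely and may be integrated term by term.\<close>

lemma integral_dominated_series:
  fixes F :: "nat \<Rightarrow> real^3 \<Rightarrow> real"
  assumes [measurable]: "\<And>n. F n \<in> borel_measurable borel" and F: "\<And>n x. \<bar>F n x\<bar> \<le> D x"
    and D: "square_integrable D" and \<psi>: "square_integrable \<psi>" and a: "summable (\<lambda>n. \<bar>a n\<bar>)"
  shows "(\<integral>x. (\<Sum>n. a n * F n x) * \<psi> x \<partial>lborel) = (\<Sum>n. a n * (\<integral>x. F n x * \<psi> x \<partial>lborel))"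
proof -
  have D0: "0 \<le> D x" for x using F[of 0 x] by linarith
  have s: "summable (\<lambda>n. \<bar>a n * F n x\<bar>)" for x
    by (rule summable_comparison_test'[OF summable_mult2[OF a, of "D x"], of 0])
       (use F D0 in \<open>auto simp: abs_mult intro!: mult_left_mono\<close>)
  have int: "integrable lborel (\<lambda>x. F n x * \<psi> x)" for n
    by (rule square_integrable_mult[OF square_integrable_dominated[OF _ F D] \<psi>]) simp
  have bd: "integrable lborel (\<lambda>x. D x * \<bar>\<psi> x\<bar>)"
    using integrable_norm[OF square_integrable_mult[OF D \<psi>]] D0 by (simp add: abs_mult)
  have "(\<integral>x. (\<Sum>n. a n * F n x) * \<psi> x \<partial>lborel) = (\<integral>x. (\<Sum>n. a n * (F n x * \<psi> x)) \<partial>lborel)"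
    by (intro Bochner_Integration.integral_cong refl)
       (simp add: suminf_mult2[OF summable_rabs_cancel[OF s]] mult.assoc)
  also have "\<dots> = (\<Sum>n. (\<integral>x. a n * (F n x * \<psi> x) \<partial>lborel))"
  proof (rule integral_suminf)
    show "integrable lborel (\<lambda>x. a n * (F n x * \<psi> x))" for n using int by simp
    show "AE x in lborel. summable (\<lambda>n. norm (a n * (F n x * \<psi> x)))"
    proof (rule AE_I2)
      fix x show "summable (\<lambda>n. norm (a n * (F n x * \<psi> x)))"
        using summable_mult2[OF s, of x "\<bar>\<psi> x\<bar>"] by (simp add: abs_mult mult.assoc)
    qed
    show "summable (\<lambda>n. \<integral>x. norm (a n * (F n x * \<psi> x)) \<partial>lborel)"
    proof (rule summable_comparison_test'[OF summable_mult2[OF a, of "\<integral>x. D x * \<bar>\<psi> x\<bar> \<partial>lborel"], of 0])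
      fix n
      have "(\<integral>x. norm (F n x * \<psi> x) \<partial>lborel) \<le> (\<integral>x. D x * \<bar>\<psi> x\<bar> \<partial>lborel)"
        by (rule integral_mono[OF integrable_norm[OF int] bd]) (simp add: abs_mult F mult_right_mono)
      then show "norm (\<integral>x. norm (a n * (F n x * \<psi> x)) \<partial>lborel) \<le> \<bar>a n\<bar> * (\<integral>x. D x * \<bar>\<psi> x\<bar> \<partial>lborel)"
        by (simp add: abs_mult mult_left_mono)
    qed
  qed
  also have "\<dots> = (\<Sum>n. a n * (\<integral>x. F n x * \<psi> x \<partial>lborel))" by simp
  finally show ?thesis .
qed

lemma weak_deriv_series:
  assumes "\<And>n. F n \<in> borel_measurable borel" "\<And>n x. \<bar>F n x\<bar> \<le> D x"
    and "\<And>n. G n \<in> borel_measurable borel" "\<And>n x. \<bar>G n x\<bar> \<le> D x"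
    and D: "square_integrable D" and a: "summable (\<lambda>n. \<bar>a n\<bar>)" and FG: "\<And>n. weak_deriv is (F n) (G n)"
  shows "weak_deriv is (\<lambda>x. \<Sum>n. a n * F n x) (\<lambda>x. \<Sum>n. a n * G n x)"
  unfolding weak_deriv_def
proof (intro allI impI)
  fix \<phi> assume \<phi>: "test_function \<phi>"
  have sq: "square_integrable \<phi>" using square_integrable_test[OF \<phi>, of "[]"] by simp
  have "summable (\<lambda>n. a n * (\<integral>x. G n x * \<phi> x \<partial>lborel))"
  proof (rule summable_comparison_test'[OF summable_mult2[OF a, of "\<integral>x. D x * \<bar>\<phi> x\<bar> \<partial>lborel"], of 0])
    fix n
    have D0: "0 \<le> D x" for x using assms(2)[of 0 x] by linarith
    have "\<bar>\<integral>x. G n x * \<phi> x \<partial>lborel\<bar> \<le> (\<integral>x. D x * \<bar>\<phi> x\<bar> \<partial>lborel)"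
    proof (rule integral_abs_bound_integral)
      show "integrable lborel (\<lambda>x. G n x * \<phi> x)"
        by (rule square_integrable_mult[OF square_integrable_dominated[OF assms(3,4) D] sq])
      show "integrable lborel (\<lambda>x. D x * \<bar>\<phi> x\<bar>)"
        using integrable_norm[OF square_integrable_mult[OF D sq]] D0 by (simp add: abs_mult)
    qed (simp add: abs_mult assms mult_right_mono)
    then show "norm (a n * (\<integral>x. G n x * \<phi> x \<partial>lborel)) \<le> \<bar>a n\<bar> * (\<integral>x. D x * \<bar>\<phi> x\<bar> \<partial>lborel)"
      by (simp add: abs_mult mult_left_mono)
  qed
  then have "(\<Sum>n. a n * ((-1) ^ length is * (\<integral>x. G n x * \<phi> x \<partial>lborel)))
    = (-1) ^ length is * (\<Sum>n. a n * (\<integral>x. G n x * \<phi> x \<partial>lborel))"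
    by (subst suminf_mult[symmetric]) (simp_all add: mult_ac)
  then show "(\<integral>x. (\<Sum>n. a n * F n x) * partial_derivs is \<phi> x \<partial>lborel)
      = (-1) ^ length is * (\<integral>x. (\<Sum>n. a n * G n x) * \<phi> x \<partial>lborel)"
    using FG \<phi>
    by (simp add: integral_dominated_series[OF assms(1,2) D square_integrable_test[OF \<phi>] a]
        integral_dominated_series[OF assms(3,4) D sq a] weak_deriv_def)
qed

lemma series_dominated:
  fixes F :: "nat \<Rightarrow> real"
  assumes "\<And>n. \<bar>F n\<bar> \<le> C" "summable (\<lambda>n. \<bar>a n\<bar>)"
  shows "\<bar>\<Sum>n. a n * F n\<bar> \<le> (\<Sum>n. \<bar>a n\<bar>) * C"
proof -
  have s: "summable (\<lambda>n. \<bar>a n * F n\<bar>)"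
    by (rule summable_comparison_test'[OF summable_mult2[OF assms(2), of C], of 0])
       (use assms in \<open>auto simp: abs_mult intro!: mult_left_mono\<close>)
  then have "\<bar>\<Sum>n. a n * F n\<bar> \<le> (\<Sum>n. \<bar>a n * F n\<bar>)" by (rule summable_rabs)
  also have "\<dots> \<le> (\<Sum>n. \<bar>a n\<bar> * C)"
    by (rule suminf_le[OF _ s summable_mult2[OF assms(2)]]) (simp add: abs_mult assms mult_left_mono)
  also have "\<dots> = (\<Sum>n. \<bar>a n\<bar>) * C" by (rule suminf_mult2[OF assms(2), symmetric])
  finally show ?thesis .
qed

text \<open>Continuity follows from the Weierstrass M-test; the weak derivatives are the series of
  the individual ones, by term by term integration against test functions.\<close>

lemma dominated_H2_series:
  assumes F: "\<And>n. dominated_H2 R L (F n)" and a: "summable (\<lambda>n. \<bar>a n\<bar>)" "(\<Sum>n. \<bar>a n\<bar>) \<le> A" and L: "0 \<le> L"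
  shows "dominated_H2 R (A * L) (\<lambda>x. \<Sum>n. a n * F n x)"
proof -
  let ?D = "\<lambda>x. L * indicator (cball 0 R) x"
  have A: "(\<Sum>n. \<bar>a n\<bar>) * ?D x \<le> A * L * indicator (cball 0 R) x" for x :: "real^3"
    using a(2) L by (auto simp: indicator_def intro!: mult_right_mono)
  have Fb: "\<bar>F n x\<bar> \<le> ?D x" and Fc: "continuous_on UNIV (F n)" for n x using F by (auto simp: dominated_H2_def)
  have Fm: "F n \<in> borel_measurable borel" for n using Fc by (rule borel_measurable_continuous_onI)
  have "\<bar>\<Sum>n. a n * F n x\<bar> \<le> A * L * indicator (cball 0 R) x" for x
    using series_dominated[of "\<lambda>n. F n x", OF Fb a(1)] A[of x] by linarith
  moreover have "continuous_on UNIV (\<lambda>x. \<Sum>n. a n * F n x)"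
  proof (rule uniform_limit_theorem)
    show "uniform_limit UNIV (\<lambda>n x. \<Sum>i<n. a i * F i x) (\<lambda>x. \<Sum>n. a n * F n x) sequentially"
    proof (rule Weierstrass_m_test[OF _ summable_mult2[OF a(1), of L]])
      fix n x
      have "\<bar>F n x\<bar> \<le> L" using Fb[of n x] L by (cases "x \<in> cball 0 R") auto
      then show "norm (a n * F n x) \<le> \<bar>a n\<bar> * L" by (simp add: abs_mult mult_left_mono)
    qed
  qed (auto intro!: always_eventually continuous_intros Fc)
  moreover have "\<exists>g. g \<in> borel_measurable borel \<and> weak_deriv is (\<lambda>x. \<Sum>n. a n * F n x) g \<and>
        (\<forall>x. \<bar>g x\<bar> \<le> A * L * indicator (cball 0 R) x)" if l: "length is \<in> {1, 2}" for "is"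
  proof -
    have "\<forall>n. \<exists>g. g \<in> borel_measurable borel \<and> weak_deriv is (F n) g \<and> (\<forall>x. \<bar>g x\<bar> \<le> ?D x)"
      using F l unfolding dominated_H2_def by blast
    then obtain G where G: "\<And>n. G n \<in> borel_measurable borel" "\<And>n. weak_deriv is (F n) (G n)"
        "\<And>n x. \<bar>G n x\<bar> \<le> ?D x"
      by metis
    have "weak_deriv is (\<lambda>x. \<Sum>n. a n * F n x) (\<lambda>x. \<Sum>n. a n * G n x)"
      by (rule weak_deriv_series[OF Fm Fb G(1,3) square_integrable_ball a(1) G(2)])
    moreover have "\<bar>\<Sum>n. a n * G n x\<bar> \<le> A * L * indicator (cball 0 R) x" for x
      using series_dominated[of "\<lambda>n. G n x", OF G(3) a(1)] A[of x] by linarith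
    moreover have "(\<lambda>x. \<Sum>n. a n * G n x) \<in> borel_measurable borel"
      using G(1) by (intro borel_measurable_suminf borel_measurable_times) auto
    ultimately show ?thesis by blast
  qed
  ultimately show ?thesis by (simp add: dominated_H2_def)
qed

section \<open>Weak derivatives of radial functions\<close>

lemma test_function_partial:
  assumes "test_function \<phi>"
  shows "test_function (partial_deriv j \<phi>)"
proof -
  let ?K = "closure {x. \<phi> x \<noteq> 0}"
  have "{x. partial_deriv j \<phi> x \<noteq> 0} \<subseteq> ?K"
    using partial_deriv_eq_0[of ?K _ \<phi> j] closure_subset[of "{x. \<phi> x \<noteq> 0}"] by blast
  then have "closure {x. partial_deriv j \<phi> x \<noteq> 0} \<subseteq> ?K" by (simp add: closure_minimal)
  then have "compact (closure {x. partial_deriv j \<phi> x \<noteq> 0})"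
    using assms by (metis closed_closure compact_Int_closed inf.absorb_iff2 test_function_def)
  moreover have "partial_derivs is (partial_deriv j \<phi>) = partial_derivs (is @ [j]) \<phi>" for "is" by simp
  ultimately show ?thesis using assms unfolding test_function_def by metis
qed

text \<open>The iterated derivative for [i, j] applies j first, so the first assumption is tested
  against the partial derivative in direction j of the test function.\<close>

lemma weak_deriv_comp:
  assumes "weak_deriv [i] f g" "weak_deriv [j] g h"
  shows "weak_deriv [i, j] f h"
  unfolding weak_deriv_def
proof (intro allI impI)
  fix \<phi> assume \<phi>: "test_function \<phi>"
  show "(\<integral>x. f x * partial_derivs [i, j] \<phi> x \<partial>lborel) = (-1) ^ length [i, j] * (\<integral>x. h x * \<phi> x \<partial>lborel)"
    using assms(1)[unfolded weak_deriv_def, rule_format, OF test_function_partial[OF \<phi>, of j]]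
      assms(2)[unfolded weak_deriv_def, rule_format, OF \<phi>] by simp
qed

lemma partial_deriv_DERIV:
  assumes "\<phi> differentiable (at x)"
  shows "((\<lambda>s. \<phi> (x + s *\<^sub>R axis i 1)) has_real_derivative partial_deriv i \<phi> x) (at 0)"
proof -
  have D: "(\<phi> has_derivative frechet_derivative \<phi> (at x)) (at (x + 0 *\<^sub>R axis i 1))"
    using assms by (simp add: frechet_derivative_works)
  have "((\<lambda>s::real. x + s *\<^sub>R axis i 1) has_derivative (\<lambda>s. s *\<^sub>R axis i 1)) (at 0)"
    by (auto intro!: derivative_eq_intros)
  from has_derivative_compose[OF this D]
  have "((\<lambda>s. \<phi> (x + s *\<^sub>R axis i 1)) has_derivative (\<lambda>s. frechet_derivative \<phi> (at x) (s *\<^sub>R axis i 1))) (at 0)"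
      .
  moreover have "frechet_derivative \<phi> (at x) (s *\<^sub>R axis i 1) = partial_deriv i \<phi> x * s" for s
    using linear_scale[OF linear_frechet_derivative[OF assms]] by (simp add: partial_deriv_def)
  ultimately show ?thesis by (simp add: has_field_derivative_def)
qed

lemma DERIV_line_shift:
  fixes x e :: "'a::real_vector"
  assumes "((\<lambda>s. f (x + \<sigma> *\<^sub>R e + s *\<^sub>R e)) has_real_derivative d) (at 0)"
  shows "((\<lambda>s. f (x + s *\<^sub>R e)) has_real_derivative d) (at \<sigma>)"
proof -
  have "((\<lambda>s. f (x + \<sigma> *\<^sub>R e + (s - \<sigma>) *\<^sub>R e)) has_real_derivative d) (at \<sigma>)"
    using DERIV_shift[of "\<lambda>s. f (x + \<sigma> *\<^sub>R e + (s - \<sigma>) *\<^sub>R e)" d 0 \<sigma>] assms by (simp add: add.commute)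
  moreover have "(\<lambda>s. f (x + \<sigma> *\<^sub>R e + (s - \<sigma>) *\<^sub>R e)) = (\<lambda>s. f (x + s *\<^sub>R e))"
    by (simp add: algebra_simps)
  ultimately show ?thesis by simp
qed

text \<open>A line meets the exceptional point b at most once, and the fundamental theorem of
  calculus tolerates finitely many exceptional points.\<close>

lemma directional_lipschitz:
  fixes f :: "real^3 \<Rightarrow> real"
  assumes f: "continuous_on UNIV f" and C: "\<And>x. \<bar>g x\<bar> \<le> C" and e: "e \<noteq> 0" and s: "0 \<le> s"
    and D: "\<And>x. x \<noteq> b \<Longrightarrow> ((\<lambda>s. f (x + s *\<^sub>R e)) has_real_derivative g x) (at 0)"
  shows "\<bar>f (x + s *\<^sub>R e) - f x\<bar> \<le> C * s"
proof -
  let ?u = "\<lambda>\<sigma>. f (x + \<sigma> *\<^sub>R e)" and ?S = "{\<sigma>. x + \<sigma> *\<^sub>R e = b}"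
  have fin: "finite ?S"
  proof -
    have "\<sigma> = \<tau>" if "x + \<sigma> *\<^sub>R e = b" "x + \<tau> *\<^sub>R e = b" for \<sigma> \<tau>
    proof -
      have "\<sigma> *\<^sub>R e = \<tau> *\<^sub>R e" using that by (metis add_left_cancel)
      then show ?thesis using e by simp
    qed
    then have "\<exists>\<sigma>. ?S \<subseteq> {\<sigma>}" by blast
    then show ?thesis using finite_subset by blast
  qed
  have "((\<lambda>\<sigma>. g (x + \<sigma> *\<^sub>R e)) has_integral ?u s - ?u 0) {0..s}"
  proof (rule fundamental_theorem_of_calculus_interior_strong[OF fin s])
    show "continuous_on {0..s} ?u"
      by (rule continuous_on_compose2[OF f]) (auto intro!: continuous_intros)
    fix \<sigma> assume "\<sigma> \<in> {0<..<s} - ?S"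
    then have "x + \<sigma> *\<^sub>R e \<noteq> b" by simp
    then show "(?u has_vector_derivative g (x + \<sigma> *\<^sub>R e)) (at \<sigma>)"
      unfolding has_real_derivative_iff_has_vector_derivative[symmetric]
      by (rule DERIV_line_shift[where f = f and x = x and \<sigma> = \<sigma> and e = e, OF D])
  qed
  then have "norm (?u s - ?u 0) \<le> C * measure lborel {0..s}"
    by (rule has_integral_bound_real[rotated 2]) (use C[of x] C in \<open>auto intro: order_trans[OF abs_ge_zero]\<close>)
  then show ?thesis using s by simp
qed

lemma DERIV_quotient_seq:
  fixes u :: "real \<Rightarrow> real"
  assumes "(u has_real_derivative d) (at 0)" "\<And>n. s n \<noteq> 0" "s \<longlonglongrightarrow> 0"
  shows "(\<lambda>n. (u (s n) - u 0) / s n) \<longlonglongrightarrow> d"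
proof -
  have "((\<lambda>h. (u (0 + h) - u 0) / h) \<longlongrightarrow> d) (at 0)" using assms(1) by (simp add: DERIV_def)
  moreover have "filterlim s (at 0) sequentially" using assms(2,3) by (simp add: filterlim_at)
  ultimately show ?thesis using filterlim_compose by fastforce
qed

text \<open>A difference quotient is moved from the test function to f by translation invariance of
  Lebesgue measure, and both sides pass to the limit by dominated convergence. One exceptional point
  is allowed, which serves for the centre of a radial function.\<close>

lemma weak_deriv_partial:
  fixes f g :: "real^3 \<Rightarrow> real"
  assumes f: "continuous_on UNIV f" and M: "\<And>x. \<bar>f x\<bar> \<le> M"
    and g: "g \<in> borel_measurable borel" and C: "\<And>x. \<bar>g x\<bar> \<le> C"
    and D: "\<And>x. x \<noteq> b \<Longrightarrow> ((\<lambda>s. f (x + s *\<^sub>R axis i 1)) has_real_derivative g x) (at 0)"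
  shows "weak_deriv [i] f g"
  unfolding weak_deriv_def
proof (intro allI impI)
  fix \<phi> assume \<phi>: "test_function \<phi>"
  let ?e = "axis i (1::real) :: real^3" and ?\<phi>' = "partial_deriv i \<phi>" and ?K = "closure {x. \<phi> x \<noteq> 0}"
  have e: "?e \<noteq> 0" by (simp add: axis_eq_0_iff)
  have ne: "norm ?e = 1" by simp
  have diff: "partial_derivs is \<phi> differentiable (at x)" for "is" x using \<phi> by (simp add: test_function_def)
  have "continuous_on UNIV (partial_derivs is \<phi>)" for "is"
    using diff by (simp add: continuous_on_eq_continuous_at differentiable_imp_continuous_within)
  from this[of "[]"] this[of "[i]"] have c\<phi>: "continuous_on UNIV \<phi>" "continuous_on UNIV ?\<phi>'" by simp_all
  have [measurable]: "f \<in> borel_measurable borel" "\<phi> \<in> borel_measurable borel" "?\<phi>' \<in> borel_measurable borel"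
    using f c\<phi> by (auto intro: borel_measurable_continuous_onI)
  have sh: "(\<lambda>x. h (x + a)) \<in> borel_measurable borel" if "h \<in> borel_measurable borel" for h :: "real^3 \<Rightarrow> real"
      and a
    using measurable_compose[OF _ that, of "\<lambda>x. x + a" borel] by simp
  have K: "compact ?K" using \<phi> by (simp add: test_function_def)
  have \<phi>0: "\<phi> x = 0" if "x \<notin> ?K" for x using that closure_subset[of "{x. \<phi> x \<noteq> 0}"] by blast
  have \<phi>'0: "?\<phi>' x = 0" if "x \<notin> ?K" for x by (rule partial_deriv_eq_0[OF closed_closure that \<phi>0])
  obtain \<rho> where \<rho>: "\<And>x. x \<in> ?K \<Longrightarrow> norm x \<le> \<rho>"
    using compact_imp_bounded[OF K] by (auto simp: bounded_iff)
  have bd: "\<exists>B. \<forall>x. \<bar>h x\<bar> \<le> B" if h: "continuous_on UNIV h" "\<And>x. x \<notin> ?K \<Longrightarrow> h x = 0" for h :: "real^3 \<Rightarrow> real"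
  proof -
    have "compact (h ` ?K)" using K h(1) compact_continuous_image continuous_on_subset by blast
    then obtain B where "\<And>y. y \<in> h ` ?K \<Longrightarrow> \<bar>y\<bar> \<le> B" using compact_imp_bounded by (force simp: bounded_iff)
    then have "\<bar>h x\<bar> \<le> max B 0" for x using h(2)[of x] by (cases "x \<in> ?K") (auto simp: le_max_iff_disj)
    then show ?thesis by blast
  qed
  obtain B where B: "\<And>x. \<bar>\<phi> x\<bar> \<le> B" using bd[OF c\<phi>(1) \<phi>0] by blast
  obtain B' where B': "\<And>x. \<bar>?\<phi>' x\<bar> \<le> B'" using bd[OF c\<phi>(2) \<phi>'0] by blast
  have B0: "0 \<le> B'" "0 \<le> B" "0 \<le> C" "0 \<le> M"
    using B'[of 0] B[of 0] C[of 0] M[of 0] abs_ge_zero order_trans by blast+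
  define s where "s n = inverse (real (Suc n))" for n
  have s: "0 < s n" "s n \<le> 1" "s n \<noteq> 0" for n
    by (simp_all add: s_def inverse_le_1_iff del: of_nat_Suc)
  have s_lim: "s \<longlonglongrightarrow> 0" unfolding s_def by (rule LIMSEQ_inverse_real_of_nat)
  \<comment> \<open>The extra radius 1 makes room for the translates of the support, since all steps
    \<open>s n\<close> are at most 1.\<close>
  let ?W = "\<lambda>x::real^3. indicator (cball 0 (\<rho> + 1)) x :: real"
  have Wint: "integrable lborel (\<lambda>x. c * ?W x)" for c
    by (intro integrable_mult_right integrable_real_indicator)
       (use emeasure_bounded_finite[OF bounded_cball, of "0::real^3" "\<rho> + 1"] in auto)
  define q where "q n x = f x * ((\<phi> (x + s n *\<^sub>R ?e) - \<phi> x) / s n)" for n x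
  define p where "p n x = (f (x + (- s n) *\<^sub>R ?e) - f x) / s n * \<phi> x" for n x
  have qm: "q n \<in> borel_measurable lborel" and pm: "p n \<in> borel_measurable lborel" for n
    unfolding q_def p_def by (simp_all add: sh)
  have m1: "(\<lambda>x. f x * ?\<phi>' x) \<in> borel_measurable lborel" by simp
  have m2: "(\<lambda>x. - g x * \<phi> x) \<in> borel_measurable lborel" using g by simp
  have "(\<lambda>n. \<integral>x. q n x \<partial>lborel) \<longlonglongrightarrow> (\<integral>x. f x * ?\<phi>' x \<partial>lborel)"
  proof (rule integral_dominated_convergence[OF _ _ Wint[of "M * B'"]])
    show "AE x in lborel. (\<lambda>n. q n x) \<longlonglongrightarrow> f x * ?\<phi>' x"
    proof (rule AE_I2)
      fix x
      have "(\<lambda>n. (\<phi> (x + s n *\<^sub>R ?e) - \<phi> (x + 0 *\<^sub>R ?e)) / s n) \<longlonglongrightarrow> ?\<phi>' x"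
        by (rule DERIV_quotient_seq[OF partial_deriv_DERIV s(3) s_lim]) (use diff[of "[]"] in simp)
      then show "(\<lambda>n. q n x) \<longlonglongrightarrow> f x * ?\<phi>' x" unfolding q_def by (intro tendsto_mult_left) simp
    qed
    fix n
    show "AE x in lborel. norm (q n x) \<le> M * B' * ?W x"
    proof (rule AE_I2)
      fix x
      have "\<bar>\<phi> (x + s n *\<^sub>R ?e) - \<phi> x\<bar> \<le> B' * s n"
        by (rule directional_lipschitz[OF c\<phi>(1) B' e less_imp_le[OF s(1)]])
           (use diff[of "[]"] partial_deriv_DERIV in auto)
      then have 1: "\<bar>(\<phi> (x + s n *\<^sub>R ?e) - \<phi> x) / s n\<bar> \<le> B'" using s(1)[of n] by (simp add: field_simps)
      show "norm (q n x) \<le> M * B' * ?W x"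
      proof (cases "norm x \<le> \<rho> + 1")
        case True
        then show ?thesis using mult_mono[OF M[of x] 1] B0 by (simp add: q_def abs_mult)
      next
        case False
        have n1: "x \<notin> ?K" using False \<rho>[of x] by linarith
        have n2: "x + s n *\<^sub>R ?e \<notin> ?K"
        proof
          assume "x + s n *\<^sub>R ?e \<in> ?K"
          from \<rho>[OF this] have "norm x - norm (s n *\<^sub>R ?e) \<le> \<rho>" using norm_diff_ineq[of x "s n *\<^sub>R ?e"]
            by linarith
          then show False using False s(1,2)[of n] by simp
        qed
        show ?thesis using False \<phi>0[OF n1] \<phi>0[OF n2] by (simp add: q_def)
      qed
    qed
  qed (rule m1, rule qm)
  moreover have "(\<lambda>n. \<integral>x. p n x \<partial>lborel) \<longlonglongrightarrow> (\<integral>x. - g x * \<phi> x \<partial>lborel)"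
  proof (rule integral_dominated_convergence[OF _ _ Wint[of "C * B"]])
    have "AE x in lborel. x \<noteq> b" by (rule AE_lborel_singleton)
    then show "AE x in lborel. (\<lambda>n. p n x) \<longlonglongrightarrow> - g x * \<phi> x"
    proof eventually_elim
      case (elim x)
      have ms: "(\<lambda>n. - s n) \<longlonglongrightarrow> 0" using tendsto_minus[OF s_lim] by simp
      have "(\<lambda>n. (f (x + (- s n) *\<^sub>R ?e) - f (x + 0 *\<^sub>R ?e)) / (- s n)) \<longlonglongrightarrow> g x"
        by (rule DERIV_quotient_seq[OF D[OF elim] _ ms]) (use s in simp)
      then have "(\<lambda>n. - ((f (x + (- s n) *\<^sub>R ?e) - f (x + 0 *\<^sub>R ?e)) / (- s n))) \<longlonglongrightarrow> - g x"
        by (rule tendsto_minus)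
      then show ?case unfolding p_def by (intro tendsto_mult_right) simp
    qed
    fix n
    show "AE x in lborel. norm (p n x) \<le> C * B * ?W x"
    proof (rule AE_I2)
      fix x
      have "\<bar>f (x + (- s n) *\<^sub>R ?e + s n *\<^sub>R ?e) - f (x + (- s n) *\<^sub>R ?e)\<bar> \<le> C * s n"
        by (rule directional_lipschitz[OF f C e less_imp_le[OF s(1)] D])
      then have 1: "\<bar>(f (x + (- s n) *\<^sub>R ?e) - f x) / s n\<bar> \<le> C" using s(1)[of n]
        by (simp add: field_simps abs_minus_commute)
      show "norm (p n x) \<le> C * B * ?W x"
      proof (cases "norm x \<le> \<rho> + 1")
        case True
        then show ?thesis using mult_mono[OF 1 B[of x]] B0 by (simp add: p_def abs_mult)
      next
        case False
        then have "x \<notin> ?K" using \<rho>[of x] by linarith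
        from \<phi>0[OF this] show ?thesis using False by (simp add: p_def)
      qed
    qed
  qed (rule m2, rule pm)
  \<comment> \<open>Substituting x - s e for x in the product of f(x) and \<phi>(x + s e) changes
    the quotient of \<phi> into the quotient of f.\<close>
  moreover have "(\<integral>x. q n x \<partial>lborel) = (\<integral>x. p n x \<partial>lborel)" for n
  proof -
    have i1: "integrable lborel (\<lambda>x. h x * \<phi> x)" if h: "h \<in> borel_measurable borel" "\<And>x. \<bar>h x\<bar> \<le> M" for h
    proof (rule Bochner_Integration.integrable_bound[OF Wint[of "M * B"]])
      show "(\<lambda>x. h x * \<phi> x) \<in> borel_measurable lborel" using h(1) by simp
      show "AE x in lborel. norm (h x * \<phi> x) \<le> norm (M * B * ?W x)"
      proof (rule AE_I2)
        fix x
        show "norm (h x * \<phi> x) \<le> norm (M * B * ?W x)"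
        proof (cases "norm x \<le> \<rho> + 1")
          case True
          then show ?thesis using mult_mono[OF h(2)[of x] B[of x]] B0 by (simp add: abs_mult)
        next
          case False
          then have "x \<notin> ?K" using \<rho>[of x] by linarith
          from \<phi>0[OF this] show ?thesis using False by simp
        qed
      qed
    qed
    let ?a = "s n *\<^sub>R ?e"
    have fm: "(\<lambda>x. f (x + - ?a)) \<in> borel_measurable borel" by (rule sh) simp
    have j1: "integrable lborel (\<lambda>x. f (x + - ?a) * \<phi> x)" by (rule i1[OF fm M])
    have j0: "integrable lborel (\<lambda>x. f x * \<phi> x)" by (rule i1) (simp_all add: M)
    have j2: "integrable lborel (\<lambda>x. f x * \<phi> (x + ?a))"
      using integrable_lborel_shift[OF j1, of ?a] by simp
    have "(\<integral>x. q n x \<partial>lborel) = (\<integral>x. (f x * \<phi> (x + ?a) - f x * \<phi> x) / s n \<partial>lborel)"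
      by (simp add: q_def right_diff_distrib)
    also have "\<dots> = ((\<integral>x. f x * \<phi> (x + ?a) \<partial>lborel) - (\<integral>x. f x * \<phi> x \<partial>lborel)) / s n"
      using j0 j2 by simp
    also have "(\<integral>x. f x * \<phi> (x + ?a) \<partial>lborel) = (\<integral>x. f (x + - ?a) * \<phi> x \<partial>lborel)"
      using integral_lborel_shift[of "\<lambda>x. f (x + - ?a) * \<phi> x" ?a] fm by simp
    also have "(\<dots> - (\<integral>x. f x * \<phi> x \<partial>lborel)) / s n = (\<integral>x. (f (x + - ?a) * \<phi> x - f x * \<phi> x) / s n \<partial>lborel)"
      using j0 j1 by simp
    also have "\<dots> = (\<integral>x. p n x \<partial>lborel)" by (simp add: p_def left_diff_distrib)
    finally show ?thesis .
  qed
  ultimately have "(\<integral>x. f x * ?\<phi>' x \<partial>lborel) = (\<integral>x. - g x * \<phi> x \<partial>lborel)"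
    by (auto intro: LIMSEQ_unique)
  then show "(\<integral>x. f x * partial_derivs [i] \<phi> x \<partial>lborel) = (-1) ^ length [i] * (\<integral>x. g x * \<phi> x \<partial>lborel)"
    by simp
qed

lemma norm_line_DERIV:
  fixes z e :: "'a::real_inner"
  assumes "z \<noteq> 0"
  shows "((\<lambda>s. norm (z + s *\<^sub>R e)) has_real_derivative (z \<bullet> e) / norm z) (at 0)"
proof -
  have l: "((\<lambda>s::real. z + s *\<^sub>R e) has_derivative (\<lambda>s. s *\<^sub>R e)) (at 0)"
    by (auto intro!: derivative_eq_intros)
  have n: "(norm has_derivative (\<lambda>h. sgn z \<bullet> h)) (at (z + 0 *\<^sub>R e))"
    using has_derivative_norm[OF assms] by (simp add: inner_commute[of "sgn z"])
  have "((\<lambda>s. norm (z + s *\<^sub>R e)) has_derivative (\<lambda>s. sgn z \<bullet> (s *\<^sub>R e))) (at 0)"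
    by (rule has_derivative_compose[OF l n])
  moreover have "(\<lambda>s. sgn z \<bullet> (s *\<^sub>R e)) = (*) ((z \<bullet> e) / norm z)"
    by (rule ext) (simp add: sgn_div_norm divide_inverse)
  ultimately show ?thesis unfolding has_field_derivative_def by (simp only:)
qed

text \<open>The second derivatives contain \<psi>'(r) / r, so the bound |\<psi>'(r)| \<le> L * r is
  what excludes a conical point at b. The derivatives are computed classically away from b; the weak
  ones then follow because a single point does no harm.\<close>

lemma dominated_H2_radial:
  fixes \<psi> \<psi>' \<psi>'' :: "real \<Rightarrow> real" and b :: "real^3"
  assumes c: "continuous_on {0..} \<psi>" and c'': "continuous_on {0<..} \<psi>''"
    and D: "\<And>r. r > 0 \<Longrightarrow> (\<psi> has_real_derivative \<psi>' r) (at r)"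
      "\<And>r. r > 0 \<Longrightarrow> (\<psi>' has_real_derivative \<psi>'' r) (at r)"
    and L: "\<And>r. r \<ge> 0 \<Longrightarrow> \<bar>\<psi> r\<bar> \<le> L" "\<And>r. r > 0 \<Longrightarrow> \<bar>\<psi>' r\<bar> \<le> L * r" "\<And>r. r > 0 \<Longrightarrow> \<bar>\<psi>'' r\<bar> \<le> L"
    and \<rho>: "\<And>r. r > \<rho> \<Longrightarrow> \<psi> r = 0" "\<And>r. r > \<rho> \<Longrightarrow> \<psi>' r = 0" "\<And>r. r > \<rho> \<Longrightarrow> \<psi>'' r = 0"
    and \<rho>0: "0 \<le> \<rho>" and R: "norm b + \<rho> \<le> R"
  shows "dominated_H2 R ((3 + \<rho>) * L) (\<lambda>x. \<psi> (norm (x - b)))"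
proof -
  define f where "f x = \<psi> (norm (x - b))" for x
  define f1 where "f1 i x = \<psi>' (norm (x - b)) / norm (x - b) * (x - b) $ i" for i x
  define f2 where "f2 i j x = (\<psi>'' (norm (x - b)) / (norm (x - b))\<^sup>2 - \<psi>' (norm (x - b)) / (norm (x - b))^3)
      * (x - b) $ i * (x - b) $ j + \<psi>' (norm (x - b)) / norm (x - b) * axis j 1 $ i" for i j x
  have L0: "0 \<le> L" using L(1)[of 0] by linarith
  have z: "norm (x - b) > \<rho>" if "norm x > R" for x :: "real^3"
    using that R norm_triangle_ineq2[of x b] by linarith
  have M: "\<bar>q\<bar> \<le> (3 + \<rho>) * L * indicator (cball 0 R) x"
    if "norm x > R \<Longrightarrow> q = 0" "\<bar>q\<bar> \<le> (3 + \<rho>) * L" for q and x :: "real^3"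
    using that by (cases "norm x \<le> R") auto
  \<comment> \<open>The summand 3 accounts for the three terms of the Hessian, the summand \<rho>
    for the factor |x - b| in the bound for the gradient.\<close>
  have Lle: "L \<le> (3 + \<rho>) * L" "L * \<rho> \<le> (3 + \<rho>) * L" "3 * L \<le> (3 + \<rho>) * L"
    using L0 \<rho>0 by (simp_all add: algebra_simps)
  have fL: "\<bar>f x\<bar> \<le> (3 + \<rho>) * L" for x using L(1)[of "norm (x - b)"] Lle by (simp add: f_def)
  have q1: "\<bar>\<psi>' (norm (x - b)) / norm (x - b)\<bar> \<le> L" for x
    using L(2)[of "norm (x - b)"] L0 by (cases "x = b") (auto simp: field_simps)
  have comp: "\<bar>(x - b) $ i\<bar> \<le> norm (x - b)" for x i by (rule component_le_norm_cart)
  have f1L: "\<bar>f1 i x\<bar> \<le> L * norm (x - b)" for i x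
    unfolding f1_def abs_mult using q1[of x] comp[of x i] L0 by (intro mult_mono) (auto simp: abs_mult)
  have f10: "f1 i x = 0" if "norm (x - b) > \<rho>" for i x using that \<rho>(2) by (simp add: f1_def)
  have f1L': "\<bar>f1 i x\<bar> \<le> (3 + \<rho>) * L" for i x
  proof (cases "norm (x - b) > \<rho>")
    case True then show ?thesis using f10 L0 \<rho>0 by simp
  next
    case False
    then have "L * norm (x - b) \<le> L * \<rho>" using L0 by (simp add: mult_left_mono)
    then show ?thesis using f1L[of i x] Lle by linarith
  qed
  have f2L: "\<bar>f2 i j x\<bar> \<le> (3 + \<rho>) * L" for i j x
  proof (cases "x = b")
    case True then show ?thesis using L0 \<rho>0 by (simp add: f2_def)
  next
    case False
    define r where "r = norm (x - b)"
    have r: "r > 0" using False by (simp add: r_def)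
    have ij: "\<bar>(x - b) $ i * (x - b) $ j\<bar> \<le> r\<^sup>2"
      unfolding abs_mult power2_eq_square r_def by (intro mult_mono comp) auto
    have "\<bar>\<psi>'' r / r\<^sup>2 * ((x - b) $ i * (x - b) $ j)\<bar> \<le> L / r\<^sup>2 * r\<^sup>2"
      unfolding abs_mult[of "\<psi>'' r / r\<^sup>2"] using ij L(3)[OF r] L0
      by (intro mult_mono) (auto simp: divide_right_mono)
    moreover have "\<bar>\<psi>' r / r^3 * ((x - b) $ i * (x - b) $ j)\<bar> \<le> L / r\<^sup>2 * r\<^sup>2"
      unfolding abs_mult[of "\<psi>' r / r^3"]
    proof (intro mult_mono ij)
      have "\<bar>\<psi>' r / r^3\<bar> \<le> (L * r) / r^3" using L(2)[OF r] r by (simp add: divide_right_mono)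
      also have "\<dots> = L / r\<^sup>2" using r by (simp add: power2_eq_square power3_eq_cube)
      finally show "\<bar>\<psi>' r / r^3\<bar> \<le> L / r\<^sup>2" .
    qed (use L0 in auto)
    moreover have "\<bar>\<psi>' r / r * axis j 1 $ i\<bar> \<le> L"
      using q1[of x] L0 by (simp add: axis_def r_def)
    moreover have "L / r\<^sup>2 * r\<^sup>2 = L" using r by simp
    moreover have "f2 i j x = \<psi>'' r / r\<^sup>2 * ((x - b) $ i * (x - b) $ j) - \<psi>' r / r^3
        * ((x - b) $ i * (x - b) $ j)
        + \<psi>' r / r * axis j 1 $ i"
      by (simp add: f2_def r_def left_diff_distrib mult.assoc)
    ultimately have "\<bar>f2 i j x\<bar> \<le> 3 * L" by linarith
    then show ?thesis using Lle by linarith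
  qed
  have cf: "continuous_on UNIV f"
    unfolding f_def by (rule continuous_on_compose2[OF c]) (auto intro!: continuous_intros)
  have cn: "continuous_on (- {b}) (\<lambda>x. norm (x - b))" by (intro continuous_intros)
  have c': "continuous_on {0<..} \<psi>'"
    using D(2) by (meson DERIV_continuous continuous_at_imp_continuous_on greaterThan_iff)
  have sub: "(\<lambda>x. norm (x - b)) ` (- {b}) \<subseteq> {0<..}" by auto
  have cnt: "continuous_on (- {b}) (\<lambda>x. \<psi>' (norm (x - b)))" "continuous_on (- {b}) (\<lambda>x. \<psi>'' (norm (x - b)))"
    using continuous_on_compose2[OF c' cn sub] continuous_on_compose2[OF c'' cn sub] by simp_all
  have cx: "continuous_on S (\<lambda>x. (x - b) $ i)" for S i by (intro continuous_intros)
  have cf1: "continuous_on UNIV (f1 i)" for i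
  proof -
    have "continuous_on (- {b}) (f1 i)"
      unfolding f1_def by (intro continuous_on_mult continuous_on_divide cnt cn cx) auto
    then have "isCont (f1 i) x" if "x \<noteq> b" for x
      using that by (simp add: continuous_on_eq_continuous_at open_Compl)
    moreover have "isCont (f1 i) b"
    proof -
      have "(f1 i \<longlongrightarrow> 0) (at b)"
      proof (rule Lim_null_comparison)
        show "\<forall>\<^sub>F x in at b. norm (f1 i x) \<le> L * norm (x - b)" using f1L by simp
        have "((\<lambda>x. L * norm (x - b)) \<longlongrightarrow> L * norm (b - b)) (at b)" by (intro tendsto_intros)
        then show "((\<lambda>x. L * norm (x - b)) \<longlongrightarrow> 0) (at b)" by simp
      qed
      then show ?thesis by (simp add: isCont_def f1_def)
    qed
    ultimately show ?thesis by (metis continuous_at_imp_continuous_on)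
  qed
  have cf2: "f2 i j \<in> borel_measurable borel" for i j
  proof -
    have "continuous_on (- {b}) (f2 i j)"
      unfolding f2_def by (intro continuous_intros cnt cn) auto
    then have "(\<lambda>x. indicator (- {b}) x *\<^sub>R f2 i j x) \<in> borel_measurable borel"
      by (intro borel_measurable_continuous_on_indicator) auto
    \<comment> \<open>Division by zero gives the value 0 at b, so cutting out b changes
      nothing.\<close>
    moreover have "(\<lambda>x. indicator (- {b}) x *\<^sub>R f2 i j x) = f2 i j"
    proof
      fix x show "indicator (- {b}) x *\<^sub>R f2 i j x = f2 i j x" by (cases "x = b") (simp_all add: f2_def)
    qed
    ultimately show ?thesis by simp
  qed
  have Df: "((\<lambda>s. f (x + s *\<^sub>R axis i 1)) has_real_derivative f1 i x) (at 0)" if "x \<noteq> b" for i x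
  proof -
    have nz: "x - b \<noteq> 0" using that by simp
    have n: "((\<lambda>s. norm (x - b + s *\<^sub>R axis i 1)) has_real_derivative (x - b) $ i / norm (x - b)) (at 0)"
      using norm_line_DERIV[OF nz, of "axis i 1"] by (simp add: inner_axis)
    have "(\<psi> has_real_derivative \<psi>' (norm (x - b))) (at (norm (x - b + 0 *\<^sub>R axis i 1)))"
      using D(1)[of "norm (x - b)"] nz by simp
    from DERIV_chain2[OF this n] show ?thesis
      by (simp add: f_def f1_def add_diff_eq diff_add_eq)
  qed
  have Df1: "((\<lambda>s. f1 i (x + s *\<^sub>R axis j 1)) has_real_derivative f2 i j x) (at 0)" if "x \<noteq> b" for i j x
  proof -
    define r where "r = norm (x - b)"
    have nz: "x - b \<noteq> 0" using that by simp
    then have r: "r > 0" by (simp add: r_def)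
    have n: "((\<lambda>s. norm (x - b + s *\<^sub>R axis j 1)) has_real_derivative (x - b) $ j / r) (at 0)"
      using norm_line_DERIV[OF nz, of "axis j 1"] by (simp add: inner_axis r_def)
    have "(\<psi>' has_real_derivative \<psi>'' r) (at (norm (x - b + 0 *\<^sub>R axis j 1)))"
      using D(2)[OF r] by (simp add: r_def)
    note p = DERIV_chain2[OF this n]
    have l: "((\<lambda>s. (x - b) $ i + s * axis j 1 $ i) has_real_derivative axis j 1 $ i) (at 0)"
      by (auto intro!: derivative_eq_intros)
    have "((\<lambda>s. \<psi>' (norm (x - b + s *\<^sub>R axis j 1)) / norm (x - b + s *\<^sub>R axis j 1)
        * ((x - b) $ i + s * axis j 1 $ i))
       has_real_derivative
        (\<psi>'' r * ((x - b) $ j / r) * r - \<psi>' r * ((x - b) $ j / r)) / (r * r) * (x - b) $ i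
         + axis j 1 $ i * (\<psi>' r / r)) (at 0)"
      using DERIV_mult[OF DERIV_divide[OF p n] l] r by (simp add: r_def)
    moreover have "(\<psi>'' r * ((x - b) $ j / r) * r - \<psi>' r * ((x - b) $ j / r)) / (r * r) * (x - b) $ i
         + axis j 1 $ i * (\<psi>' r / r) = f2 i j x"
      unfolding f2_def r_def[symmetric] using r by (simp add: field_simps power2_eq_square power3_eq_cube)
    moreover have "f1 i (x + s *\<^sub>R axis j 1)
      = \<psi>' (norm (x - b + s *\<^sub>R axis j 1)) / norm (x - b + s *\<^sub>R axis j 1) *
          ((x - b) $ i + s * axis j 1 $ i)" for s
      by (simp add: f1_def add_diff_eq diff_add_eq)
    ultimately show ?thesis by simp
  qed
  have w1: "weak_deriv [i] f (f1 i)" for i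
    by (rule weak_deriv_partial[OF cf fL borel_measurable_continuous_onI[OF cf1] f1L' Df])
  have w2: "weak_deriv [j] (f1 i) (f2 i j)" for i j
    by (rule weak_deriv_partial[OF cf1 f1L' cf2 f2L Df1])
  have "\<exists>g. g \<in> borel_measurable borel \<and> weak_deriv is f g
      \<and> (\<forall>x. \<bar>g x\<bar> \<le> (3 + \<rho>) * L * indicator (cball 0 R) x)"
    if "length is \<in> {1, 2}" for "is"
  proof -
    from that consider i where "is = [i]" | i j where "is = [i, j]"
      by (auto simp: numeral_2_eq_2 length_Suc_conv)
    then show ?thesis
    proof cases
      case 1
      have "\<bar>f1 i x\<bar> \<le> (3 + \<rho>) * L * indicator (cball 0 R) x" for x
        by (rule M) (use f1L' f10 z in auto)
      then show ?thesis using w1[of i] 1 borel_measurable_continuous_onI[OF cf1] by blast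
    next
      case 2
      have "\<bar>f2 i j x\<bar> \<le> (3 + \<rho>) * L * indicator (cball 0 R) x" for x
        by (rule M) (use f2L z \<rho> in \<open>auto simp: f2_def\<close>)
      then show ?thesis using weak_deriv_comp[OF w1 w2] 2 cf2 by blast
    qed
  qed
  moreover have "\<bar>f x\<bar> \<le> (3 + \<rho>) * L * indicator (cball 0 R) x" for x
    by (rule M) (use fL z \<rho> in \<open>auto simp: f_def\<close>)
  ultimately have "dominated_H2 R ((3 + \<rho>) * L) f" using cf by (simp only: dominated_H2_def) blast
  then show ?thesis by (simp add: f_def[abs_def])
qed

section \<open>Weightings and potentials\<close>

lemma fin_supp_approx:
  assumes "w \<in> closure (fin_supp_measures Y)" "0 < \<theta>"
  obtains u S c where "finite S" "S \<subseteq> Y" "\<forall>f. blinfun_apply u f = (\<Sum>x\<in>S. c x * H2_fun f x)" "norm (u - w) < \<theta>"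
proof -
  obtain u where u: "u \<in> fin_supp_measures Y" "dist u w < \<theta>"
    using assms closure_approachable by blast
  then show ?thesis using that unfolding fin_supp_measures_def dist_norm by blast
qed

lemma blinfun_diff_bound: "\<bar>blinfun_apply u f - blinfun_apply w f\<bar> \<le> norm (u - w) * norm f"
  for u w :: Hm2
  using norm_blinfun[of "u - w" f] by (simp add: blinfun.diff_left)

text \<open>Replacing a weighting by a finitely supported measure at distance \<theta> costs a
  multiple of \<theta>; this removes that error.\<close>

lemma le_all_eps:
  fixes a b K :: real
  assumes "\<And>\<theta>. 0 < \<theta> \<Longrightarrow> a \<le> b + K * \<theta>"
  shows "a \<le> b"
proof (rule field_le_epsilon)
  fix e :: real assume e: "0 < e"
  define \<theta> where "\<theta> = e / (\<bar>K\<bar> + 1)"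
  have "0 < \<theta>" using e by (simp add: \<theta>_def)
  then have "a \<le> b + K * \<theta>" by (rule assms)
  also have "K * \<theta> \<le> \<bar>K\<bar> * \<theta>" using \<open>0 < \<theta>\<close> by (simp add: mult_right_mono)
  also have "\<dots> \<le> e" using e by (simp add: \<theta>_def field_simps)
  finally show "a \<le> b + e" by simp
qed

text \<open>Finitely supported measures on Y see only values on Y, and norm limits inherit
  this.\<close>

lemma pairing_cong:
  assumes w: "w \<in> closure (fin_supp_measures Y)" and fg: "\<And>x. x \<in> Y \<Longrightarrow> H2_fun f x = H2_fun g x"
  shows "blinfun_apply w f = blinfun_apply w g"
proof -
  have "\<bar>blinfun_apply w f - blinfun_apply w g\<bar> \<le> 0"
  proof (rule le_all_eps)
    fix \<theta> :: real assume "0 < \<theta>"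
    from fin_supp_approx[OF w this] obtain u S c where u: "finite S" "S \<subseteq> Y"
      "\<forall>f. blinfun_apply u f = (\<Sum>x\<in>S. c x * H2_fun f x)" "norm (u - w) < \<theta>" by metis
    have "blinfun_apply u f = blinfun_apply u g"
      unfolding u(3)[rule_format] using fg u(2) by (intro sum.cong) auto
    then have "\<bar>blinfun_apply w f - blinfun_apply w g\<bar> \<le> norm (u - w) * norm f + norm (u - w) * norm g"
      using blinfun_diff_bound[of u f w] blinfun_diff_bound[of u g w] by linarith
    also have "\<dots> \<le> \<theta> * norm f + \<theta> * norm g"
      using u(4) by (intro add_mono mult_right_mono) auto
    finally show "\<bar>blinfun_apply w f - blinfun_apply w g\<bar> \<le> 0 + (norm f + norm g) * \<theta>"
      by (simp add: algebra_simps)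
  qed
  then show ?thesis by simp
qed

text \<open>A measure close to w pairs to 0 in the limit by pointwise convergence, and the norm
  bound controls the difference. Norm convergence, which fails in the application, is
  avoided.\<close>

lemma pairing_bounded_tendsto_0:
  assumes w: "w \<in> closure (fin_supp_measures Y)" and C: "\<And>n. norm (F n) \<le> C"
    and F: "\<And>x. x \<in> Y \<Longrightarrow> (\<lambda>n. H2_fun (F n) x) \<longlonglongrightarrow> 0"
  shows "(\<lambda>n. blinfun_apply w (F n)) \<longlonglongrightarrow> 0"
proof (rule LIMSEQ_I)
  fix r :: real assume r: "0 < r"
  have C0: "0 \<le> C" using C[of 0] norm_ge_zero order_trans by blast
  define \<theta> where "\<theta> = r / (2 * (C + 1))"
  have \<theta>: "0 < \<theta>" "\<theta> * C < r / 2" using r C0 by (simp_all add: \<theta>_def field_simps)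
  from fin_supp_approx[OF w \<theta>(1)] obtain u S c where u: "finite S" "S \<subseteq> Y"
    "\<forall>f. blinfun_apply u f = (\<Sum>x\<in>S. c x * H2_fun f x)" "norm (u - w) < \<theta>" by metis
  have "(\<lambda>n. \<Sum>x\<in>S. c x * H2_fun (F n) x) \<longlonglongrightarrow> (\<Sum>x\<in>S. c x * 0)"
    using u(2) F by (intro tendsto_sum tendsto_mult_left) auto
  then have "(\<lambda>n. blinfun_apply u (F n)) \<longlonglongrightarrow> 0" by (simp add: u(3)[rule_format])
  from LIMSEQ_D[OF this, of "r / 2"] r obtain N where N: "\<And>n. n \<ge> N \<Longrightarrow> \<bar>blinfun_apply u (F n)\<bar> < r / 2"
    by auto
  have "norm (blinfun_apply w (F n) - 0) < r" if "n \<ge> N" for n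
  proof -
    have "norm (u - w) * norm (F n) \<le> \<theta> * C" using u(4) C[of n] \<theta>(1) by (intro mult_mono) auto
    then show ?thesis using blinfun_diff_bound[of u "F n" w] N[OF that] \<theta>(2) by simp
  qed
  then show "\<exists>N. \<forall>n\<ge>N. norm (blinfun_apply w (F n) - 0) < r" by blast
qed

text \<open>By translation invariance of the norm, the functions \<open>exp (- t |y - \<cdot>|)\<close> all have the same norm, so
  that a measure close to a weighting almost satisfies the weighting equation, uniformly in \<open>y\<close>.\<close>

lemma weighting_equation_approx:
  assumes w: "is_weighting t Y w" and Y: "Y \<noteq> {}"
  obtains N where "0 \<le> N" "\<forall>u S c y. (\<forall>f. blinfun_apply u f = (\<Sum>x\<in>S. c x * H2_fun f x)) \<longrightarrow> y \<in> Y \<longrightarrow>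
      \<bar>(\<Sum>x\<in>S. c x * exp (- (t * norm (x - y)))) - 1\<bar> \<le> norm (u - w) * N"
proof -
  obtain y0 where y0: "y0 \<in> Y" using Y by blast
  have ex: "\<exists>e. (\<forall>x. H2_fun e x = exp (- (t * norm (y - x)))) \<and> blinfun_apply w e = 1" if "y \<in> Y" for y
    using w that by (simp add: is_weighting_def)
  obtain e0 where e0: "\<And>x. H2_fun e0 x = exp (- (t * norm (y0 - x)))" using ex[OF y0] by blast
  show ?thesis
  proof (rule that[of "norm e0"], goal_cases)
    case 2
    show ?case
  proof (intro allI impI)
    fix u S c y assume u: "\<forall>f. blinfun_apply u f = (\<Sum>x\<in>S. c x * H2_fun f x)" and y: "y \<in> Y"
    obtain e where e: "\<And>x. H2_fun e x = exp (- (t * norm (y - x)))" "blinfun_apply w e = 1"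
      using ex[OF y] by blast
    \<comment> \<open>Elements of \<open>H2\<close> are determined by their values, so the given
      exponential at y is the translate of the one at \<open>y0\<close>.\<close>
    have "e = H2_shift (y0 - y) e0" 
    proof (rule H2_eqI)
      fix x
      have "y0 - (x + (y0 - y)) = y - x" by simp
      then show "H2_fun e x = H2_fun (H2_shift (y0 - y) e0) x" unfolding H2_fun_shift e(1) e0 by simp
    qed
    then have n: "norm e \<le> norm e0" using norm_H2_shift_le by simp
    have "(\<Sum>x\<in>S. c x * exp (- (t * norm (x - y)))) = blinfun_apply u e"
      by (simp add: u e norm_minus_commute)
    then have "\<bar>(\<Sum>x\<in>S. c x * exp (- (t * norm (x - y)))) - 1\<bar> \<le> norm (u - w) * norm e"
      using blinfun_diff_bound[of u e w] e(2) by simp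
    also have "\<dots> \<le> norm (u - w) * norm e0" using n by (intro mult_left_mono) auto
    finally show "\<bar>(\<Sum>x\<in>S. c x * exp (- (t * norm (x - y)))) - 1\<bar> \<le> norm (u - w) * norm e0" .
  qed
  qed simp
qed

text \<open>For a finite sum the pairing may be moved under the integral over y, where the
  approximate weighting equation applies pointwise. The shift by z is for the translated bumps used
  later.\<close>

lemma potential_pairing_approx:
  fixes v :: "real^3 \<Rightarrow> real"
  assumes v: "integrable lborel v" and t: "t > 0" and S: "finite S"
    and k: "\<And>y. v y \<noteq> 0 \<Longrightarrow> \<bar>(\<Sum>x\<in>S. c x * exp (- (t * norm (x - (z + y))))) - 1\<bar> \<le> \<kappa>"
  shows "\<bar>(\<Sum>x\<in>S. c x * (\<integral>y. v y * exp (- (t * norm (x - z - y))) \<partial>lborel)) - (\<integral>y. v y \<partial>lborel)\<bar>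
    \<le> \<kappa> * (\<integral>y. \<bar>v y\<bar> \<partial>lborel)"
proof -
  have int: "integrable lborel (\<lambda>y. v y * exp (- (t * norm (x - z - y))))" for x
    by (rule integrable_mult_exp_dist[OF v t])
  have "(\<Sum>x\<in>S. c x * (\<integral>y. v y * exp (- (t * norm (x - z - y))) \<partial>lborel)) - (\<integral>y. v y \<partial>lborel)
    = (\<integral>y. (\<Sum>x\<in>S. c x * (v y * exp (- (t * norm (x - z - y))))) - v y \<partial>lborel)"
    using int v by (simp add: Bochner_Integration.integral_sum)
  also have "\<bar>\<dots>\<bar> \<le> (\<integral>y. \<kappa> * \<bar>v y\<bar> \<partial>lborel)"
  proof (rule integral_abs_bound_integral)
    show "integrable lborel (\<lambda>y. (\<Sum>x\<in>S. c x * (v y * exp (- (t * norm (x - z - y))))) - v y)"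
      using int v by (intro Bochner_Integration.integrable_diff Bochner_Integration.integrable_sum) auto
    show "integrable lborel (\<lambda>y. \<kappa> * \<bar>v y\<bar>)" using v by simp
    fix y
    have "(\<Sum>x\<in>S. c x * (v y * exp (- (t * norm (x - z - y)))))
      = v y * (\<Sum>x\<in>S. c x * exp (- (t * norm (x - (z + y)))))"
      unfolding sum_distrib_left diff_diff_eq by (simp add: mult.left_commute)
    then have "(\<Sum>x\<in>S. c x * (v y * exp (- (t * norm (x - z - y))))) - v y
      = ((\<Sum>x\<in>S. c x * exp (- (t * norm (x - (z + y))))) - 1) * v y"
      by (simp add: algebra_simps)
    then show "\<bar>(\<Sum>x\<in>S. c x * (v y * exp (- (t * norm (x - z - y))))) - v y\<bar> \<le> \<kappa> * \<bar>v y\<bar>"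
      using k[of y] by (cases "v y = 0") (auto simp: abs_mult intro!: mult_right_mono)
  qed
  finally show ?thesis by simp
qed

text \<open>The exchange of pairing and integral is carried out for a finitely supported measure
  near w and only then transferred to w.\<close>

lemma weighting_pairing_potential:
  assumes w: "is_weighting t Y w" and t: "t > 0" and v: "integrable lborel v" "\<And>y. v y \<noteq> 0 \<Longrightarrow> y \<in> Y"
    and Y: "Y \<noteq> {}" and F: "\<And>x. x \<in> Y \<Longrightarrow> H2_fun F x = (\<integral>y. v y * exp (- (t * norm (x - y))) \<partial>lborel)"
  shows "blinfun_apply w F = (\<integral>y. v y \<partial>lborel)"
proof -
  obtain N where N: "0 \<le> N" "\<forall>u S c y. (\<forall>f. blinfun_apply u f = (\<Sum>x\<in>S. c x * H2_fun f x)) \<longrightarrow> y \<in> Y \<longrightarrow>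
      \<bar>(\<Sum>x\<in>S. c x * exp (- (t * norm (x - y)))) - 1\<bar> \<le> norm (u - w) * N"
    by (rule weighting_equation_approx[OF w Y])
  let ?V = "\<integral>y. \<bar>v y\<bar> \<partial>lborel"
  have cl: "w \<in> closure (fin_supp_measures Y)" using w by (simp add: is_weighting_def)
  have "\<bar>blinfun_apply w F - (\<integral>y. v y \<partial>lborel)\<bar> \<le> 0"
  proof (rule le_all_eps)
    fix \<theta> :: real assume "0 < \<theta>"
    from fin_supp_approx[OF cl this] obtain u S c where u: "finite S" "S \<subseteq> Y"
      "\<forall>f. blinfun_apply u f = (\<Sum>x\<in>S. c x * H2_fun f x)" "norm (u - w) < \<theta>" by metis
    have "blinfun_apply u F = (\<Sum>x\<in>S. c x * (\<integral>y. v y * exp (- (t * norm (x - 0 - y))) \<partial>lborel))"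
      unfolding u(3)[rule_format] using u(2) F by (intro sum.cong) auto
    moreover have "\<bar>(\<Sum>x\<in>S. c x * (\<integral>y. v y * exp (- (t * norm (x - 0 - y))) \<partial>lborel)) - (\<integral>y. v y \<partial>lborel)\<bar>
      \<le> norm (u - w) * N * ?V"
    proof (rule potential_pairing_approx[OF v(1) t u(1)])
      fix y assume "v y \<noteq> 0"
      from N(2)[rule_format, OF u(3)[rule_format], OF v(2)[OF this]]
      show "\<bar>(\<Sum>x\<in>S. c x * exp (- (t * norm (x - (0 + y))))) - 1\<bar> \<le> norm (u - w) * N"
        unfolding add_0_left .
    qed
    ultimately have "\<bar>blinfun_apply w F - (\<integral>y. v y \<partial>lborel)\<bar> \<le> norm (u - w) * norm F + norm (u - w) * N * ?V"
      using blinfun_diff_bound[of u F w] by linarith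
    also have "\<dots> \<le> \<theta> * norm F + \<theta> * N * ?V"
      using u(4) N(1) by (intro add_mono mult_right_mono) auto
    finally show "\<bar>blinfun_apply w F - (\<integral>y. v y \<partial>lborel)\<bar> \<le> 0 + (norm F + N * ?V) * \<theta>"
      by (simp add: algebra_simps)
  qed
  then show ?thesis by simp
qed

section \<open>Bump functions that are exponential potentials\<close>

text \<open>Iterated derivatives of \<open>p * (e\<^sup>2 - p\<^sup>2)^4\<close>.\<close>

definition bump_profile :: "real \<Rightarrow> nat \<Rightarrow> real \<Rightarrow> real" where
  "bump_profile e i p = (if i = 0 then p * (e\<^sup>2 - p\<^sup>2)^4
     else if i = 1 then e^8 - 12 * e^6 * p^2 + 30 * e^4 * p^4 - 28 * e^2 * p^6 + 9 * p^8
     else if i = 2 then - 24 * e^6 * p + 120 * e^4 * p^3 - 168 * e^2 * p^5 + 72 * p^7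
     else if i = 3 then - 24 * e^6 + 360 * e^4 * p^2 - 840 * e^2 * p^4 + 504 * p^6
     else 720 * e^4 * p - 3360 * e^2 * p^3 + 3024 * p^5)"

lemma bump_profile_DERIV:
  assumes "i < 4"
  shows "(bump_profile e i has_real_derivative bump_profile e (Suc i) p) (at p within S)"
proof -
  from assms consider "i = 0" | "i = 1" | "i = 2" | "i = 3" by linarith
  then show ?thesis
  proof cases
    case 1
    have "((\<lambda>p. p * (e\<^sup>2 - p\<^sup>2)^4) has_real_derivative
        1 * (e\<^sup>2 - p\<^sup>2)^4 + 4 * (- 2 * p) * (e\<^sup>2 - p\<^sup>2)^3 * p) (at p within S)"
      by (rule derivative_eq_intros refl | simp)+
    moreover have "1 * (e\<^sup>2 - p\<^sup>2)^4 + 4 * (- 2 * p) * (e\<^sup>2 - p\<^sup>2)^3 * p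
      = e^8 - 12 * e^6 * p^2 + 30 * e^4 * p^4 - 28 * e^2 * p^6 + 9 * p^8"
      by algebra
    ultimately show ?thesis using 1 by (simp add: bump_profile_def[abs_def])
  next
    case 2
    then show ?thesis unfolding bump_profile_def[abs_def]
      by (auto intro!: derivative_eq_intros)
  next
    case 3
    then show ?thesis unfolding bump_profile_def[abs_def]
      by (auto intro!: derivative_eq_intros)
  next
    case 4
    then show ?thesis unfolding bump_profile_def[abs_def]
      by (auto intro!: derivative_eq_intros)
  qed
qed

lemma bump_profile_endpoint: "i < 4 \<Longrightarrow> bump_profile e i e = 0"
proof -
  assume "i < 4"
  then consider "i = 0" | "i = 1" | "i = 2" | "i = 3" by linarith
  moreover have "e^8 - 12 * e^6 * e^2 + 30 * e^4 * e^4 - 28 * e^2 * e^6 + 9 * e^8 = 0"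
    "- 24 * e^6 * e + 120 * e^4 * e^3 - 168 * e^2 * e^5 + 72 * e^7 = 0"
    "- 24 * e^6 + 360 * e^4 * e^2 - 840 * e^2 * e^4 + 504 * e^6 = 0" by algebra+
  ultimately show ?thesis by cases (simp_all add: bump_profile_def)
qed

lemma bump_profile_integral_pos:
  assumes "e > 0"
  shows "integral {0..e} (\<lambda>p. p * bump_profile e 0 p) > 0"
proof -
  let ?G = "\<lambda>p. e^8 * p^3 / 3 - 4 * e^6 * p^5 / 5 + 6 * e^4 * p^7 / 7 - 4 * e^2 * p^9 / 9 + p^11 / 11"
  have "((\<lambda>p. p * bump_profile e 0 p) has_integral ?G e - ?G 0) {0..e}"
  proof (rule fundamental_theorem_of_calculus)
    fix p
    have "(?G has_real_derivative e^8 * p^2 - 4 * e^6 * p^4 + 6 * e^4 * p^6 - 4 * e^2 * p^8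
        + p^10) (at p within {0..e})"
      by (auto intro!: derivative_eq_intros)
    moreover have "e^8 * p^2 - 4 * e^6 * p^4 + 6 * e^4 * p^6 - 4 * e^2 * p^8 + p^10 = p * (p * (e\<^sup>2 - p\<^sup>2)^4)"
      by algebra
    ultimately show "(?G has_vector_derivative p * bump_profile e 0 p) (at p within {0..e})"
      by (simp add: bump_profile_def has_real_derivative_iff_has_vector_derivative)
  qed (use assms in simp)
  then have "integral {0..e} (\<lambda>p. p * bump_profile e 0 p) = ?G e - ?G 0" by (rule integral_unique)
  also have "\<dots> = 128 / 3465 * e^11" by (simp add: power_add[symmetric])
  also have "\<dots> > 0" using assms by simp
  finally show ?thesis .
qed

text \<open>The bump is (e^2 - |x|^2)^4 inside the ball of radius e. Its fourfold zero on the
  boundary satisfies the boundary conditions for the inside formula and makes the potential vanish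
  outside, so the density needs no layers. The boundary terms of the mass drop out as well, leaving
  t^4 / (8 * pi * t) times the integral of the bump.\<close>

lemma bump_potential:
  assumes t: "t > 0" and e: "e > 0"
  obtains v \<phi> :: "real^3 \<Rightarrow> real" where
    "integrable lborel v" "\<forall>y. v y \<noteq> 0 \<longrightarrow> norm y \<le> e"
    "\<forall>x. \<phi> x = (\<integral>y. v y * exp (- (t * norm (x - y))) \<partial>lborel)"
    "\<forall>x. 0 \<le> \<phi> x" "\<forall>x. \<phi> x \<noteq> 0 \<longrightarrow> norm x \<le> e" "continuous_on UNIV \<phi>" "integrable lborel \<phi>"
    "0 < (\<integral>x. \<phi> x \<partial>lborel)"
    "(\<integral>y. v y \<partial>lborel) = t^3 / (8 * pi) * (\<integral>x. \<phi> x \<partial>lborel)"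
proof -
  let ?f = "bump_profile e"
  have e0: "0 \<le> e" using e by simp
  have f4: "continuous_on {0..e} (?f 4)" unfolding bump_profile_def by (auto intro!: continuous_intros)
  have f0: "?f 0 0 = 0" "?f 2 0 = 0" by (simp_all add: bump_profile_def)
  note D = bump_profile_DERIV
  define v where "v = radial_density e (ode_density t ?f)"
  define \<phi> where "\<phi> x = (\<integral>y. v y * exp (- (t * norm (x - y))) \<partial>lborel)" for x
  have vint: "integrable lborel v" unfolding v_def by (rule ode_density_integrable[OF t e0 D f4 f0])
  have vsupp: "norm y \<le> e" if "v y \<noteq> 0" for y
    using that by (auto simp: v_def radial_density_def indicator_def split: if_splits)
  have cont: "continuous_on UNIV \<phi>" unfolding \<phi>_def by (rule continuous_potential[OF vint t])
  have E: "?f 0 e = 0" "?f 1 e = 0" "?f 2 e = 0" "?f 3 e = 0" by (simp_all add: bump_profile_endpoint)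
  have ins: "\<phi> x = (e\<^sup>2 - (norm x)\<^sup>2)^4" if "x \<noteq> 0" "norm x \<le> e" for x
  proof -
    have "\<phi> x = ?f 0 (norm x) / norm x"
      unfolding \<phi>_def v_def
      by (rule ode_density_potential_inside[OF t e0 D f4 f0 _ _ that]) (simp_all add: E[simplified])
    then show ?thesis using that by (simp add: bump_profile_def)
  qed
  have out: "\<phi> x = 0" if "x \<noteq> 0" "e \<le> norm x" for x
    unfolding \<phi>_def v_def by (rule ode_density_potential_outside[OF t e0 D f4 f0 bump_profile_endpoint that])
  have nz: "0 \<le> \<phi> x" if "x \<noteq> 0" for x
    using ins[OF that] out[OF that] by (cases "norm x \<le> e") auto
  \<comment> \<open>The explicit formulas exclude the origin; there the sign comes from
    continuity.\<close>
  have z: "0 \<le> \<phi> 0"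
  proof (rule tendsto_lowerbound)
    show "(\<phi> \<longlongrightarrow> \<phi> 0) (at 0)" using cont by (simp add: continuous_on_eq_continuous_at isCont_def)
    show "\<forall>\<^sub>F x in at 0. 0 \<le> \<phi> x" using nz by (auto simp: eventually_at_filter)
  qed simp
  have supp: "norm x \<le> e" if "\<phi> x \<noteq> 0" for x
  proof (rule ccontr)
    assume "\<not> norm x \<le> e"
    then have "x \<noteq> 0" "e \<le> norm x" using e by auto
    then show False using out that by blast
  qed
  have fc: "continuous_on {0..e} (?f 0)" unfolding bump_profile_def by (auto intro!: continuous_intros)
  note rd = radial_density_mass[OF fc e0]
  have ae: "AE x in lborel. \<phi> x = radial_density e (?f 0) x"
    using AE_lborel_singleton[of "0 :: real^3"]
  proof eventually_elim
    case (elim x)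
    then show ?case using ins[of x] out[of x]
      by (cases "norm x \<le> e") (auto simp: radial_density_def bump_profile_def)
  qed
  have \<phi>m: "\<phi> \<in> borel_measurable lborel" using borel_measurable_continuous_onI[OF cont] by simp
  have \<phi>i: "integrable lborel \<phi>"
    by (rule integrable_cong_AE_imp[OF rd(1) \<phi>m]) (use ae in eventually_elim, simp)
  have \<phi>I: "(\<integral>x. \<phi> x \<partial>lborel) = 4 * pi * integral {0..e} (\<lambda>p. p * ?f 0 p)"
    using integral_cong_AE[OF \<phi>m borel_measurable_integrable[OF rd(1)] ae] rd(2) by (simp add: mult.commute)
  have vI: "(\<integral>y. v y \<partial>lborel) = (t^4 * integral {0..e} (\<lambda>p. p * ?f 0 p)) / (2 * t)"
  proof -
    have "(\<integral>y. v y \<partial>lborel) = (t^4 * integral {0..e} (\<lambda>p. p * ?f 0 p) + (e * ?f 3 e - ?f 2 e)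
        - 2 * t\<^sup>2 * (e * ?f 1 e - ?f 0 e)) / (2 * t)"
      unfolding v_def by (rule ode_density_mass[OF t e0 D f4 f0])
    then show ?thesis unfolding E by simp
  qed
  show ?thesis
  proof (rule that[of v \<phi>])
    show "0 < (\<integral>x. \<phi> x \<partial>lborel)" using bump_profile_integral_pos[OF e] by (simp add: \<phi>I)
    show "(\<integral>y. v y \<partial>lborel) = t^3 / (8 * pi) * (\<integral>x. \<phi> x \<partial>lborel)"
      using t by (simp add: \<phi>I vI power4_eq_xxxx power3_eq_cube)
    show "\<forall>x. 0 \<le> \<phi> x" using nz z by metis
    show "\<forall>y. v y \<noteq> 0 \<longrightarrow> norm y \<le> e" using vsupp by blast
    show "\<forall>x. \<phi> x \<noteq> 0 \<longrightarrow> norm x \<le> e" using supp by blast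
    show "\<forall>x. \<phi> x = (\<integral>y. v y * exp (- (t * norm (x - y))) \<partial>lborel)" by (simp add: \<phi>_def)
  qed (fact vint cont \<phi>i)+
qed

lemma lborel_reflect: "distr lborel borel (\<lambda>a. x - a) = (lborel :: 'a::euclidean_space measure)"
  using lborel_affine[of "-1" x] by (simp add: density_1)

lemma integral_lborel_reflect:
  fixes f :: "'a::euclidean_space \<Rightarrow> real"
  assumes "f \<in> borel_measurable borel"
  shows "(\<integral>a. f (x - a) \<partial>lborel) = (\<integral>a. f a \<partial>lborel)"
  by (subst (2) lborel_reflect[of x, symmetric], subst integral_distr) (use assms in simp_all)

lemma integrable_lborel_reflect:
  fixes f :: "'a::euclidean_space \<Rightarrow> real"
  assumes "integrable lborel f"
  shows "integrable lborel (\<lambda>a. f (x - a))"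
proof -
  have "integrable (distr lborel borel (\<lambda>a. x - a)) f" using assms by (simp add: lborel_reflect)
  then show ?thesis by (subst (asm) integrable_distr_eq) (use assms in simp_all)
qed

text \<open>The convolution of \<open>g\<close> with a small bump \<phi> is paired in two ways. As
  an average of translates of \<open>g\<close> it is close to the pairing of \<open>g\<close> times
  the integral of \<phi>. As an average of translates of \<phi>, each the potential of a density
  inside the ball, it is close to the integral of \<open>g\<close> over the ball times the mass of
  that density. The ratio of the two bump integrals is t^3 / (8 * pi).\<close>

lemma weighting_vanishing:
  assumes w: "is_weighting t (cball 0 1) w" and t: "t > 0" and \<delta>: "0 < \<delta>"
    and g: "\<And>x. 1 - \<delta> \<le> norm x \<Longrightarrow> norm x \<le> 1 + \<delta> \<Longrightarrow> H2_fun g x = 0"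
  shows "blinfun_apply w g = t^3 / (8 * pi) * (\<integral>x. indicator (cball 0 1) x * H2_fun g x \<partial>lborel)"
proof -
  define g0 where "g0 x = indicator (cball 0 1) x * H2_fun g x" for x
  have cl: "w \<in> closure (fin_supp_measures (cball 0 1))" using w by (simp add: is_weighting_def)
  obtain N where N: "0 \<le> N" "\<forall>u S c y. (\<forall>f. blinfun_apply u f = (\<Sum>x\<in>S. c x * H2_fun f x)) \<longrightarrow> y \<in> cball 0 1 \<longrightarrow>
      \<bar>(\<Sum>x\<in>S. c x * exp (- (t * norm (x - y)))) - 1\<bar> \<le> norm (u - w) * N"
    by (rule weighting_equation_approx[OF w]) auto
  have g0i: "integrable lborel g0"
    using borel_integrable_compact[of "cball (0::real^3) 1" "H2_fun g"] continuous_on_subset[OF H2_continuous]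
    by (simp add: g0_def[abs_def])
  have g0m: "g0 \<in> borel_measurable borel" using borel_measurable_integrable[OF g0i] by simp
  obtain Bg where Bg: "\<And>x. \<bar>g0 x\<bar> \<le> Bg"
  proof -
    have "compact (H2_fun g ` cball 0 1)"
      using continuous_on_subset[OF H2_continuous] by (intro compact_continuous_image) auto
    then obtain B where B: "\<And>y. y \<in> H2_fun g ` cball 0 1 \<Longrightarrow> \<bar>y\<bar> \<le> B"
      using compact_imp_bounded by (force simp: bounded_iff)
    have "\<bar>g0 x\<bar> \<le> max B 0" for x
      using B[of "H2_fun g x"] by (cases "x \<in> cball 0 1") (auto simp: g0_def le_max_iff_disj)
    then show ?thesis by (rule that)
  qed
  have small: "\<bar>blinfun_apply w g - t^3 / (8 * pi) * (\<integral>x. g0 x \<partial>lborel)\<bar> \<le> 2 * \<eta>" if \<eta>: "0 < \<eta>" for \<eta>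
  proof -
    define \<theta>0 where "\<theta>0 = \<eta> / (2 * norm g + 1)"
    have \<theta>0: "0 < \<theta>0" "\<theta>0 * (2 * norm g) \<le> \<eta>"
    proof -
      have "0 < 2 * norm g + 1" by (simp add: add_nonneg_pos)
      then show "0 < \<theta>0" using \<eta> by (simp add: \<theta>0_def)
      have "\<theta>0 * (2 * norm g) \<le> \<theta>0 * (2 * norm g + 1)" using \<open>0 < \<theta>0\<close> by simp
      also have "\<dots> = \<eta>" using \<open>0 < 2 * norm g + 1\<close> by (simp add: \<theta>0_def)
      finally show "\<theta>0 * (2 * norm g) \<le> \<eta>" .
    qed
    \<comment> \<open>This first measure serves only to choose the radius e: it has finitely many
      points, so continuity of \<open>g\<close> at these points shows that small translations of
      \<open>g\<close> hardly change the pairing. Continuity of translations in the norm of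
      \<open>H2\<close> is not invoked.\<close>
    obtain u0 S0 c0 where u0: "finite S0" "S0 \<subseteq> cball 0 1"
      "\<forall>f. blinfun_apply u0 f = (\<Sum>x\<in>S0. c0 x * H2_fun f x)" "norm (u0 - w) < \<theta>0"
      by (rule fin_supp_approx[OF cl \<theta>0(1)])
    have nsh: "norm (g - H2_shift a g) \<le> 2 * norm g" for a
      using norm_triangle_ineq4[of g "H2_shift a g"] norm_H2_shift_le[of a g] by linarith
    have "((\<lambda>a. blinfun_apply u0 (g - H2_shift (- a) g)) \<longlongrightarrow> 0) (at 0)"
    proof -
      have "((\<lambda>a. \<Sum>x\<in>S0. c0 x * (H2_fun g x - H2_fun g (x + (- a)))) \<longlongrightarrow>
          (\<Sum>x\<in>S0. c0 x * (H2_fun g x - H2_fun g (x + (- 0))))) (at 0)"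
      proof (intro tendsto_sum tendsto_mult_left tendsto_diff tendsto_const)
        fix x
        have "isCont (H2_fun g) (x + (- 0))" using H2_continuous[of g]
          by (simp add: continuous_on_eq_continuous_at)
        moreover have "((\<lambda>a. x + (- a)) \<longlongrightarrow> x + (- 0)) (at 0)" by (intro tendsto_intros)
        ultimately show "((\<lambda>a. H2_fun g (x + (- a))) \<longlongrightarrow> H2_fun g (x + (- 0))) (at 0)"
          by (rule isCont_tendsto_compose)
      qed
      then show ?thesis by (simp add: u0(3)[rule_format])
    qed
    then have "\<forall>\<^sub>F a in at 0. dist (blinfun_apply u0 (g - H2_shift (- a) g)) 0 < \<eta>"
      using \<eta> by (rule tendstoD)
    then obtain d where d: "0 < d" "\<And>a. a \<noteq> 0 \<Longrightarrow> norm a < d \<Longrightarrow> \<bar>blinfun_apply u0 (g - H2_shift (- a) g)\<bar> < \<eta>"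
      by (auto simp: eventually_at)
    have sh0: "H2_shift (- 0) g = g" by (rule H2_eqI) simp
    define e where "e = min (d / 2) (min \<delta> 1)"
    have e: "0 < e" "e < d" "e \<le> \<delta>" using d(1) \<delta> by (auto simp: e_def)
    have wsh: "\<bar>blinfun_apply w (g - H2_shift (- a) g)\<bar> \<le> 2 * \<eta>" if a: "norm a \<le> e" for a
    proof -
      have "\<bar>blinfun_apply u0 (g - H2_shift (- a) g)\<bar> \<le> \<eta>"
        using d(2)[of a] a e \<eta> sh0 by (cases "a = 0") auto
      moreover have "norm (u0 - w) * norm (g - H2_shift (- a) g) \<le> \<theta>0 * (2 * norm g)"
        using u0(4) nsh \<theta>0(1) by (intro mult_mono) auto
      ultimately show ?thesis
        using blinfun_diff_bound[of u0 "g - H2_shift (- a) g" w] \<theta>0(2) by linarith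
    qed
    obtain v \<phi> :: "real^3 \<Rightarrow> real" where v': "integrable lborel v" "\<forall>y. v y \<noteq> 0 \<longrightarrow> norm y \<le> e"
      and \<phi>': "\<forall>x. \<phi> x = (\<integral>y. v y * exp (- (t * norm (x - y))) \<partial>lborel)"
      "\<forall>x. 0 \<le> \<phi> x" "\<forall>x. \<phi> x \<noteq> 0 \<longrightarrow> norm x \<le> e" "continuous_on UNIV \<phi>" "integrable lborel \<phi>"
      "0 < (\<integral>x. \<phi> x \<partial>lborel)" and m: "(\<integral>y. v y \<partial>lborel) = t^3 / (8 * pi) * (\<integral>x. \<phi> x \<partial>lborel)"
      by (rule bump_potential[OF t e(1)])
    note v = v'[rule_format] and \<phi> = \<phi>'[rule_format]
    define \<Phi> where "\<Phi> = (\<integral>x. \<phi> x \<partial>lborel)"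
    define m' where "m' = (\<integral>y. v y \<partial>lborel)"
    let ?V = "\<integral>y. \<bar>v y\<bar> \<partial>lborel" and ?G = "\<integral>x. \<bar>g0 x\<bar> \<partial>lborel"
    have \<phi>m [measurable]: "\<phi> \<in> borel_measurable borel" using \<phi>(4) by (rule borel_measurable_continuous_onI)
    \<comment> \<open>For x in the ball, x - a lies in the ball or in the outer half of the shell
      where \<open>g\<close> vanishes, so \<open>g\<close> may be cut off outside the ball.\<close>
    have gshift: "\<phi> a * H2_fun g (x - a) = \<phi> a * g0 (x - a)" if "x \<in> cball 0 1" for x a
    proof (cases "\<phi> a = 0")
      case False
      then have "norm a \<le> \<delta>" using \<phi>(3) e(3) by force
      then have "norm (x - a) \<le> 1 + \<delta>" using that norm_triangle_ineq4[of x a] by simp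
      then show ?thesis using g[of "x - a"] \<delta> by (auto simp: g0_def indicator_def)
    qed simp
    \<comment> \<open>The bump and its density are now fixed, and a second approximating measure is
      taken at distance \<theta>. Its error involves the integral of |v|, which depends on e, so
      \<theta> must tend to 0 after e has been chosen.\<close>
    have bound: "\<bar>blinfun_apply w g * \<Phi> - m' * (\<integral>x. g0 x \<partial>lborel)\<bar> \<le> 2 * \<eta> * \<Phi>"
    proof (rule le_all_eps)
      fix \<theta> :: real assume \<theta>: "0 < \<theta>"
      obtain u S c where u: "finite S" "S \<subseteq> cball 0 1"
        "\<forall>f. blinfun_apply u f = (\<Sum>x\<in>S. c x * H2_fun f x)" "norm (u - w) < \<theta>"
        by (rule fin_supp_approx[OF cl \<theta>])
      define P where "P x z = (\<integral>y. v y * exp (- (t * norm (x - z - y))) \<partial>lborel)" for x z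
      have P: "P x z = \<phi> (x - z)" for x z by (simp add: P_def \<phi>(1))
      have swapi: "integrable lborel (\<lambda>a. \<phi> a * g0 (x - a))" for x
      proof (rule Bochner_Integration.integrable_bound)
        show "integrable lborel (\<lambda>a. Bg * \<phi> a)" using \<phi>(5) by simp
        have "(\<lambda>a. g0 (x - a)) \<in> borel_measurable borel"
          using measurable_compose[OF _ g0m, of "\<lambda>a. x - a" borel] by simp
        then show "(\<lambda>a. \<phi> a * g0 (x - a)) \<in> borel_measurable lborel" by simp
        show "AE a in lborel. norm (\<phi> a * g0 (x - a)) \<le> norm (Bg * \<phi> a)"
        proof (rule AE_I2)
          fix a
          have "\<bar>g0 (x - a)\<bar> * \<bar>\<phi> a\<bar> \<le> \<bar>Bg\<bar> * \<bar>\<phi> a\<bar>"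
            using Bg[of "x - a"] by (intro mult_right_mono) auto
          then show "norm (\<phi> a * g0 (x - a)) \<le> norm (Bg * \<phi> a)" by (simp add: abs_mult mult.commute)
        qed
      qed
      have swap: "(\<integral>a. \<phi> a * g0 (x - a) \<partial>lborel) = (\<integral>z. g0 z * \<phi> (x - z) \<partial>lborel)"
        and swapi': "integrable lborel (\<lambda>z. g0 z * \<phi> (x - z))" for x
        using integral_lborel_reflect[OF borel_measurable_integrable[OF swapi[of x], simplified], of x]
          integrable_lborel_reflect[OF swapi[of x], of x] by (simp_all add: mult.commute)
      \<comment> \<open>Reading the convolution as an average of translates of
        \<open>g\<close>.\<close>
      have 1: "\<bar>blinfun_apply u g * \<Phi> - (\<integral>a. (\<Sum>x\<in>S. c x * (\<phi> a * g0 (x - a))) \<partial>lborel)\<bar>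
        \<le> (2 * \<eta> + \<theta> * (2 * norm g)) * \<Phi>"
      proof -
        have si: "integrable lborel (\<lambda>a. \<Sum>x\<in>S. c x * (\<phi> a * g0 (x - a)))"
          using swapi by (intro Bochner_Integration.integrable_sum) auto
        have "blinfun_apply u g * \<Phi> - (\<integral>a. (\<Sum>x\<in>S. c x * (\<phi> a * g0 (x - a))) \<partial>lborel)
          = (\<integral>a. blinfun_apply u g * \<phi> a - (\<Sum>x\<in>S. c x * (\<phi> a * g0 (x - a))) \<partial>lborel)"
          using si \<phi>(5) by (simp add: \<Phi>_def)
        also have "\<bar>\<dots>\<bar> \<le> (\<integral>a. (2 * \<eta> + \<theta> * (2 * norm g)) * \<phi> a \<partial>lborel)"
        proof (rule integral_abs_bound_integral)
          fix a
          have "(\<Sum>x\<in>S. c x * (\<phi> a * g0 (x - a))) = (\<Sum>x\<in>S. c x * (\<phi> a * H2_fun g (x - a)))"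
            by (rule sum.cong[OF refl]) (simp only: gshift[OF subsetD[OF u(2)]])
          also have "\<dots> = \<phi> a * blinfun_apply u (H2_shift (- a) g)"
            by (simp add: u(3)[rule_format] sum_distrib_left mult_ac)
          finally have "blinfun_apply u g * \<phi> a - (\<Sum>x\<in>S. c x * (\<phi> a * g0 (x - a)))
            = \<phi> a * blinfun_apply u (g - H2_shift (- a) g)"
            by (simp add: blinfun.diff_right algebra_simps)
          moreover have "\<bar>\<phi> a * blinfun_apply u (g - H2_shift (- a) g)\<bar> \<le> (2 * \<eta> + \<theta> * (2 * norm g)) * \<phi> a"
          proof (cases "\<phi> a = 0")
            case False
            have "norm (u - w) * norm (g - H2_shift (- a) g) \<le> \<theta> * (2 * norm g)"
              using u(4) nsh \<theta> by (intro mult_mono) auto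
            then have "\<bar>blinfun_apply u (g - H2_shift (- a) g)\<bar> \<le> 2 * \<eta> + \<theta> * (2 * norm g)"
              using blinfun_diff_bound[of u "g - H2_shift (- a) g" w] wsh[OF \<phi>(3)[OF False]] by linarith
            then show ?thesis using \<phi>(2)[of a] by (simp add: abs_mult mult.commute mult_left_mono)
          qed simp
          ultimately show "\<bar>blinfun_apply u g * \<phi> a - (\<Sum>x\<in>S. c x * (\<phi> a * g0 (x - a)))\<bar>
              \<le> (2 * \<eta> + \<theta> * (2 * norm g)) * \<phi> a"
            by simp
        qed (use si \<phi>(5) in auto)
        finally show ?thesis by (simp add: \<Phi>_def)
      qed
      \<comment> \<open>Reading the convolution as an average of translates of the bump by z. Where
        \<open>g0 z\<close> is not 0, z is at least \<delta> away from the sphere, so the shifted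
        density stays in the ball.\<close>
      have 2: "\<bar>(\<integral>a. (\<Sum>x\<in>S. c x * (\<phi> a * g0 (x - a))) \<partial>lborel) - m' * (\<integral>x. g0 x \<partial>lborel)\<bar> \<le> \<theta> * N * ?V * ?G"
      proof -
        have si: "integrable lborel (\<lambda>z. \<Sum>x\<in>S. c x * (g0 z * \<phi> (x - z)))"
          using swapi' by (intro Bochner_Integration.integrable_sum) auto
        have "(\<integral>a. (\<Sum>x\<in>S. c x * (\<phi> a * g0 (x - a))) \<partial>lborel) = (\<integral>z. (\<Sum>x\<in>S. c x * (g0 z * \<phi> (x - z))) \<partial>lborel)"
          using swapi swapi' swap by (simp add: Bochner_Integration.integral_sum)
        then have "(\<integral>a. (\<Sum>x\<in>S. c x * (\<phi> a * g0 (x - a))) \<partial>lborel) - m' * (\<integral>x. g0 x \<partial>lborel)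
          = (\<integral>z. (\<Sum>x\<in>S. c x * (g0 z * \<phi> (x - z))) - m' * g0 z \<partial>lborel)"
          using si g0i by simp
        also have "\<bar>\<dots>\<bar> \<le> (\<integral>z. (\<theta> * N * ?V) * \<bar>g0 z\<bar> \<partial>lborel)"
        proof (rule integral_abs_bound_integral)
          fix z
          show "\<bar>(\<Sum>x\<in>S. c x * (g0 z * \<phi> (x - z))) - m' * g0 z\<bar> \<le> \<theta> * N * ?V * \<bar>g0 z\<bar>"
          proof (cases "g0 z = 0")
            case False
            then have z: "norm z < 1 - \<delta>" using g[of z] \<delta> by (force simp: g0_def indicator_def split: if_splits)
            have "\<bar>(\<Sum>x\<in>S. c x * P x z) - m'\<bar> \<le> norm (u - w) * N * ?V"
              unfolding P_def m'_def
            proof (rule potential_pairing_approx[OF v(1) t u(1)])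
              fix y assume "v y \<noteq> 0"
              then have "norm (z + y) \<le> 1" using v(2)[of y] z e(3) norm_triangle_ineq[of z y] by linarith
              then have "z + y \<in> cball 0 1" by simp
              from N(2)[rule_format, OF u(3)[rule_format], OF this]
              show "\<bar>(\<Sum>x\<in>S. c x * exp (- (t * norm (x - (z + y))))) - 1\<bar> \<le> norm (u - w) * N" .
            qed
            also have "\<dots> \<le> \<theta> * N * ?V" using u(4) N(1) by (intro mult_right_mono) auto
            finally have "\<bar>(\<Sum>x\<in>S. c x * P x z) - m'\<bar> * \<bar>g0 z\<bar> \<le> \<theta> * N * ?V * \<bar>g0 z\<bar>"
              by (rule mult_right_mono) simp
            moreover have "(\<Sum>x\<in>S. c x * (g0 z * \<phi> (x - z))) = g0 z * (\<Sum>x\<in>S. c x * P x z)"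
              by (simp add: P sum_distrib_left mult_ac)
            ultimately show ?thesis by (simp add: abs_mult[symmetric] algebra_simps)
          qed simp
        qed (use si g0i in auto)
        finally show ?thesis by simp
      qed
      have 3: "\<bar>blinfun_apply w g * \<Phi> - blinfun_apply u g * \<Phi>\<bar> \<le> \<theta> * norm g * \<Phi>"
      proof -
        have "norm (u - w) * norm g \<le> \<theta> * norm g" using u(4) by (intro mult_right_mono) auto
        then have "\<bar>blinfun_apply w g - blinfun_apply u g\<bar> * \<Phi> \<le> \<theta> * norm g * \<Phi>"
          using blinfun_diff_bound[of u g w] \<phi>(6)
            by (intro mult_right_mono) (auto simp: \<Phi>_def abs_minus_commute)
        then show ?thesis using \<phi>(6) by (simp add: abs_mult \<Phi>_def left_diff_distrib[symmetric])
      qed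
      have "\<bar>blinfun_apply w g * \<Phi> - m' * (\<integral>x. g0 x \<partial>lborel)\<bar>
        \<le> \<theta> * norm g * \<Phi> + (2 * \<eta> + \<theta> * (2 * norm g)) * \<Phi> + \<theta> * N * ?V * ?G"
        using 1 2 3 by linarith
      also have "\<dots> = 2 * \<eta> * \<Phi> + (3 * norm g * \<Phi> + N * ?V * ?G) * \<theta>" by (simp add: algebra_simps)
      finally show "\<bar>blinfun_apply w g * \<Phi> - m' * (\<integral>x. g0 x \<partial>lborel)\<bar>
        \<le> 2 * \<eta> * \<Phi> + (3 * norm g * \<Phi> + N * ?V * ?G) * \<theta>" .
    qed
    have "blinfun_apply w g * \<Phi> - m' * (\<integral>x. g0 x \<partial>lborel)
      = (blinfun_apply w g - t^3 / (8 * pi) * (\<integral>x. g0 x \<partial>lborel)) * \<Phi>"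
      unfolding m'_def m \<Phi>_def by (simp add: algebra_simps)
    with bound have "\<bar>blinfun_apply w g - t^3 / (8 * pi) * (\<integral>x. g0 x \<partial>lborel)\<bar> * \<Phi> \<le> 2 * \<eta> * \<Phi>"
      using \<phi>(6) by (simp add: abs_mult \<Phi>_def)
    then show ?thesis using \<phi>(6) by (simp add: \<Phi>_def)
  qed
  have "\<bar>blinfun_apply w g - t^3 / (8 * pi) * (\<integral>x. g0 x \<partial>lborel)\<bar> \<le> 0"
    by (rule le_all_eps[where K = 2]) (use small in simp)
  then show ?thesis by (simp add: g0_def[abs_def])
qed

section \<open>The magnitude of the ball\<close>

lemma pos_power_DERIV:
  fixes x :: real
  assumes "n \<ge> 2"
  shows "((\<lambda>x. max 0 x ^ n) has_real_derivative real n * max 0 x ^ (n - 1)) (at x)"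
proof -
  consider "x > 0" | "x < 0" | "x = 0" by linarith
  then show ?thesis
  proof cases
    case 1
    have "((\<lambda>x. x ^ n) has_real_derivative real n * max 0 x ^ (n - 1)) (at x)"
      using 1 by (auto intro!: derivative_eq_intros)
    then show ?thesis
      by (rule has_field_derivative_transform_within[where d = x]) (use 1 in \<open>auto simp: dist_real_def max_def\<close>)
  next
    case 2
    have "((\<lambda>x. 0) has_real_derivative real n * max 0 x ^ (n - 1)) (at x)"
      using 2 assms by (auto simp: max_def zero_power)
    then show ?thesis
      by (rule has_field_derivative_transform_within[where d =
          "- x"]) (use 2 assms in \<open>auto simp: dist_real_def max_def zero_power\<close>)
  next
    case 3
    have "((\<lambda>h::real. max 0 h ^ n / h) \<longlongrightarrow> 0) (at 0)"
    proof (rule Lim_null_comparison)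
      have "norm (max 0 h ^ n / h) \<le> \<bar>h\<bar> ^ (n - 1)" if "h \<noteq> 0" for h :: real
      proof (cases "h > 0")
        case True
        then have "max 0 h ^ n / h = h ^ (n - 1)" using assms by (simp add: max_def power_diff)
        then show ?thesis using True by simp
      next
        case False
        then have "max 0 h = 0" by simp
        then show ?thesis using assms by (simp add: zero_power)
      qed
      then show "\<forall>\<^sub>F h in at (0::real). norm (max 0 h ^ n / h) \<le> \<bar>h\<bar> ^ (n - 1)"
        by (simp add: eventually_at_filter)
      have "((\<lambda>h::real. \<bar>h\<bar> ^ (n - 1)) \<longlongrightarrow> \<bar>0\<bar> ^ (n - 1)) (at 0)" by (intro tendsto_intros)
      then show "((\<lambda>h::real. \<bar>h\<bar> ^ (n - 1)) \<longlongrightarrow> 0) (at 0)" using assms by (simp add: zero_power)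
    qed
    then show ?thesis using 3 assms by (simp add: DERIV_def zero_power)
  qed
qed

text \<open>Iterated derivatives of \<open>(1 - y\<^sup>2)\<^sub>+ ^ 5 * (a * y\<^sup>2 + c * y ^ 3)\<close>.\<close>

definition layer_poly :: "real \<Rightarrow> real \<Rightarrow> nat \<Rightarrow> real \<Rightarrow> real" where
  "layer_poly a c i y = (if i = 0 then a * y^2 + c * y^3
     else if i = 1 then a * (2 * y - 12 * y^3) + c * (3 * y^2 - 13 * y^4)
     else if i = 2 then a * (2 - 54 * y^2 + 132 * y^4) + c * (6 * y - 82 * y^3 + 156 * y^5)
     else if i = 3 then a * (- 120 * y + 960 * y^3 - 1320 * y^5) + c * (6 - 288 * y^2 + 1518 * y^4 - 1716 * y^6)
     else a * (- 120 + 3480 * y^2 - 13320 * y^4 + 11880 * y^6) + c *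
         (- 600 * y + 7800 * y^3 - 22440 * y^5 + 17160 * y^7))"

definition layer_poly' :: "real \<Rightarrow> real \<Rightarrow> nat \<Rightarrow> real \<Rightarrow> real" where
  "layer_poly' a c i y = (if i = 0 then a * (2 * y) + c * (3 * y^2)
     else if i = 1 then a * (2 - 36 * y^2) + c * (6 * y - 52 * y^3)
     else if i = 2 then a * (- 108 * y + 528 * y^3) + c * (6 - 246 * y^2 + 780 * y^4)
     else a * (- 120 + 2880 * y^2 - 6600 * y^4) + c * (- 576 * y + 6072 * y^3 - 10296 * y^5))"

text \<open>The exponent 5 leaves a factor that vanishes at |y| = 1 even after four
  differentiations, so the fourth derivative is still continuous.\<close>

definition layer :: "real \<Rightarrow> real \<Rightarrow> nat \<Rightarrow> real \<Rightarrow> real" where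
  "layer a c i y = max 0 (1 - y\<^sup>2) ^ (5 - i) * layer_poly a c i y"

lemma layer_poly_DERIV:
  assumes "i < 4"
  shows "(layer_poly a c i has_real_derivative layer_poly' a c i y) (at y)"
proof -
  from assms consider "i = 0" | "i = 1" | "i = 2" | "i = 3" by linarith
  then show ?thesis
    by cases (auto simp: layer_poly_def[abs_def] layer_poly'_def intro!: derivative_eq_intros)
qed

text \<open>The product rule after a common factor (1 - y^2)^(4 - i) has been taken out.\<close>

lemma layer_poly_Suc:
  assumes "i < 4"
  shows "layer_poly a c (Suc i) y = - 2 * real (5 - i) * y * layer_poly a c i y + (1 - y\<^sup>2)
      * layer_poly' a c i y"
proof -
  from assms consider "i = 0" | "i = 1" | "i = 2" | "i = 3" by linarith
  then show ?thesis
    by cases (simp_all add: layer_poly_def layer_poly'_def algebra_simps power_add[symmetric] eval_nat_numeral)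
qed

lemma layer_DERIV:
  assumes i: "i < 4"
  shows "(layer a c i has_real_derivative layer a c (Suc i) y) (at y)"
proof -
  define n where "n = 3 - i"
  have n: "5 - i = Suc (Suc n)" "5 - Suc i = Suc n" using i by (simp_all add: n_def)
  let ?m = "\<lambda>y::real. max 0 (1 - y\<^sup>2)"
  have g: "((\<lambda>y. 1 - y\<^sup>2) has_real_derivative - 2 * y) (at y)" by (auto intro!: derivative_eq_intros)
  have "((\<lambda>y. ?m y ^ Suc (Suc n)) has_real_derivative real (Suc (Suc n)) * ?m y ^ Suc n * (- 2 * y)) (at y)"
    using DERIV_chain2[OF pos_power_DERIV[of "Suc (Suc n)"] g] by simp
  from DERIV_mult[OF this layer_poly_DERIV[OF i]]
  have "(layer a c i has_real_derivative
      real (Suc (Suc n)) * ?m y ^ Suc n * (- 2 * y) * layer_poly a c i y + layer_poly' a c i y * ?m y ^ Suc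
          (Suc n)) (at y)"
    by (simp only: layer_def[abs_def] n)
  moreover have m: "?m y ^ Suc (Suc n) = ?m y ^ Suc n * (1 - y\<^sup>2)"
    by (cases "0 \<le> 1 - y\<^sup>2") (auto simp: max_def)
  have "real (Suc (Suc n)) * ?m y ^ Suc n * (- 2 * y) * layer_poly a c i y + layer_poly' a c i y
      * ?m y ^ Suc (Suc n)
    = ?m y ^ Suc n * (- 2 * real (5 - i) * y * layer_poly a c i y + (1 - y\<^sup>2) * layer_poly' a c i y)"
    unfolding m by (simp add: n algebra_simps del: power_Suc of_nat_Suc)
  ultimately show ?thesis by (simp only: layer_def[of a c "Suc i"] n layer_poly_Suc[OF i])
qed

lemma layer_outside: "1 \<le> \<bar>y\<bar> \<Longrightarrow> i < 5 \<Longrightarrow> layer a c i y = 0"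
  using abs_square_le_1[of y] power_mono[of 1 "\<bar>y\<bar>" 2] by (simp add: layer_def max_def zero_power)

lemma layer_0: "layer a c 0 0 = 0" "layer a c 1 0 = 0" "layer a c 2 0 = 2 * a" "layer a c 3 0 = 6 * c"
  by (simp_all add: layer_def layer_poly_def)

lemma layer_continuous: "continuous_on S (layer a c i)"
proof -
  consider "i = 0" | "i = 1" | "i = 2" | "i = 3" | "i \<noteq> 0" "i \<noteq> 1" "i \<noteq> 2" "i \<noteq> 3" by blast
  then have "continuous_on S (layer_poly a c i)"
    by cases (auto simp: layer_poly_def[abs_def] intro!: continuous_intros)
  then show ?thesis unfolding layer_def[abs_def] by (intro continuous_intros)
qed

lemma layer_bound:
  assumes "i \<le> 2"
  shows "\<bar>layer a c i y\<bar> \<le> 250 * (\<bar>a\<bar> + \<bar>c\<bar>)"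
proof (cases "\<bar>y\<bar> \<le> 1")
  case True
  have p: "\<bar>y ^ k\<bar> \<le> 1" for k using True by (simp add: power_abs power_le_one)
  \<comment> \<open>The largest sum of absolute coefficients for i \<le> 2 is 6 + 82 + 156 =
    244.\<close>
  have b: "\<bar>layer_poly a c i y\<bar> \<le> 250 * (\<bar>a\<bar> + \<bar>c\<bar>)"
  proof -
    have *: "\<bar>a * u + c * v\<bar> \<le> 250 * (\<bar>a\<bar> + \<bar>c\<bar>)" if "\<bar>u\<bar> \<le> 250" "\<bar>v\<bar> \<le> 250" for u v
    proof -
      have "\<bar>a * u + c * v\<bar> \<le> \<bar>a\<bar> * \<bar>u\<bar> + \<bar>c\<bar> * \<bar>v\<bar>" using abs_triangle_ineq[of "a * u" "c * v"]
        by (simp add: abs_mult)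
      also have "\<dots> \<le> \<bar>a\<bar> * 250 + \<bar>c\<bar> * 250" using that by (intro add_mono mult_left_mono) auto
      finally show ?thesis by simp
    qed
    from assms consider "i = 0" | "i = 1" | "i = 2" by linarith
    then show ?thesis
    proof cases
      case 1
      have "\<bar>y^2\<bar> \<le> 250" "\<bar>y^3\<bar> \<le> 250" using p[of 2] p[of 3] by linarith+
      from *[OF this] 1 show ?thesis by (simp add: layer_poly_def)
    next
      case 2
      have "\<bar>2 * y - 12 * y^3\<bar> \<le> 250" "\<bar>3 * y^2 - 13 * y^4\<bar> \<le> 250"
        using True p[of 2] p[of 3] p[of 4] by linarith+
      from *[OF this] 2 show ?thesis by (simp add: layer_poly_def)
    next
      case 3
      have "\<bar>2 - 54 * y^2 + 132 * y^4\<bar> \<le> 250" "\<bar>6 * y - 82 * y^3 + 156 * y^5\<bar> \<le> 250"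
        using True p[of 2] p[of 3] p[of 4] p[of 5] by linarith+
      from *[OF this] 3 show ?thesis by (simp add: layer_poly_def)
    qed
  qed
  have "0 \<le> y\<^sup>2" by simp
  then have "\<bar>max 0 (1 - y\<^sup>2) ^ (5 - i)\<bar> \<le> 1" by (simp add: power_abs power_le_one)
  then have "\<bar>layer a c i y\<bar> \<le> 1 * (250 * (\<bar>a\<bar> + \<bar>c\<bar>))"
    unfolding layer_def abs_mult using b by (intro mult_mono) auto
  then show ?thesis by simp
next
  case False
  then show ?thesis using layer_outside[of y i a c] assms by simp
qed

text \<open>The constant function \<open>1\<close> is the potential of a distribution on the closed ball that has layers on
  the sphere. Adding to it a correction supported in a shell of width \<open>d\<close> gives a profile that is
  the potential of a function.\<close>

definition shell_correction :: "real \<Rightarrow> real \<Rightarrow> nat \<Rightarrow> real \<Rightarrow> real" where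
  "shell_correction t d i r
     = d\<^sup>2 / d ^ i * layer (- (t\<^sup>2 + 2 * t) / 2) (d * (2 * t^3 + 3 * t\<^sup>2) / 6) i ((r - 1) / d)"

lemma shell_correction_DERIV:
  assumes "i < 4" "d > 0"
  shows "(shell_correction t d i has_real_derivative shell_correction t d (Suc i) r) (at r within S)"
proof -
  have "((\<lambda>r. (r - 1) / d) has_real_derivative 1 / d) (at r)"
    using assms(2) by (auto intro!: derivative_eq_intros)
  from DERIV_cmult[OF DERIV_chain2[OF layer_DERIV[OF assms(1)] this], of "d\<^sup>2 / d ^ i"]
  have "(shell_correction t d i has_real_derivative shell_correction t d (Suc i) r) (at r)"
    unfolding shell_correction_def[abs_def] by (simp add: mult.commute)
  then show ?thesis by (rule DERIV_subset) simp
qed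

lemma shell_correction_outside: "d > 0 \<Longrightarrow> i < 5 \<Longrightarrow> d \<le> \<bar>r - 1\<bar> \<Longrightarrow> shell_correction t d i r = 0"
  by (simp add: shell_correction_def layer_outside)

text \<open>The scaling gives order d^(2 - i): the function itself is small with d, while its second
  derivative remains bounded but does not become small.\<close>

lemma shell_correction_bound:
  assumes "0 < d" "d \<le> 1" "i \<le> 2" "t > 0"
  shows "\<bar>shell_correction t d i r\<bar> \<le> d\<^sup>2 / d ^ i * (250 * ((t\<^sup>2 + 2 * t) + (2 * t^3 + 3 * t\<^sup>2)))"
proof -
  have "\<bar>- (t\<^sup>2 + 2 * t) / 2\<bar> + \<bar>d * (2 * t^3 + 3 * t\<^sup>2) / 6\<bar> \<le> (t\<^sup>2 + 2 * t) + (2 * t^3 + 3 * t\<^sup>2)"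
  proof (rule add_mono)
    have "\<bar>- X / 2\<bar> \<le> X" if "0 \<le> X" for X :: real using that by simp
    then show "\<bar>- (t\<^sup>2 + 2 * t) / 2\<bar> \<le> t\<^sup>2 + 2 * t" using assms(4)
      by (metis add_nonneg_nonneg less_eq_real_def mult_nonneg_nonneg zero_le_numeral zero_le_power2)
    have "d * (2 * t^3 + 3 * t\<^sup>2) \<le> 1 * (2 * t^3 + 3 * t\<^sup>2)" using assms by (intro mult_right_mono) auto
    moreover have "0 \<le> d * (2 * t^3 + 3 * t\<^sup>2)" using assms by simp
    ultimately show "\<bar>d * (2 * t^3 + 3 * t\<^sup>2) / 6\<bar> \<le> 2 * t^3 + 3 * t\<^sup>2" by simp
  qed
  then have "250 * (\<bar>- (t\<^sup>2 + 2 * t) / 2\<bar> + \<bar>d * (2 * t^3 + 3 * t\<^sup>2) / 6\<bar>)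
      \<le> 250 * ((t\<^sup>2 + 2 * t) + (2 * t^3 + 3 * t\<^sup>2))" by (rule mult_left_mono) simp
  then have l: "\<bar>layer (- (t\<^sup>2 + 2 * t) / 2) (d * (2 * t^3 + 3 * t\<^sup>2) / 6) i ((r - 1) / d)\<bar>
      \<le> 250 * ((t\<^sup>2 + 2 * t) + (2 * t^3 + 3 * t\<^sup>2))"
    by (rule order_trans[OF layer_bound[OF assms(3)]])
  have "\<bar>d\<^sup>2 / d ^ i\<bar> = d\<^sup>2 / d ^ i" using assms(1) by simp
  then show ?thesis
    unfolding shell_correction_def abs_mult using l assms(1) by (simp only:) (rule mult_left_mono, auto)
qed

lemma shell_correction_continuous: "d > 0 \<Longrightarrow> continuous_on S (shell_correction t d i)"
  unfolding shell_correction_def[abs_def]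
  by (intro continuous_on_mult continuous_on_const continuous_on_compose2[OF layer_continuous[of UNIV]]
      continuous_on_divide continuous_on_diff continuous_on_id) auto

lemma shell_correction_dominated:
  assumes d: "0 < d" "d \<le> 1 / 2" and t: "t > 0"
  shows "dominated_H2 2 (5 * (26 * (250 * ((t\<^sup>2 + 2 * t) + (2 * t^3 + 3 * t\<^sup>2)))))
    (\<lambda>x. shell_correction t d 0 (norm x) / norm x)"
proof -
  define C where "C = 250 * ((t\<^sup>2 + 2 * t) + (2 * t^3 + 3 * t\<^sup>2))"
  have C0: "0 \<le> C" using t by (simp add: C_def)
  let ?q = "shell_correction t d"
  have q: "\<bar>?q i r\<bar> \<le> C" if "i \<le> 2" for i r
  proof -
    have "d\<^sup>2 / d ^ i = d ^ (2 - i)" using that d by (simp add: power_diff)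
    also have "\<dots> \<le> 1" using d by (simp add: power_le_one)
    finally have "d\<^sup>2 / d ^ i * C \<le> 1 * C" using C0 by (rule mult_right_mono)
    moreover have "\<bar>?q i r\<bar> \<le> d\<^sup>2 / d ^ i * C" unfolding C_def using shell_correction_bound that d t by simp
    ultimately show ?thesis by simp
  qed
  have z: "?q i r = 0" if "r \<le> 1 / 2 \<or> r > 2" "i < 5" for i r
    using that d by (intro shell_correction_outside) (auto simp: abs_if)
  define \<psi> where "\<psi> r = ?q 0 r / r" for r
  define \<psi>' where "\<psi>' r = ?q 1 r / r - ?q 0 r / r\<^sup>2" for r
  define \<psi>'' where "\<psi>'' r = ?q 2 r / r - 2 * ?q 1 r / r\<^sup>2 + 2 * ?q 0 r / r^3" for r
  note D = shell_correction_DERIV[OF _ d(1), where S = UNIV]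
  have D0: "(?q 0 has_real_derivative ?q 1 r) (at r)" and D1: "(?q 1 has_real_derivative ?q 2 r) (at r)" for r
    using D[of 0] D[of 1] by (simp_all add: eval_nat_numeral)
  \<comment> \<open>The correction lives where r > 1 / 2, so every division by r costs at most a
    factor 2.\<close>
  have div: "\<bar>?q i r / r ^ k\<bar> \<le> C * 2 ^ k" if "i \<le> 2" for i r k
  proof (cases "r \<le> 1 / 2")
    case True
    then show ?thesis using z[of r i] that C0 by simp
  next
    case False
    then have "\<bar>?q i r\<bar> * (1 / r) ^ k \<le> C * 2 ^ k"
      using q[OF that, of r] C0 by (intro mult_mono power_mono) (auto simp: field_simps)
    then show ?thesis using False by (simp add: abs_mult power_divide power_abs)
  qed
  \<comment> \<open>The second derivative has the largest bound: 2 + 2 * 4 + 2 * 8 = 26 times C. The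
    support lies in radius 2, which gives the factor 3 + 2.\<close>
  have "dominated_H2 2 ((3 + 2) * (26 * C)) (\<lambda>x. \<psi> (norm (x - 0)))"
  proof (rule dominated_H2_radial[where \<psi>' = \<psi>' and \<psi>'' = \<psi>''])
    show "(\<psi> has_real_derivative \<psi>' r) (at r)" if "r > 0" for r
      unfolding \<psi>_def[abs_def] \<psi>'_def using that D0
      by (auto intro!: derivative_eq_intros D0 simp: field_simps power2_eq_square)
    show "(\<psi>' has_real_derivative \<psi>'' r) (at r)" if "r > 0" for r
      unfolding \<psi>'_def[abs_def] \<psi>''_def using that
      by (auto intro!: derivative_eq_intros D0 D1 D1[unfolded One_nat_def] simp: field_simps power2_eq_square
          power3_eq_cube)
    show "continuous_on {0..} \<psi>"
    proof -
      have "continuous_on ({1/4..} \<union> {..1/2}) \<psi>"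
      proof (rule continuous_on_closed_Un)
        show "continuous_on {1/4..} \<psi>"
          unfolding \<psi>_def by (intro continuous_intros shell_correction_continuous d) auto
        show "continuous_on {..1/2} \<psi>"
          by (rule continuous_on_eq[OF continuous_on_const[of _ 0]]) (use z in \<open>auto simp: \<psi>_def\<close>)
      qed auto
      then show ?thesis by (rule continuous_on_subset) auto
    qed
    show "continuous_on {0<..} \<psi>''"
      unfolding \<psi>''_def by (intro continuous_intros shell_correction_continuous d) auto
    show "\<bar>\<psi> r\<bar> \<le> 26 * C" for r
      using div[of 0 r 1] C0 by (simp add: \<psi>_def)
    have p: "\<bar>\<psi>' r\<bar> \<le> 6 * C" for r
    proof -
      have "\<bar>?q 1 r / r\<bar> \<le> 2 * C" using div[of 1 r 1] by simp
      moreover have "\<bar>?q 0 r / r\<^sup>2\<bar> \<le> 4 * C" using div[of 0 r 2] by simp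
      ultimately show ?thesis unfolding \<psi>'_def by linarith
    qed
    show "\<bar>\<psi>' r\<bar> \<le> 26 * C * r" if "r > 0" for r
    proof (cases "r \<le> 1 / 2")
      case True
      then show ?thesis using z[of r] C0 that by (simp add: \<psi>'_def)
    next
      case False
      then have "6 * C \<le> 26 * C * r" using mult_left_mono[of "1/2" r "26 * C"] C0 by simp
      then show ?thesis using p[of r] by linarith
    qed
    show "\<bar>\<psi>'' r\<bar> \<le> 26 * C" for r
    proof -
      have "\<psi>'' r = ?q 2 r / r ^ 1 - 2 * (?q 1 r / r ^ 2) + 2 * (?q 0 r / r ^ 3)" by (simp add: \<psi>''_def)
      moreover have "\<bar>?q 2 r / r ^ 1\<bar> \<le> 2 * C" using div[of 2 r 1] by simp
      moreover have "\<bar>?q 1 r / r ^ 2\<bar> \<le> 4 * C" using div[of 1 r 2] by simp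
      moreover have "\<bar>?q 0 r / r ^ 3\<bar> \<le> 8 * C" using div[of 0 r 3] by simp
      ultimately show ?thesis by linarith
    qed
    show "\<psi> r = 0" "\<psi>' r = 0" "\<psi>'' r = 0" if "r > 2" for r
      using z[of r] that by (simp_all add: \<psi>_def \<psi>'_def \<psi>''_def)
  qed simp_all
  then show ?thesis by (simp add: \<psi>_def C_def)
qed

text \<open>The function 1 has the profile p, whose derivatives at p = 1 violate the boundary
  conditions. The correction repairs them, and the sum is then the potential of an integrable
  density on the ball, with the mass given by the boundary values and the integral of p times the
  profile.\<close>

lemma weighting_shell:
  assumes w: "is_weighting t (cball 0 1) w" and t: "t > 0" and d: "0 < d" "d \<le> 1 / 2"
    and h: "\<And>x. x \<in> cball 0 1 \<Longrightarrow> H2_fun h x = 1"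
    and F: "\<And>x. H2_fun F x = shell_correction t d 0 (norm x) / norm x"
  shows "blinfun_apply w (h + F) = 1 + 2 * t + t\<^sup>2 + t^3 / 6
     + t^3 / 2 * integral {0..1} (\<lambda>p. p * shell_correction t d 0 p)"
proof -
  define f where "f i p = (if i = 0 then p else if i = 1 then 1 else 0) + shell_correction t d i p" for i p
  have D: "(f i has_real_derivative f (Suc i) p) (at p within {0..1})" if "i < 4" for i p
  proof -
    have "((\<lambda>p::real. if i = 0 then p else if i = 1 then 1 else 0) has_real_derivative
        (if Suc i = 0 then p else if Suc i = 1 then 1 else 0)) (at p within {0..1})"
      by (cases "i = 0"; cases "i = 1") (auto intro!: derivative_eq_intros)
    from DERIV_add[OF this shell_correction_DERIV[OF that d(1)]] show ?thesis by (simp only: f_def[abs_def])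
  qed
  have f4: "continuous_on {0..1} (f 4)" unfolding f_def by (simp add: shell_correction_continuous[OF d(1)])
  have f0: "f 0 0 = 0" "f 2 0 = 0" using d by (simp_all add: f_def shell_correction_outside)
  \<comment> \<open>These are the conditions f'' = - 2 t f' - t^2 f and f''' = 3 t^2 f' + 2 t^3 f
    for f = f' = 1; the coefficients 1 / 2 and 1 / 6 in the correction are the Taylor factors that
    produce them.\<close>
  have E: "f 0 1 = 1" "f 1 1 = 1" "f 2 1 = - (t\<^sup>2 + 2 * t)" "f 3 1 = 2 * t^3 + 3 * t\<^sup>2"
    using d by (simp_all add: f_def shell_correction_def layer_0 layer_0[simplified] power2_eq_square
        power3_eq_cube)
  define v where "v = radial_density 1 (ode_density t f)"
  have vint: "integrable lborel v" unfolding v_def by (rule ode_density_integrable[OF t zero_le_one D f4 f0])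
  have vsupp: "y \<in> cball 0 1" if "v y \<noteq> 0" for y
    using that by (auto simp: v_def radial_density_def indicator_def split: if_splits)
  let ?P = "\<lambda>x. \<integral>y. v y * exp (- (t * norm (x - y))) \<partial>lborel"
  have pot: "H2_fun (h + F) x = ?P x" if "x \<noteq> 0" "x \<in> cball 0 1" for x
  proof -
    have "?P x = f 0 (norm x) / norm x"
      unfolding v_def
      by (rule ode_density_potential_inside[OF t zero_le_one D f4 f0 _ _ that(1)])
         (use that E in \<open>auto simp: algebra_simps\<close>)
    also have "\<dots> = 1 + shell_correction t d 0 (norm x) / norm x"
      using that(1) by (simp add: f_def add_divide_distrib)
    finally show ?thesis using h[OF that(2)] F by simp
  qed
  \<comment> \<open>At the centre both sides are limits of their values nearby.\<close>
  have pot0: "H2_fun (h + F) 0 = ?P 0"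
  proof (rule tendsto_unique[of "at (0::real^3)"])
    have "\<forall>x\<in>UNIV. isCont ?P x"
      using continuous_potential[OF vint t] by (simp only: continuous_on_eq_continuous_at[OF open_UNIV])
    then show "(?P \<longlongrightarrow> ?P 0) (at 0)" unfolding isCont_def by blast
    have "\<forall>\<^sub>F x in at (0::real^3). x \<in> ball 0 1 \<and> x \<noteq> 0"
      by (auto simp: eventually_at intro!: exI[of _ 1])
    then have "\<forall>\<^sub>F x in at 0. H2_fun (h + F) x = ?P x"
      by eventually_elim (rule pot, auto)
    moreover have "(H2_fun (h + F) \<longlongrightarrow> H2_fun (h + F) 0) (at 0)"
      using H2_continuous[of "h + F"] by (simp add: continuous_on_eq_continuous_at isCont_def)
    ultimately show "(?P \<longlongrightarrow> H2_fun (h + F) 0) (at 0)"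
      by (rule Lim_transform_eventually[rotated])
  qed simp
  have "blinfun_apply w (h + F) = (\<integral>y. v y \<partial>lborel)"
  proof (rule weighting_pairing_potential[OF w t vint vsupp])
    show "H2_fun (h + F) x = ?P x" if "x \<in> cball 0 1" for x
      using pot[OF _ that] pot0 by (cases "x = 0") auto
  qed auto
  also have "\<dots> = (t^4 * integral {0..1} (\<lambda>p. p * f 0 p) + (1 * f 3 1 - f 2 1) - 2 * t\<^sup>2
      * (1 * f 1 1 - f 0 1)) / (2 * t)"
    unfolding v_def by (rule ode_density_mass[OF t zero_le_one D f4 f0])
  also have "integral {0..1} (\<lambda>p. p * f 0 p) = 1 / 3 + integral {0..1} (\<lambda>p. p * shell_correction t d 0 p)"
  proof -
    have "((\<lambda>p::real. p\<^sup>2) has_integral (1::real)^3 / 3 - 0^3 / 3) {0..1}"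
    proof (rule fundamental_theorem_of_calculus)
      show "((\<lambda>p. p^3 / 3) has_vector_derivative p\<^sup>2) (at p within {0..1})" for p :: real
        unfolding has_real_derivative_iff_has_vector_derivative[symmetric]
        by (auto intro!: derivative_eq_intros)
    qed simp
    then have "((\<lambda>p::real. p\<^sup>2) has_integral 1 / 3) {0..1}" by simp
    moreover have "((\<lambda>p. p * shell_correction t d 0 p) has_integral integral {0..1} (\<lambda>p. p
        * shell_correction t d 0 p)) {0..1}"
      by (intro integrable_integral integrable_continuous_real continuous_intros shell_correction_continuous d)
    ultimately have "((\<lambda>p. p\<^sup>2 + p * shell_correction t d 0 p) has_integral
      1 / 3 + integral {0..1} (\<lambda>p. p * shell_correction t d 0 p)) {0..1}" by (rule has_integral_add)
    moreover have "(\<lambda>p. p\<^sup>2 + p * shell_correction t d 0 p) = (\<lambda>p. p * f 0 p)"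
      by (auto simp: f_def power2_eq_square algebra_simps)
    ultimately show ?thesis by (simp add: integral_unique)
  qed
  also have "(t^4 * (1 / 3 + J) + (1 * f 3 1 - f 2 1) - 2 * t\<^sup>2 * (1 * f 1 1 - f 0 1)) / (2 * t)
    = 1 + 2 * t + t\<^sup>2 + t^3 / 6 + t^3 / 2 * J" for J
    unfolding E using t by (simp add: field_simps power2_eq_square power3_eq_cube power4_eq_xxxx)
  finally show ?thesis .
qed

text \<open>The shell width tends to 0. The corrections stay bounded in norm and tend to 0
  pointwise, so their pairings and integrals vanish in the limit. The polynomial is the magnitude of
  the ball of radius t.\<close>

lemma weighting_magnitude:
  assumes w: "is_weighting t (cball 0 1) w" and t: "t > 0"
    and h: "\<And>x. x \<in> cball 0 1 \<Longrightarrow> H2_fun h x = 1"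
  shows "blinfun_apply w h = 1 + 2 * t + t\<^sup>2 + t^3 / 6"
proof -
  define d where "d n = inverse (real (Suc (Suc n)))" for n
  have d: "0 < d n" "d n \<le> 1 / 2" "d n \<le> 1" for n by (simp_all add: d_def field_simps)
  have dlim: "d \<longlonglongrightarrow> 0" unfolding d_def using LIMSEQ_Suc[OF LIMSEQ_inverse_real_of_nat] .
  define C where "C = 250 * ((t\<^sup>2 + 2 * t) + (2 * t^3 + 3 * t\<^sup>2))"
  have cb: "\<bar>shell_correction t (d n) 0 r\<bar> \<le> (d n)\<^sup>2 * C" for n r
    using shell_correction_bound[OF d(1,3), of 0 t n r] t by (simp add: C_def)
  define F where "F n = Abs_H2 (\<lambda>x. shell_correction t (d n) 0 (norm x) / norm x)" for n
  note dom = shell_correction_dominated[OF d(1,2) t]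
  have F: "H2_fun (F n) = (\<lambda>x. shell_correction t (d n) 0 (norm x) / norm x)" for n
    unfolding F_def by (rule Abs_H2_inverse[OF dominated_H2_sobolev2[OF dom]])
  have "(\<lambda>n. blinfun_apply w (F n)) \<longlonglongrightarrow> 0"
  proof (rule pairing_bounded_tendsto_0)
    show "w \<in> closure (fin_supp_measures (cball 0 1))" using w by (simp add: is_weighting_def)
    show "norm (F n) \<le> ball_const 2 * (5 * (26 * (250 * ((t\<^sup>2 + 2 * t) + (2 * t^3 + 3 * t\<^sup>2)))))" for n
      by (rule dominated_H2_norm) (use dom[of n] t in \<open>simp_all add: F\<close>)
    fix x :: "real^3"
    have "(\<lambda>n. shell_correction t (d n) 0 (norm x)) \<longlonglongrightarrow> 0"
    proof (rule Lim_null_comparison)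
      show "\<forall>\<^sub>F n in sequentially. norm (shell_correction t (d n) 0 (norm x)) \<le> (d n)\<^sup>2 * C" using cb by simp
      have "(\<lambda>n. (d n)\<^sup>2 * C) \<longlonglongrightarrow> 0\<^sup>2 * C" by (intro tendsto_intros dlim)
      then show "(\<lambda>n. (d n)\<^sup>2 * C) \<longlonglongrightarrow> 0" by simp
    qed
    then have "(\<lambda>n. shell_correction t (d n) 0 (norm x) * inverse (norm x)) \<longlonglongrightarrow> 0 * inverse (norm x)"
      by (rule tendsto_mult_right)
    then show "(\<lambda>n. H2_fun (F n) x) \<longlonglongrightarrow> 0" by (simp add: F divide_inverse)
  qed
  then have l1: "(\<lambda>n. blinfun_apply w h + blinfun_apply w (F n)) \<longlonglongrightarrow> blinfun_apply w h + 0"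
    by (intro tendsto_add tendsto_const)
  have "(\<lambda>n. integral {0..1} (\<lambda>p. p * shell_correction t (d n) 0 p)) \<longlonglongrightarrow> 0"
  proof (rule Lim_null_comparison)
    have "norm (integral {0..1} (\<lambda>p. p * shell_correction t (d n) 0 p)) \<le> (d n)\<^sup>2 * C" for n
    proof -
      have "norm (integral {0..1} (\<lambda>p. p * shell_correction t (d n) 0 p)) \<le> ((d n)\<^sup>2 * C) * (1 - 0)"
      proof (rule integral_bound)
        show "continuous_on {0..1} (\<lambda>p. p * shell_correction t (d n) 0 p)"
          by (intro continuous_intros shell_correction_continuous d)
        fix p :: real assume "p \<in> {0..1}"
        then have "\<bar>p\<bar> * \<bar>shell_correction t (d n) 0 p\<bar> \<le> 1 * ((d n)\<^sup>2 * C)"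
          using cb by (intro mult_mono) auto
        then show "norm (p * shell_correction t (d n) 0 p) \<le> (d n)\<^sup>2 * C" by (simp add: abs_mult)
      qed simp
      then show ?thesis by simp
    qed
    then show "\<forall>\<^sub>F n in sequentially. norm (integral {0..1} (\<lambda>p. p * shell_correction t (d n) 0 p))
        \<le> (d n)\<^sup>2 * C" by simp
    have "(\<lambda>n. (d n)\<^sup>2 * C) \<longlonglongrightarrow> 0\<^sup>2 * C" by (intro tendsto_intros dlim)
    then show "(\<lambda>n. (d n)\<^sup>2 * C) \<longlonglongrightarrow> 0" by simp
  qed
  then have "(\<lambda>n. 1 + 2 * t + t\<^sup>2 + t^3 / 6 + t^3 / 2 * integral {0..1} (\<lambda>p. p * shell_correction t (d n) 0 p))
    \<longlonglongrightarrow> 1 + 2 * t + t\<^sup>2 + t^3 / 6 + t^3 / 2 * 0"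
    by (intro tendsto_intros)
  moreover have "blinfun_apply w h + blinfun_apply w (F n)
    = 1 + 2 * t + t\<^sup>2 + t^3 / 6 + t^3 / 2 * integral {0..1} (\<lambda>p. p * shell_correction t (d n) 0 p)" for n
    using weighting_shell[OF w t d(1,2) h, of "F n" n] by (simp add: F blinfun.add_right)
  ultimately show ?thesis using LIMSEQ_unique[OF l1] by simp
qed

section \<open>Uniform boundedness\<close>

text \<open>The uniform boundedness principle by the gliding hump argument, for a \<open>\<sigma>\<close>-convex set \<open>Q\<close> instead
  of the unit ball; this avoids the completeness of \<open>H2\<close>.\<close>

lemma uniform_boundedness_sigma_convex:
  fixes T :: "real \<Rightarrow> 'a::real_normed_vector \<Rightarrow>\<^sub>L real" and Q :: "'a set"
  assumes bdd: "\<And>q. q \<in> Q \<Longrightarrow> norm q \<le> C"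
    and sc: "\<And>(q :: nat \<Rightarrow> 'a) a. (\<And>n. q n \<in> Q) \<Longrightarrow> summable (\<lambda>n. \<bar>a n\<bar>) \<Longrightarrow> (\<Sum>n. \<bar>a n\<bar>) \<le> 1
      \<Longrightarrow> \<exists>x. (\<lambda>n. a n *\<^sub>R q n) sums x"
    and conv: "\<And>f. \<exists>l. ((\<lambda>t. blinfun_apply (T t) f) \<longlongrightarrow> l) (at_right 0)"
  shows "\<exists>K. \<forall>\<^sub>F t in at_right 0. \<forall>q\<in>Q. \<bar>blinfun_apply (T t) q\<bar> \<le> K"
proof (rule ccontr)
  assume neg: "\<not> (\<exists>K. \<forall>\<^sub>F t in at_right 0. \<forall>q\<in>Q. \<bar>blinfun_apply (T t) q\<bar> \<le> K)"
  have ex: "\<exists>t q. 0 < t \<and> t < \<epsilon> \<and> q \<in> Q \<and> K < \<bar>blinfun_apply (T t) q\<bar>" if "0 < \<epsilon>" for \<epsilon> K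
  proof (rule ccontr)
    assume "\<not> ?thesis"
    then have "\<forall>t. 0 < t \<longrightarrow> t < \<epsilon> \<longrightarrow> (\<forall>q\<in>Q. \<bar>blinfun_apply (T t) q\<bar> \<le> K)" by (meson not_le)
    then have "\<forall>\<^sub>F t in at_right 0. \<forall>q\<in>Q. \<bar>blinfun_apply (T t) q\<bar> \<le> K"
      unfolding eventually_at_right_field using that by blast
    then show False using neg by blast
  qed
  \<comment> \<open>With ratio 1 / 3 all later coefficients together amount to half of the current
    one, less than the share 3 / 4 kept in the hump; and the growth 4^n outruns the decay 3^(-
    n).\<close>
  define r :: real where "r = 1 / 3"
  \<comment> \<open>\<open>S\<close> will be the supremum over Q, finite because Q is bounded and
    each functional is continuous; \<open>q\<close> attains at least three quarters of it.\<close>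
  define good where "good n t q S \<longleftrightarrow> 0 < t \<and> t < inverse (real (Suc n)) \<and> q \<in> Q \<and> 4 ^ n < S \<and>
      3 / 4 * S \<le> \<bar>blinfun_apply (T t) q\<bar> \<and> (\<forall>q'\<in>Q. \<bar>blinfun_apply (T t) q'\<bar> \<le> S)" for n t q S
  have "\<exists>t q S. good n t q S" for n
  proof -
    obtain t q0 where t: "0 < t" "t < inverse (real (Suc n))"
        and q0: "q0 \<in> Q" "4 ^ n < \<bar>blinfun_apply (T t) q0\<bar>"
      using ex[of "inverse (real (Suc n))" "4 ^ n"] by auto
    define A where "A = (\<lambda>q. \<bar>blinfun_apply (T t) q\<bar>) ` Q"
    have bA: "bdd_above A"
    proof (rule bdd_aboveI)
      fix y assume "y \<in> A"
      then obtain q where "q \<in> Q" "y = \<bar>blinfun_apply (T t) q\<bar>" by (auto simp: A_def)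
      then show "y \<le> norm (T t) * C"
        using norm_blinfun[of "T t" q] mult_left_mono[OF bdd, of q "norm (T t)"] by simp
    qed
    have neA: "A \<noteq> {}" using q0 by (auto simp: A_def)
    define S where "S = Sup A"
    have S: "y \<le> S" if "y \<in> A" for y unfolding S_def using that bA by (rule cSup_upper)
    have "4 ^ n < S" using S[of "\<bar>blinfun_apply (T t) q0\<bar>"] q0 by (auto simp: A_def)
    moreover have "(0::real) < 4 ^ n" by simp
    ultimately have S0: "0 < S" "4 ^ n < S" by linarith+
    then have "3 / 4 * S < Sup A" by (simp add: S_def)
    then obtain y where "y \<in> A" "3 / 4 * S < y" using less_cSupD[OF neA] by blast
    then obtain q where "q \<in> Q" "3 / 4 * S \<le> \<bar>blinfun_apply (T t) q\<bar>" by (auto simp: A_def)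
    then have "good n t q S" using t S0 S by (auto simp: good_def A_def)
    then show ?thesis by blast
  qed
  then obtain t q S where g: "\<And>n. good n (t n) (q n) (S n)" by metis
  have tn: "0 < t n" "t n < inverse (real (Suc n))" and qn: "q n \<in> Q" and Sn: "4 ^ n < S n"
      "3 / 4 * S n \<le> \<bar>blinfun_apply (T (t n)) (q n)\<bar>" "\<And>q'. q' \<in> Q \<Longrightarrow> \<bar>blinfun_apply (T (t n)) q'\<bar> \<le> S n" for n
    using g[of n] by (auto simp: good_def)
  \<comment> \<open>Partial sums with signs chosen one at a time: of |u + v| and |u - v| at least
    one is no smaller than |v|, so the new term cannot be cancelled by the preceding ones.\<close>
  define p where "p = rec_nat 0 (\<lambda>n x. if r ^ Suc n * \<bar>blinfun_apply (T (t n)) (q n)\<bar>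
      \<le> \<bar>blinfun_apply (T (t n)) (x + r ^ Suc n *\<^sub>R q n)\<bar> then x + r ^ Suc n *\<^sub>R q n else x - r ^ Suc n *\<^sub>R q
          n)"
  have p: "p 0 = 0" "p (Suc n) = (if r ^ Suc n * \<bar>blinfun_apply (T (t n)) (q n)\<bar>
      \<le> \<bar>blinfun_apply (T (t n)) (p n + r ^ Suc n *\<^sub>R q n)\<bar> then p n + r ^ Suc n *\<^sub>R q n else p n - r ^ Suc n
          *\<^sub>R q n)" for n
    by (simp_all add: p_def)
  define a where "a n = (if r ^ Suc n * \<bar>blinfun_apply (T (t n)) (q n)\<bar>
      \<le> \<bar>blinfun_apply (T (t n)) (p n + r ^ Suc n *\<^sub>R q n)\<bar> then r ^ Suc n else - (r ^ Suc n))" for n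
  have r0: "0 < r" "r < 1" by (simp_all add: r_def)
  have pa: "p (Suc n) = p n + a n *\<^sub>R q n" for n unfolding p(2) a_def by simp
  have psum: "p n = (\<Sum>m<n. a m *\<^sub>R q m)" for n by (induction n) (simp_all add: p(1) pa)
  have aabs: "\<bar>a n\<bar> = r ^ Suc n" for n using r0 by (simp add: a_def)
  have hump: "r ^ Suc n * (3 / 4 * S n) \<le> \<bar>blinfun_apply (T (t n)) (p (Suc n))\<bar>" for n
  proof -
    have "r ^ Suc n * \<bar>blinfun_apply (T (t n)) (q n)\<bar> \<le> \<bar>blinfun_apply (T (t n)) (p (Suc n))\<bar>"
    proof (cases "r ^ Suc n * \<bar>blinfun_apply (T (t n)) (q n)\<bar>
        \<le> \<bar>blinfun_apply (T (t n)) (p n + r ^ Suc n *\<^sub>R q n)\<bar>")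
      case True
      then show ?thesis by (simp only: p(2) if_True)
    next
      case False
      define u where "u = blinfun_apply (T (t n)) (p n)"
      define v where "v = r ^ Suc n * blinfun_apply (T (t n)) (q n)"
      have v: "r ^ Suc n * \<bar>blinfun_apply (T (t n)) (q n)\<bar> = \<bar>v\<bar>" using r0 by (simp add: v_def abs_mult)
      have "blinfun_apply (T (t n)) (p n + r ^ Suc n *\<^sub>R q n) = u + v"
        "blinfun_apply (T (t n)) (p n - r ^ Suc n *\<^sub>R q n) = u - v"
        by (simp_all add: u_def v_def blinfun.add_right blinfun.diff_right blinfun.scaleR_right)
      then show ?thesis using False unfolding p(2) v by simp
    qed
    moreover have "r ^ Suc n * (3 / 4 * S n) \<le> r ^ Suc n * \<bar>blinfun_apply (T (t n)) (q n)\<bar>"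
      using Sn(2) r0 by (intro mult_left_mono) auto
    ultimately show ?thesis by linarith
  qed
  have gs: "(\<lambda>n. r ^ Suc n) sums (1 / 2)"
    using sums_mult[OF geometric_sums[of r], of r] r0 by (simp add: r_def)
  obtain x where x: "(\<lambda>n. a n *\<^sub>R q n) sums x"
    using sc[of q a, OF qn] sums_summable[OF gs] sums_unique[OF gs] by (auto simp: aabs)
  \<comment> \<open>The hump contributes 3 / 4 and the tail takes away at most 1 / 2 of r^(n + 1)
    times \<open>S n\<close>, leaving 1 / 4.\<close>
  have big: "r ^ Suc n * S n / 4 \<le> \<bar>blinfun_apply (T (t n)) x\<bar>" for n
  proof -
    let ?L = "blinfun_apply (T (t n))"
    have "(\<lambda>m. ?L (a m *\<^sub>R q m)) sums ?L x"
      using bounded_linear.sums[OF blinfun.bounded_linear_right x] .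
    then have "(\<lambda>m. a m * ?L (q m)) sums ?L x" by (simp add: blinfun.scaleR_right)
    from sums_split_initial_segment[OF this, of "Suc n"]
    have tail: "(\<lambda>m. a (m + Suc n) * ?L (q (m + Suc n))) sums (?L x - ?L (p (Suc n)))"
      by (simp add: psum blinfun.sum_right blinfun.scaleR_right del: sum.lessThan_Suc)
    have gt: "(\<lambda>m. r ^ Suc n * S n * r ^ Suc m) sums (r ^ Suc n * S n * (1 / 2))"
      by (rule sums_mult[OF gs])
    have "norm (a (m + Suc n) * ?L (q (m + Suc n))) \<le> r ^ Suc n * S n * r ^ Suc m" for m
    proof -
      have "norm (a (m + Suc n) * ?L (q (m + Suc n))) \<le> r ^ Suc (m + Suc n) * S n"
        unfolding real_norm_def abs_mult aabs using Sn(3)[OF qn] r0 by (intro mult_left_mono) auto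
      also have "\<dots> = r ^ Suc n * S n * r ^ Suc m" by (simp add: power_add)
      finally show ?thesis .
    qed
    then have "norm (?L x - ?L (p (Suc n))) \<le> r ^ Suc n * S n * (1 / 2)"
      by (rule norm_sums_le[OF tail gt])
    then show ?thesis using hump[of n] by (simp add: field_simps abs_if split: if_splits)
  qed
  obtain l where l: "((\<lambda>t. blinfun_apply (T t) x) \<longlongrightarrow> l) (at_right 0)" using conv by blast
  have "filterlim t (at_right 0) sequentially"
    unfolding filterlim_at
  proof
    show "\<forall>\<^sub>F n in sequentially. t n \<in> {0<..} \<and> t n \<noteq> 0" using tn(1) by (simp add: less_imp_neq[symmetric])
    show "t \<longlonglongrightarrow> 0"
      by (rule tendsto_sandwich[OF _ _ tendsto_const LIMSEQ_inverse_real_of_nat])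
         (intro always_eventually allI less_imp_le tn)+
  qed
  from filterlim_compose[OF l this] have "(\<lambda>n. blinfun_apply (T (t n)) x) \<longlonglongrightarrow> l" .
  then obtain B where B: "\<And>n. \<bar>blinfun_apply (T (t n)) x\<bar> \<le> B"
    using Bseq_def convergentI convergent_imp_Bseq by (metis real_norm_def)
  have "(4 / 3) ^ n \<le> 12 * B" for n
  proof -
    have "r ^ Suc n * 4 ^ n \<le> r ^ Suc n * S n" using Sn(1)[of n] r0 by (intro mult_left_mono) auto
    then have "r ^ Suc n * 4 ^ n \<le> 4 * B" using big[of n] B[of n] by linarith
    moreover have "r ^ Suc n * 4 ^ n = (4 / 3) ^ n / 3" by (simp add: r_def power_divide)
    ultimately show ?thesis by linarith
  qed
  moreover obtain n where "12 * B < (4 / 3) ^ n" using real_arch_pow[of "4 / 3" "12 * B"] by auto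
  ultimately show False using not_le by blast
qed

text \<open>The limit is written down as the pointwise series; the remainder is dominated with a
  constant proportional to the tail of |a n|, so convergence in norm follows without a completeness
  argument.\<close>

lemma dominated_H2_sigma_convex:
  fixes q :: "nat \<Rightarrow> H2"
  assumes q: "\<And>n. dominated_H2 R L (H2_fun (q n))" and L: "0 \<le> L" and a: "summable (\<lambda>n. \<bar>a n\<bar>)"
  shows "\<exists>x. (\<lambda>n. a n *\<^sub>R q n) sums x"
proof -
  define x where "x = Abs_H2 (\<lambda>y. \<Sum>n. a n * H2_fun (q n) y)"
  have "dominated_H2 R ((\<Sum>n. \<bar>a n\<bar>) * L) (\<lambda>y. \<Sum>n. a n * H2_fun (q n) y)"
    by (rule dominated_H2_series[OF q a order_refl L])
  then have x: "H2_fun x = (\<lambda>y. \<Sum>n. a n * H2_fun (q n) y)"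
    unfolding x_def by (intro Abs_H2_inverse dominated_H2_sobolev2)
  have s: "summable (\<lambda>n. a n * H2_fun (q n) y)" for y
  proof (rule summable_rabs_cancel, rule summable_comparison_test'[OF summable_mult2[OF a, of L], of 0])
    fix n
    have "\<bar>H2_fun (q n) y\<bar> \<le> L * indicator (cball 0 R) y" using q[of n] by (simp add: dominated_H2_def)
    also have "\<dots> \<le> L" using L by (simp add: indicator_def)
    finally show "norm \<bar>a n * H2_fun (q n) y\<bar> \<le> \<bar>a n\<bar> * L" by (simp add: abs_mult mult_left_mono)
  qed
  have Fsum: "H2_fun (\<Sum>m<N. a m *\<^sub>R q m) y = (\<Sum>m<N. a m * H2_fun (q m) y)" for N y
    by (induction N) simp_all
  have n: "norm (x - (\<Sum>m<N. a m *\<^sub>R q m)) \<le> ball_const R * ((\<Sum>m. \<bar>a (m + N)\<bar>) * L)" for N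
  proof (rule dominated_H2_norm)
    have "H2_fun (x - (\<Sum>m<N. a m *\<^sub>R q m)) = (\<lambda>y. \<Sum>m. a (m + N) * H2_fun (q (m + N)) y)"
    proof
      fix y
      show "H2_fun (x - (\<Sum>m<N. a m *\<^sub>R q m)) y = (\<Sum>m. a (m + N) * H2_fun (q (m + N)) y)"
        using suminf_split_initial_segment[OF s, of y N] by (simp add: x Fsum)
    qed
    moreover have "dominated_H2 R ((\<Sum>m. \<bar>a (m + N)\<bar>) * L) (\<lambda>y. \<Sum>m. a (m + N) * H2_fun (q (m + N)) y)"
      using a by (intro dominated_H2_series[OF q _ order_refl L] summable_ignore_initial_segment)
    ultimately show "dominated_H2 R ((\<Sum>m. \<bar>a (m + N)\<bar>) * L) (H2_fun (x - (\<Sum>m<N. a m *\<^sub>R q m)))" by simp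
    show "0 \<le> (\<Sum>m. \<bar>a (m + N)\<bar>) * L"
      using a L by (intro mult_nonneg_nonneg suminf_nonneg summable_ignore_initial_segment) auto
  qed
  have "(\<lambda>N. \<Sum>m. \<bar>a (m + N)\<bar>) \<longlonglongrightarrow> 0"
    using suminf_exist_split2[OF a] .
  then have "(\<lambda>N. ball_const R * ((\<Sum>m. \<bar>a (m + N)\<bar>) * L)) \<longlonglongrightarrow> ball_const R * (0 * L)"
    by (intro tendsto_intros)
  then have "(\<lambda>N. x - (\<Sum>m<N. a m *\<^sub>R q m)) \<longlonglongrightarrow> 0"
    by (intro Lim_null_comparison[OF always_eventually[OF allI[OF n]]]) simp
  from tendsto_diff[OF tendsto_const[of x] this] have "(\<lambda>n. a n *\<^sub>R q n) sums x" by (simp add: sums_def)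
  then show ?thesis by blast
qed

section \<open>The microscopic weighting\<close>

text \<open>Cubes of positive parts can be differentiated twice with continuous result. The value is
  1 up to 3 and 0 from 4 on; two points of the unit ball are at distance at most 2, so a
  neighbourhood of the ball remains where the cutoff is 1.\<close>

definition cutoff :: "real \<Rightarrow> real" where "cutoff r = max 0 (1 - max 0 (r - 3) ^ 3) ^ 3"

definition cutoff' :: "real \<Rightarrow> real" where
  "cutoff' r = - 9 * max 0 (1 - max 0 (r - 3) ^ 3) ^ 2 * max 0 (r - 3) ^ 2"

definition cutoff'' :: "real \<Rightarrow> real" where
  "cutoff'' r = 54 * max 0 (1 - max 0 (r - 3) ^ 3) * max 0 (r - 3) ^ 4
     - 18 * max 0 (1 - max 0 (r - 3) ^ 3) ^ 2 * max 0 (r - 3)"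

lemma cutoff_DERIV:
  "(cutoff has_real_derivative cutoff' r) (at r)" "(cutoff' has_real_derivative cutoff'' r) (at r)"
proof -
  have s: "((\<lambda>r::real. r - 3) has_real_derivative 1) (at r)" by (auto intro!: derivative_eq_intros)
  have u3: "((\<lambda>r::real. max 0 (r - 3) ^ 3) has_real_derivative 3 * max 0 (r - 3) ^ 2) (at r)"
    using DERIV_chain2[OF pos_power_DERIV[of 3] s] by simp
  have u2: "((\<lambda>r::real. max 0 (r - 3) ^ 2) has_real_derivative 2 * max 0 (r - 3)) (at r)"
    using DERIV_chain2[OF pos_power_DERIV[of 2] s] by simp
  have g: "((\<lambda>r::real. 1 - max 0 (r - 3) ^ 3) has_real_derivative - (3 * max 0 (r - 3) ^ 2)) (at r)"
    using DERIV_diff[OF DERIV_const u3] by simp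
  have g3: "((\<lambda>r::real. max 0 (1 - max 0 (r - 3) ^ 3) ^ 3) has_real_derivative
      3 * max 0 (1 - max 0 (r - 3) ^ 3) ^ 2 * - (3 * max 0 (r - 3) ^ 2)) (at r)"
    using DERIV_chain2[OF pos_power_DERIV[of 3] g] by simp
  have g2: "((\<lambda>r::real. max 0 (1 - max 0 (r - 3) ^ 3) ^ 2) has_real_derivative
      2 * max 0 (1 - max 0 (r - 3) ^ 3) * - (3 * max 0 (r - 3) ^ 2)) (at r)"
    using DERIV_chain2[OF pos_power_DERIV[of 2] g] by simp
  show "(cutoff has_real_derivative cutoff' r) (at r)"
    using g3 by (simp add: cutoff_def[abs_def] cutoff'_def mult.assoc)
  have "cutoff'' r = - 9 * (2 * max 0 (1 - max 0 (r - 3) ^ 3) * - (3 * max 0 (r - 3) ^ 2) * max 0 (r - 3) ^ 2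
      + 2 * max 0 (r - 3) * max 0 (1 - max 0 (r - 3) ^ 3) ^ 2)"
    unfolding cutoff''_def by algebra
  moreover have "cutoff' = (\<lambda>r. - 9 * (max 0 (1 - max 0 (r - 3) ^ 3) ^ 2 * max 0 (r - 3) ^ 2))"
    by (auto simp: cutoff'_def)
  ultimately show "(cutoff' has_real_derivative cutoff'' r) (at r)"
    using DERIV_cmult[OF DERIV_mult[OF g2 u2], of "- 9"] by (simp only:)
qed

lemma cutoff_eq_1: "r \<le> 3 \<Longrightarrow> cutoff r = 1" by (simp add: cutoff_def)

lemma cutoff_eq_0:
  assumes "r \<ge> 4"
  shows "cutoff r = 0" "cutoff' r = 0" "cutoff'' r = 0"
proof -
  have "1 ^ 3 \<le> (r - 3) ^ 3" using assms by (intro power_mono) auto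
  then have "max 0 (1 - max 0 (r - 3) ^ 3) = 0" using assms by simp
  then show "cutoff r = 0" "cutoff' r = 0" "cutoff'' r = 0"
    unfolding cutoff_def cutoff'_def cutoff''_def by simp_all
qed

lemma cutoff_bounds:
  assumes "r \<le> 4"
  shows "\<bar>cutoff r\<bar> \<le> 1" "\<bar>cutoff' r\<bar> \<le> 9" "\<bar>cutoff'' r\<bar> \<le> 72"
proof -
  define u where "u = max 0 (r - 3)"
  define g where "g = max 0 (1 - u ^ 3)"
  have u: "0 \<le> u" "u \<le> 1" using assms by (auto simp: u_def)
  then have g: "0 \<le> g" "g \<le> 1" by (auto simp: g_def)
  have p: "0 \<le> g ^ i * u ^ j" "g ^ i * u ^ j \<le> 1" for i j
    using u g by (simp_all add: mult_le_one power_le_one)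
  have c: "cutoff r = g ^ 3 * u ^ 0" "cutoff' r = - 9 * (g ^ 2 * u ^ 2)"
    "cutoff'' r = 54 * (g ^ 1 * u ^ 4) - 18 * (g ^ 2 * u ^ 1)"
    by (simp_all add: cutoff_def cutoff'_def cutoff''_def g_def u_def)
  show "\<bar>cutoff r\<bar> \<le> 1" using c(1) p[of 3 0] by linarith
  show "\<bar>cutoff' r\<bar> \<le> 9" using c(2) p[of 2 2] by linarith
  show "\<bar>cutoff'' r\<bar> \<le> 72" using c(3) p[of 1 4] p[of 2 1] by linarith
qed

text \<open>Chosen so that exp (- s r) = 1 - s r + s^2 * \<open>exp_remainder s r\<close>.\<close>

definition exp_remainder :: "real \<Rightarrow> real \<Rightarrow> real" where
  "exp_remainder s r = (exp (- (s * r)) - 1 + s * r) / s\<^sup>2"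

lemma exp_remainder_bounds:
  assumes s: "0 < s" and r: "0 \<le> r"
  shows "0 \<le> exp_remainder s r" "exp_remainder s r \<le> r\<^sup>2 / 2"
    "0 \<le> (1 - exp (- (s * r))) / s" "(1 - exp (- (s * r))) / s \<le> r"
proof -
  define u where "u = s * r"
  have u: "0 \<le> u" using s r by (simp add: u_def)
  have e1: "1 - u \<le> exp (- u)" using exp_ge_add_one_self[of "- u"] by simp
  have "0\<^sup>2 / 2 - (exp (- 0) - 1 + 0) \<le> u\<^sup>2 / 2 - (exp (- u) - 1 + u)"
  proof (rule DERIV_nonneg_imp_nondecreasing[OF u])
    fix x :: real assume "0 \<le> x" "x \<le> u"
    have "((\<lambda>u. u\<^sup>2 / 2 - (exp (- u) - 1 + u)) has_real_derivative x - (- exp (- x) + 1)) (at x)"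
      by (auto intro!: derivative_eq_intros)
    moreover have "0 \<le> x - (- exp (- x) + 1)" using exp_ge_add_one_self[of "- x"] by linarith
    ultimately show "\<exists>y. ((\<lambda>u. u\<^sup>2 / 2 - (exp (- u) - 1 + u)) has_real_derivative y) (at x) \<and> 0 \<le> y" by blast
  qed
  then have e2: "exp (- u) - 1 + u \<le> u\<^sup>2 / 2" by simp
  have e3: "exp (- u) \<le> 1" using u by simp
  show "0 \<le> exp_remainder s r" using e1 by (simp add: exp_remainder_def u_def)
  have "exp_remainder s r \<le> (u\<^sup>2 / 2) / s\<^sup>2"
    unfolding exp_remainder_def u_def[symmetric] using e2 by (rule divide_right_mono) simp
  also have "\<dots> = r\<^sup>2 / 2" using s by (simp add: u_def power_mult_distrib)
  finally show "exp_remainder s r \<le> r\<^sup>2 / 2" .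
  show "0 \<le> (1 - exp (- (s * r))) / s" using e3 s by (simp add: u_def)
  have "(1 - exp (- (s * r))) / s \<le> u / s"
    unfolding u_def[symmetric] using e1 s by (intro divide_right_mono) auto
  also have "\<dots> = r" using s by (simp add: u_def)
  finally show "(1 - exp (- (s * r))) / s \<le> r" .
qed

text \<open>The remainder has derivative (1 - exp (- s r)) / s, between 0 and r, and second
  derivative exp (- s r), between 0 and 1. All bounds are independent of s, and the derivative is
  small at the centre as \<open>dominated_H2_radial\<close> requires.\<close>

lemma exp_remainder_dominated:
  assumes s: "0 < s" and b: "norm b \<le> 1"
  shows "dominated_H2 5 ((3 + 4) * 1000) (\<lambda>x. exp_remainder s (norm (x - b)) * cutoff (norm (x - b)))"
proof -
  define \<rho> where "\<rho> = exp_remainder s"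
  define \<rho>' where "\<rho>' r = (1 - exp (- (s * r))) / s" for r
  define \<rho>'' where "\<rho>'' r = exp (- (s * r))" for r
  have D: "(\<rho> has_real_derivative \<rho>' r) (at r)" "(\<rho>' has_real_derivative \<rho>'' r) (at r)" for r
    unfolding \<rho>_def exp_remainder_def[abs_def] \<rho>'_def[abs_def] \<rho>''_def using s
    by (auto intro!: derivative_eq_intros simp: field_simps power2_eq_square)
  have B: "0 \<le> \<rho> r" "\<rho> r \<le> r\<^sup>2 / 2" "0 \<le> \<rho>' r" "\<rho>' r \<le> r" "0 \<le> \<rho>'' r" "\<rho>'' r \<le> 1" if "0 \<le> r" for r
    using exp_remainder_bounds[OF s that] s that by (simp_all add: \<rho>_def \<rho>'_def \<rho>''_def)
  note C = cutoff_bounds and Z = cutoff_eq_0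
  have \<rho>4: "\<rho> r \<le> 8" "\<rho> r \<le> 2 * r" if "0 \<le> r" "r \<le> 4" for r
  proof -
    have "r\<^sup>2 \<le> 4 * r" using that by (simp add: power2_eq_square mult_right_mono)
    then show "\<rho> r \<le> 8" "\<rho> r \<le> 2 * r" using B(2)[OF that(1)] that(2) by linarith+
  qed
  have mm: "\<bar>x * y\<bar> \<le> X * Y" if "0 \<le> x" "x \<le> X" "\<bar>y\<bar> \<le> Y" for x y X Y :: real
    using that mult_mono[of x X "\<bar>y\<bar>" Y] by (simp add: abs_mult)
  \<comment> \<open>The number 1000 is generous: on r \<le> 4 the function is at most 8, its
    derivative at most 19 * r, and its second derivative at most 1 + 2 * 36 + 8 * 72 = 649. The
    support has radius 4 around \<open>b\<close>, hence lies in the ball of radius 5.\<close>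
  have "dominated_H2 5 ((3 + 4) * 1000) (\<lambda>x. (\<lambda>r. \<rho> r * cutoff r) (norm (x - b)))"
  proof (rule dominated_H2_radial[where \<psi>' = "\<lambda>r. \<rho>' r * cutoff r + cutoff' r * \<rho> r"
        and \<psi>'' = "\<lambda>r. \<rho>'' r * cutoff r + cutoff' r * \<rho>' r + (cutoff'' r * \<rho> r + \<rho>' r * cutoff' r)"])
    show d1: "((\<lambda>r. \<rho> r * cutoff r) has_real_derivative \<rho>' r * cutoff r + cutoff' r * \<rho> r) (at r)" for r
      by (rule DERIV_mult[OF D(1) cutoff_DERIV(1)])
    show "((\<lambda>r. \<rho>' r * cutoff r + cutoff' r * \<rho> r) has_real_derivative
        \<rho>'' r * cutoff r + cutoff' r * \<rho>' r + (cutoff'' r * \<rho> r + \<rho>' r * cutoff' r)) (at r)" for r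
      by (rule DERIV_add[OF DERIV_mult[OF D(2) cutoff_DERIV(1)] DERIV_mult[OF cutoff_DERIV(2) D(1)]])
    show "continuous_on {0..} (\<lambda>r. \<rho> r * cutoff r)"
      using d1 by (meson DERIV_continuous continuous_at_imp_continuous_on)
    have c: "continuous_on S cutoff" "continuous_on S cutoff'" "continuous_on S \<rho>" "continuous_on S \<rho>'" for S
      using D cutoff_DERIV by (meson DERIV_continuous continuous_at_imp_continuous_on)+
    have c'': "continuous_on S cutoff''" "continuous_on S \<rho>''" for S
      unfolding cutoff''_def[abs_def] \<rho>''_def[abs_def] by (intro continuous_intros)+
    show "continuous_on {0<..} (\<lambda>r. \<rho>'' r * cutoff r + cutoff' r * \<rho>' r
        + (cutoff'' r * \<rho> r + \<rho>' r * cutoff' r))"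
      by (intro continuous_intros c c'')
    show "\<bar>\<rho> r * cutoff r\<bar> \<le> 1000" if "r \<ge> 0" for r
    proof (cases "r \<le> 4")
      case True
      from mm[OF B(1)[OF that] \<rho>4(1)[OF that True] C(1)[OF True]] show ?thesis by linarith
    qed (use Z(1)[of r] in simp)
    show "\<bar>\<rho>' r * cutoff r + cutoff' r * \<rho> r\<bar> \<le> 1000 * r" if "r > 0" for r
    proof (cases "r \<le> 4")
      case True
      have r: "0 \<le> r" using that by simp
      have "\<bar>\<rho>' r * cutoff r\<bar> \<le> r * 1" by (rule mm[OF B(3)[OF r] B(4)[OF r] C(1)[OF True]])
      moreover have "\<bar>\<rho> r * cutoff' r\<bar> \<le> (2 * r) * 9" by (rule mm[OF B(1)[OF r] \<rho>4(2)[OF r True] C(2)[OF True]])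
      moreover have "cutoff' r * \<rho> r = \<rho> r * cutoff' r" by simp
      ultimately show ?thesis using r by linarith
    qed (use Z[of r] that in simp)
    show "\<bar>\<rho>'' r * cutoff r + cutoff' r * \<rho>' r + (cutoff'' r * \<rho> r + \<rho>' r * cutoff' r)\<bar> \<le> 1000" if "r > 0" for r
    proof (cases "r \<le> 4")
      case True
      have r: "0 \<le> r" using that by simp
      have "\<bar>\<rho>'' r * cutoff r\<bar> \<le> 1 * 1" by (rule mm[OF B(5)[OF r] B(6)[OF r] C(1)[OF True]])
      moreover have "\<bar>\<rho>' r * cutoff' r\<bar> \<le> 4 * 9"
        by (rule mm[OF B(3)[OF r] order_trans[OF B(4)[OF r] True] C(2)[OF True]])
      moreover have "\<bar>\<rho> r * cutoff'' r\<bar> \<le> 8 * 72" by (rule mm[OF B(1)[OF r] \<rho>4(1)[OF r True] C(3)[OF True]])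
      moreover have "cutoff' r * \<rho>' r = \<rho>' r * cutoff' r" "cutoff'' r * \<rho> r = \<rho> r * cutoff'' r" by simp_all
      ultimately show ?thesis by linarith
    qed (use Z[of r] that in simp)
  qed (use b Z in auto)
  then show ?thesis by (simp add: \<rho>_def)
qed

section \<open>Limits of the pairings as t tends to 0\<close>

lemma sphere_shell_subset:
  fixes U :: "(real^3) set"
  assumes "open U" "sphere 0 1 \<subseteq> U"
  obtains d where "0 < d" "\<forall>x. 1 - d \<le> norm x \<longrightarrow> norm x \<le> 1 + d \<longrightarrow> x \<in> U"
proof -
  obtain e where e: "0 < e" "(\<Union>x\<in>sphere 0 1. ball x e) \<subseteq> U"
    using compact_subset_open_imp_ball_epsilon_subset[OF compact_sphere assms(1,2)] by blast
  show ?thesis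
  proof (rule that[of "min (e / 2) (1 / 2)"])
    show "\<forall>x. 1 - min (e / 2) (1 / 2) \<le> norm x \<longrightarrow> norm x \<le> 1 + min (e / 2) (1 / 2) \<longrightarrow> x \<in> U"
    proof (intro allI impI)
      fix x :: "real^3" assume x: "1 - min (e / 2) (1 / 2) \<le> norm x" "norm x \<le> 1 + min (e / 2) (1 / 2)"
      then have n: "1 / 2 \<le> norm x" "\<bar>1 - norm x\<bar> < e" using e(1) by auto
      have nz: "x \<noteq> 0" using n(1) by auto
      have "x /\<^sub>R norm x - x = ((1 - norm x) / norm x) *\<^sub>R x"
      proof -
        have "(1 - norm x) / norm x = inverse (norm x) - 1" using nz
          by (simp add: diff_divide_distrib inverse_eq_divide)
        then show ?thesis by (simp add: scaleR_diff_left)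
      qed
      then have "dist (x /\<^sub>R norm x) x = \<bar>1 - norm x\<bar>" using nz by (simp add: dist_norm)
      then have "x \<in> ball (x /\<^sub>R norm x) e" using n(2) by simp
      moreover have "x /\<^sub>R norm x \<in> sphere 0 1" using nz by simp
      ultimately show "x \<in> U" using e(2) by blast
    qed
  qed (use e in auto)
qed

text \<open>The limit 2 is the coefficient of t in the magnitude. It is first found for one function
  \<open>J\<close> that equals the distance near the whole ball; an arbitrary \<open>k\<close>
  differs from it by a function that vanishes near the sphere.\<close>

lemma microscopic_weighting_pairings:
  fixes h :: H2 and k :: H2 and w :: Hm2
  assumes h: "open U" "cball 0 1 \<subseteq> U" "\<And>x. x \<in> U \<Longrightarrow> H2_fun h x = 1"
    and w: "is_microscopic_weighting (cball 0 1) w"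
  shows microscopic_weighting_one: "blinfun_apply w h = 1"
    and microscopic_weighting_dist: "norm b < 1 \<Longrightarrow> open V \<Longrightarrow> sphere 0 1 \<subseteq> V \<Longrightarrow>
      (\<And>x. x \<in> V \<Longrightarrow> H2_fun k x = dist b x) \<Longrightarrow> blinfun_apply w k = 2"
proof -
  obtain W where W: "\<And>t. t > 0 \<Longrightarrow> is_weighting t (cball 0 1) (W t)"
    and lim: "\<And>f. ((\<lambda>t. blinfun_apply (W t) f) \<longlongrightarrow> blinfun_apply w f) (at_right 0)"
    using w unfolding is_microscopic_weighting_def by blast
  have pos: "\<forall>\<^sub>F t::real in at_right 0. 0 < t" by (simp add: eventually_at_right_less)
  have lt1: "\<forall>\<^sub>F t::real in at_right 0. t < 1" by (rule eventually_at_rightI[of 0 1]) auto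
  have nt: "at_right (0::real) \<noteq> bot" by simp
  have hB: "H2_fun h x = 1" if "x \<in> cball 0 1" for x using h that by blast
  have mag: "blinfun_apply (W t) h = 1 + 2 * t + t\<^sup>2 + t^3 / 6" if "t > 0" for t
    by (rule weighting_magnitude[OF W[OF that] that hB])
  have "((\<lambda>t::real. 1 + 2 * t + t\<^sup>2 + t^3 / 6) \<longlongrightarrow> 1 + 2 * 0 + 0\<^sup>2 + 0^3 / 6) (at_right 0)"
    by (intro tendsto_intros) auto
  moreover have "\<forall>\<^sub>F t in at_right 0. 1 + 2 * t + t\<^sup>2 + t^3 / 6 = blinfun_apply (W t) h"
    using pos by eventually_elim (simp add: mag)
  ultimately have "((\<lambda>t. blinfun_apply (W t) h) \<longlongrightarrow> 1 + 2 * 0 + 0\<^sup>2 + 0^3 / 6) (at_right 0)"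
    by (rule Lim_transform_eventually)
  from tendsto_unique[OF nt lim this] show "blinfun_apply w h = 1" by simp
  assume b: "norm b < 1" and V: "open V" "sphere 0 1 \<subseteq> V" and k: "\<And>x. x \<in> V \<Longrightarrow> H2_fun k x = dist b x"
  define Q where "Q t = Abs_H2 (\<lambda>x. exp_remainder t (norm (x - b)) * cutoff (norm (x - b)))" for t
  note dom = exp_remainder_dominated[OF _ less_imp_le[OF b]]
  have Q: "H2_fun (Q t) = (\<lambda>x. exp_remainder t (norm (x - b)) * cutoff (norm (x - b)))" if "t > 0" for t
    unfolding Q_def by (rule Abs_H2_inverse[OF dominated_H2_sobolev2[OF dom[OF that]]])
  let ?L = "(3 + 4) * 1000 :: real"
  \<comment> \<open>The remainder \<open>Q t\<close> changes with t, so convergence on each fixed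
    element does not bound its pairing; a bound uniform over the dominated set does.\<close>
  have "\<exists>K. \<forall>\<^sub>F t in at_right 0. \<forall>q\<in>{q. dominated_H2 5 ?L (H2_fun q)}. \<bar>blinfun_apply (W t) q\<bar> \<le> K"
  proof (rule uniform_boundedness_sigma_convex)
    show "norm q \<le> ball_const 5 * ?L" if "q \<in> {q. dominated_H2 5 ?L (H2_fun q)}" for q
      using that by (intro dominated_H2_norm) auto
    show "\<exists>x. (\<lambda>n. a n *\<^sub>R q n) sums x"
      if "\<And>n. q n \<in> {q. dominated_H2 5 ?L (H2_fun q)}" "summable (\<lambda>n. \<bar>a n\<bar>)" for q and a :: "nat \<Rightarrow> real"
      using that by (intro dominated_H2_sigma_convex[of 5 ?L]) auto
    show "\<exists>l. ((\<lambda>t. blinfun_apply (W t) f) \<longlongrightarrow> l) (at_right 0)" for f using lim by blast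
  qed
  then obtain K where K: "\<forall>\<^sub>F t in at_right 0. \<forall>q\<in>{q. dominated_H2 5 ?L (H2_fun q)}. \<bar>blinfun_apply (W t) q\<bar>
      \<le> K"
    by blast
  have bB: "b \<in> cball 0 1" using b by simp
  have ex: "\<exists>e. (\<forall>x. H2_fun e x = exp (- (t * norm (b - x)))) \<and> blinfun_apply (W t) e = 1" if "t > 0" for t
    using W[OF that] bB unfolding is_weighting_def by blast
  obtain e1 where e1: "\<And>x. H2_fun e1 x = exp (- (1 * norm (b - x)))" using ex[of 1] by auto
  \<comment> \<open>The expansion exp (- r) = 1 - r + R at t = 1, solved for r. The cone at
    \<open>b\<close> is thereby provided by the exponential \<open>e1\<close>, which the weighting
    for t = 1 supplies as an element of \<open>H2\<close>.\<close>
  define J where "J = h - e1 + Q 1"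
  have J: "H2_fun J x = norm (x - b)" if "x \<in> U" "norm (x - b) \<le> 3" for x
    using that h(3) by (simp add: J_def e1 Q exp_remainder_def cutoff_eq_1 norm_minus_commute)
  have near: "norm (x - b) \<le> 3" if "norm x \<le> 1" for x
    using norm_triangle_ineq4[of x b] that b by linarith
  \<comment> \<open>The expansion of the exponential at \<open>b\<close> is paired with
    \<open>W t\<close>; the left side gives 1, and 2 + t + t^2 / 6 is (magnitude - 1) / t.\<close>
  have WJ: "blinfun_apply (W t) J = 2 + t + t\<^sup>2 / 6 + t * blinfun_apply (W t) (Q t)" if t: "t > 0" for t
  proof -
    obtain e where e: "\<And>x. H2_fun e x = exp (- (t * norm (b - x)))" "blinfun_apply (W t) e = 1" using ex[OF t]
      by blast
    have "blinfun_apply (W t) e = blinfun_apply (W t) (h - t *\<^sub>R J + t\<^sup>2 *\<^sub>R Q t)"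
    proof (rule pairing_cong)
      show "W t \<in> closure (fin_supp_measures (cball 0 1))" using W[OF t] by (simp add: is_weighting_def)
      fix x :: "real^3" assume x: "x \<in> cball 0 1"
      then have "H2_fun J x = norm (x - b)" "H2_fun h x = 1" "cutoff (norm (x - b)) = 1"
        using J near h by (auto intro!: cutoff_eq_1)
      then show "H2_fun e x = H2_fun (h - t *\<^sub>R J + t\<^sup>2 *\<^sub>R Q t) x"
        using t by (simp add: e Q exp_remainder_def norm_minus_commute)
    qed
    also have "\<dots> = blinfun_apply (W t) h - t * blinfun_apply (W t) J + t\<^sup>2 * blinfun_apply (W t) (Q t)"
      by (simp add: blinfun.add_right blinfun.diff_right blinfun.scaleR_right)
    finally have "t * blinfun_apply (W t) J = t * (2 + t + t\<^sup>2 / 6 + t * blinfun_apply (W t) (Q t))"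
      using e(2) mag[OF t] by (simp add: algebra_simps power2_eq_square power3_eq_cube)
    then show ?thesis using t by simp
  qed
  have "((\<lambda>t. t * blinfun_apply (W t) (Q t)) \<longlongrightarrow> 0) (at_right 0)"
  proof (rule Lim_null_comparison)
    show "\<forall>\<^sub>F t in at_right 0. norm (t * blinfun_apply (W t) (Q t)) \<le> t * K"
      using K pos
    proof eventually_elim
      case (elim t)
      have "dominated_H2 5 ?L (H2_fun (Q t))" using dom[OF elim(2)] by (simp add: Q[OF elim(2)])
      then have "\<bar>blinfun_apply (W t) (Q t)\<bar> \<le> K" using elim(1) by blast
      then show ?case using elim(2) by (simp add: abs_mult)
    qed
    have "((\<lambda>t::real. t * K) \<longlongrightarrow> 0 * K) (at_right 0)" by (intro tendsto_intros)
    then show "((\<lambda>t. t * K) \<longlongrightarrow> 0) (at_right 0)" by simp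
  qed
  then have "((\<lambda>t. 2 + t + t\<^sup>2 / 6 + t * blinfun_apply (W t) (Q t)) \<longlongrightarrow> 2 + 0 + 0\<^sup>2 / 6 + 0) (at_right 0)"
    by (intro tendsto_intros) auto
  moreover have "\<forall>\<^sub>F t in at_right 0. 2 + t + t\<^sup>2 / 6 + t * blinfun_apply (W t) (Q t) = blinfun_apply (W t) J"
    using pos by eventually_elim (simp add: WJ)
  ultimately have "((\<lambda>t. blinfun_apply (W t) J) \<longlongrightarrow> 2 + 0 + 0\<^sup>2 / 6 + 0) (at_right 0)"
    by (rule Lim_transform_eventually)
  from tendsto_unique[OF nt lim this] have wJ: "blinfun_apply w J = 2" by simp
  have "open (V \<inter> U \<inter> ball b 3)" using V(1) h(1) by (intro open_Int) auto
  moreover have "sphere 0 1 \<subseteq> V \<inter> U \<inter> ball b 3"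
  proof
    fix x :: "real^3" assume x: "x \<in> sphere 0 1"
    have "norm (b - x) < 3" using x b norm_triangle_ineq4[of b x] by simp
    then show "x \<in> V \<inter> U \<inter> ball b 3" using x V(2) h(2) by (auto simp: dist_norm)
  qed
  ultimately obtain d where d: "0 < d"
    "\<forall>x. 1 - d \<le> norm x \<longrightarrow> norm x \<le> 1 + d \<longrightarrow> x \<in> V \<inter> U \<inter> ball b 3"
    by (rule sphere_shell_subset)
  \<comment> \<open>On the shell both functions are the distance to \<open>b\<close>. Inside the
    ball \<open>k\<close> is arbitrary, and the difference is handled by the factor t^3.\<close>
  have g0: "H2_fun (k - J) x = 0" if "1 - d \<le> norm x" "norm x \<le> 1 + d" for x
  proof -
    have "x \<in> V" "x \<in> U" "norm (x - b) \<le> 3" using d(2) that by (auto simp: dist_norm norm_minus_commute)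
    then show ?thesis using k J by (simp add: dist_norm norm_minus_commute)
  qed
  define I where "I = (\<integral>x. indicator (cball 0 1) x * H2_fun (k - J) x \<partial>lborel)"
  have "((\<lambda>t. t^3 / (8 * pi) * I) \<longlongrightarrow> 0^3 / (8 * pi) * I) (at_right 0)" by (intro tendsto_intros) auto
  moreover have "\<forall>\<^sub>F t in at_right 0. t^3 / (8 * pi) * I = blinfun_apply (W t) (k - J)"
    using pos
  proof eventually_elim
    case (elim t)
    show ?case unfolding I_def by (rule weighting_vanishing[OF W[OF elim] elim d(1) g0, symmetric])
  qed
  ultimately have "((\<lambda>t. blinfun_apply (W t) (k - J)) \<longlongrightarrow> 0^3 / (8 * pi) * I) (at_right 0)"
    by (rule Lim_transform_eventually)
  from tendsto_unique[OF nt lim this] have "blinfun_apply w (k - J) = 0" by simp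
  then show "blinfun_apply w k = 2" using wJ by (simp add: blinfun.diff_right)
qed

section \<open>The maximal energy of the ball\<close>

text \<open>The pair (u, s) stands for the half-space u \<bullet> x \<le> s, whose boundary is at
  distance |s| / |u| \<le> 1 from the centre. Letting u range over the solid ball replaces surface
  measure on directions by Lebesgue measure; each half-space occurs with all its positive multiples
  of admissible size.\<close>

definition half_spaces :: "((real^3) \<times> real) set" where
  "half_spaces = {(u, s). norm u \<le> 1 \<and> \<bar>s\<bar> \<le> norm u}"

definition in_half_space :: "(real^3) \<times> real \<Rightarrow> real^3 \<Rightarrow> real" where
  "in_half_space \<omega> x = (if fst \<omega> \<bullet> x \<le> snd \<omega> then 1 else 0)"

abbreviation half_space_measure :: "((real^3) \<times> real) measure" where
  "half_space_measure \<equiv> restrict_space lborel half_spaces"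

lemma half_spaces_closed: "closed half_spaces"
proof -
  have eq: "half_spaces = {\<omega>. norm (fst \<omega>) \<le> 1} \<inter> {\<omega>. \<bar>snd \<omega>\<bar> \<le> norm (fst \<omega>)}"
    by (auto simp: half_spaces_def)
  show ?thesis unfolding eq
    by (intro closed_Int closed_Collect_le continuous_intros)
qed

lemma half_spaces_borel [measurable]: "half_spaces \<in> sets borel"
  using half_spaces_closed by simp

lemma in_half_space_measurable:
  "(\<lambda>p. in_half_space (fst p) (snd p)) \<in> borel_measurable (borel \<Otimes>\<^sub>M borel)"
proof -
  have "(\<lambda>p :: ((real^3) \<times> real) \<times> (real^3). fst (fst p) \<bullet> snd p - snd (fst p)) \<in> borel_measurable borel"
    by (intro borel_measurable_continuous_onI continuous_intros)
  then have [measurable]: "(\<lambda>p :: ((real^3) \<times> real) \<times> (real^3). fst (fst p) \<bullet> snd p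
      - snd (fst p)) \<in> borel_measurable (borel \<Otimes>\<^sub>M borel)"
    by (simp add: borel_prod)
  have eq: "(\<lambda>p :: ((real^3) \<times> real) \<times> (real^3). in_half_space (fst p) (snd p))
    = (\<lambda>p. if fst (fst p) \<bullet> snd p - snd (fst p) \<le> 0 then 1 else 0)"
    by (auto simp: in_half_space_def)
  show ?thesis unfolding eq by measurable
qed

lemma in_half_space_bounds: "0 \<le> in_half_space \<omega> x" "in_half_space \<omega> x \<le> 1" "\<bar>in_half_space \<omega> x\<bar> \<le> 1"
  by (simp_all add: in_half_space_def)

lemma unit_ball_measurable [measurable]:
  "(\<lambda>u. indicator (cball (0::real^3) 1) u :: 'b::{real_normed_algebra_1}) \<in> borel_measurable borel"
  "(\<lambda>u. indicator (cball (0::real^3) 1) u :: ennreal) \<in> borel_measurable borel"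
  by (rule borel_measurable_indicator, simp)+

lemma nn_integral_ball_norm: "(\<integral>\<^sup>+u. ennreal (indicator (cball 0 1) (u :: real^3) * norm u) \<partial>lborel)
    = ennreal pi"
proof -
  have g: "continuous_on {0..1} (\<lambda>p::real. p * p)" by (intro continuous_intros)
  have eq: "radial_density 1 (\<lambda>p. p * p) = (\<lambda>u::real^3. indicator (cball 0 1) u * norm u)"
    by (auto simp: radial_density_def indicator_def)
  note m = radial_density_mass[OF g zero_le_one]
  have "((\<lambda>p::real. p * p * p) has_integral (1::real)^4 / 4 - 0^4 / 4) {0..1}"
  proof (rule fundamental_theorem_of_calculus)
    show "((\<lambda>p. p^4 / 4) has_vector_derivative p * p * p) (at p within {0..1})" for p :: real
      unfolding has_real_derivative_iff_has_vector_derivative[symmetric]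
      by (auto intro!: derivative_eq_intros simp: power3_eq_cube)
  qed simp
  then have "integral {0..1} (\<lambda>p::real. p * p * p) = 1 / 4" by (simp add: integral_unique)
  then show ?thesis
    using m unfolding eq by (subst nn_integral_eq_integral) (auto simp: mult.assoc)
qed

text \<open>At height z the squared distance v from the axis runs over 0..1 - z^2 with density pi,
  and (v + z^2)^k integrates to (1 - z^(2 * k + 2)) / (k + 1).\<close>

lemma nn_integral_cylinder_ball:
  fixes \<phi> :: "real \<Rightarrow> real" and k :: nat
  assumes [measurable]: "\<phi> \<in> borel_measurable borel" and \<phi>: "\<And>z. 0 \<le> \<phi> z"
  shows "(\<integral>\<^sup>+y. ennreal (indicator (cball 0 1) y * (norm y) ^ (2 * k) * \<phi> ((y::real^3)$3)) \<partial>lborel)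
    = (\<integral>\<^sup>+z. ennreal (indicator {-1..1} z * (pi / (k + 1) * (1 - z ^ (2 * k + 2)) * \<phi> z)) \<partial>lborel)"
proof -
  define F where "F z v = ennreal (of_bool (v + z\<^sup>2 \<le> 1) * (v + z\<^sup>2) ^ k * \<phi> z)" for z v
  have "(\<lambda>p::real \<times> real. snd p + (fst p)\<^sup>2) \<in> borel_measurable borel"
    by (intro borel_measurable_continuous_onI continuous_intros)
  then have [measurable]: "(\<lambda>p::real \<times> real. snd p + (fst p)\<^sup>2) \<in> borel_measurable (borel \<Otimes>\<^sub>M borel)"
    by (simp add: borel_prod)
  have m: "(\<lambda>p. F (fst p) (snd p)) \<in> borel_measurable borel"
    unfolding F_def borel_prod[symmetric] by measurable
  have "(\<integral>\<^sup>+y. ennreal (indicator (cball 0 1) y * (norm y) ^ (2 * k) * \<phi> ((y::real^3)$3)) \<partial>lborel)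
    = (\<integral>\<^sup>+y. F ((y::real^3)$3) ((y$1)\<^sup>2 + (y$2)\<^sup>2) \<partial>lborel)"
  proof (rule nn_integral_cong)
    fix y :: "real^3"
    have n: "(y$1)\<^sup>2 + (y$2)\<^sup>2 + (y$3)\<^sup>2 = (norm y)\<^sup>2" by (simp add: norm_real3_square)
    have "(norm y)\<^sup>2 \<le> 1 \<longleftrightarrow> norm y \<le> 1" using abs_square_le_1[of "norm y"] by simp
    then show "ennreal (indicator (cball 0 1) y * (norm y) ^ (2 * k) * \<phi> (y$3)) = F (y$3) ((y$1)\<^sup>2 + (y$2)\<^sup>2)"
      by (simp add: F_def n power_mult indicator_def)
  qed
  also have "\<dots> = (\<integral>\<^sup>+z. \<integral>\<^sup>+v. ennreal pi * indicator {0..} v * F z v \<partial>lborel \<partial>lborel)"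
    by (rule nn_integral_cylinder[OF m])
  also have "\<dots> = (\<integral>\<^sup>+z. ennreal (indicator {-1..1} z * (pi / (k + 1) * (1 - z ^ (2 * k + 2)) * \<phi> z)) \<partial>lborel)"
  proof (rule nn_integral_cong)
    fix z :: real
    show "(\<integral>\<^sup>+v. ennreal pi * indicator {0..} v * F z v \<partial>lborel)
      = ennreal (indicator {-1..1} z * (pi / (k + 1) * (1 - z ^ (2 * k + 2)) * \<phi> z))"
    proof (cases "z\<^sup>2 \<le> 1")
      case False
      then have "z \<notin> {-1..1}" using abs_square_le_1[of z] by auto
      have eq: "ennreal pi * indicator {0..} v * F z v = 0" for v using False
        by (auto simp: F_def indicator_def)
      show ?thesis unfolding eq using \<open>z \<notin> {-1..1}\<close> by simp
    next
      case True
      then have z: "z \<in> {-1..1}" using abs_square_le_1[of z] by auto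
      have "((\<lambda>v. (v + z\<^sup>2) ^ k) has_integral ((1 - z\<^sup>2) + z\<^sup>2) ^ (k + 1) / (k + 1)
          - (0 + z\<^sup>2) ^ (k + 1) / (k + 1)) {0..1 - z\<^sup>2}"
      proof (rule fundamental_theorem_of_calculus)
        show "((\<lambda>v. (v + z\<^sup>2) ^ (k + 1) / (k + 1)) has_vector_derivative (v + z\<^sup>2) ^ k) (at v within {0..1
            - z\<^sup>2})" for v
          unfolding has_real_derivative_iff_has_vector_derivative[symmetric]
          by (rule derivative_eq_intros refl | simp)+
      qed (use True in simp)
      then have "((\<lambda>v. (v + z\<^sup>2) ^ k) has_integral (1 - z ^ (2 * k + 2)) / (k + 1)) {0..1 - z\<^sup>2}"
        by (simp add: diff_divide_distrib power_mult[symmetric] power2_eq_square[symmetric] mult.commute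
            power_add[symmetric] algebra_simps)
      from has_integral_mult_right[OF this, of "pi * \<phi> z"]
      have I: "((\<lambda>v. pi * \<phi> z * (v + z\<^sup>2) ^ k) has_integral pi * \<phi> z * ((1 - z ^ (2 * k + 2)) / (k + 1))) {0..1
          - z\<^sup>2}" .
      have "(\<integral>\<^sup>+v. ennreal pi * indicator {0..} v * F z v \<partial>lborel)
        = (\<integral>\<^sup>+v. ennreal (indicator {0..1 - z\<^sup>2} v * (pi * \<phi> z * (v + z\<^sup>2) ^ k)) \<partial>lborel)"
        by (intro nn_integral_cong) (auto simp: F_def indicator_def ennreal_mult'[symmetric] mult_ac)
      also have "\<dots> = ennreal (pi * \<phi> z * ((1 - z ^ (2 * k + 2)) / (k + 1)))"
        by (rule nn_integral_has_integral_lebesgue[OF _ I]) (use \<phi> in simp)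
      finally show ?thesis using z by (simp add: mult_ac)
    qed
  qed
  finally show ?thesis .
qed

lemma nn_integral_ball_height: "(\<integral>\<^sup>+u. ennreal (indicator (cball 0 1) (u :: real^3) * \<bar>u$3\<bar>) \<partial>lborel)
    = ennreal (pi / 2)"
proof -
  have I1: "((\<lambda>z::real. pi * (1 - z\<^sup>2) * \<bar>z\<bar>) has_integral pi / 4) {0..1}"
  proof -
    have "((\<lambda>z::real. pi * (1 - z\<^sup>2) * \<bar>z\<bar>) has_integral pi * (1^2 / 2 - 1^4 / 4) - pi
        * (0^2 / 2 - 0^4 / 4)) {0..1}"
    proof (rule fundamental_theorem_of_calculus)
      fix z :: real assume "z \<in> {0..1}"
      then show "((\<lambda>z. pi * (z^2 / 2 - z^4 / 4)) has_vector_derivative pi * (1 - z\<^sup>2)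
          * \<bar>z\<bar>) (at z within {0..1})"
        unfolding has_real_derivative_iff_has_vector_derivative[symmetric]
        by (auto intro!: derivative_eq_intros simp: algebra_simps power2_eq_square power3_eq_cube)
    qed simp
    then show ?thesis by simp
  qed
  have I2: "((\<lambda>z::real. pi * (1 - z\<^sup>2) * \<bar>z\<bar>) has_integral pi / 4) {-1..0}"
  proof -
    have "((\<lambda>z::real. pi * (1 - z\<^sup>2) * \<bar>z\<bar>) has_integral - pi * (0^2 / 2 - 0^4 / 4)
        - (- pi * ((-1)^2 / 2 - (-1)^4 / 4))) {-1..0}"
    proof (rule fundamental_theorem_of_calculus)
      fix z :: real assume "z \<in> {-1..0}"
      then show "((\<lambda>z. - pi * (z^2 / 2 - z^4 / 4)) has_vector_derivative pi * (1 - z\<^sup>2)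
          * \<bar>z\<bar>) (at z within {-1..0})"
        unfolding has_real_derivative_iff_has_vector_derivative[symmetric]
        by (auto intro!: derivative_eq_intros simp: algebra_simps power2_eq_square power3_eq_cube)
    qed simp
    then show ?thesis by simp
  qed
  have I: "((\<lambda>z::real. pi * (1 - z\<^sup>2) * \<bar>z\<bar>) has_integral pi / 4 + pi / 4) {-1..1}"
    by (rule has_integral_combine[OF _ _ I2 I1]) auto
  have "(\<integral>\<^sup>+u. ennreal (indicator (cball 0 1) (u :: real^3) * \<bar>u$3\<bar>) \<partial>lborel)
    = (\<integral>\<^sup>+z. ennreal (indicator {-1..1} z * (pi * (1 - z\<^sup>2) * \<bar>z\<bar>)) \<partial>lborel)"
    using nn_integral_cylinder_ball[of abs 0] by (simp add: power2_eq_square)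
  also have "\<dots> = ennreal (pi / 4 + pi / 4)"
  proof (rule nn_integral_has_integral_lebesgue[OF _ I])
    fix z :: real assume "z \<in> {-1..1}"
    then have "z\<^sup>2 \<le> 1" using abs_square_le_1[of z] by auto
    then show "0 \<le> pi * (1 - z\<^sup>2) * \<bar>z\<bar>" by simp
  qed
  finally show ?thesis by simp
qed

lemma nn_integral_ball_inner:
  fixes z :: "real^3"
  shows "(\<integral>\<^sup>+u. ennreal (indicator (cball 0 1) u * \<bar>u \<bullet> z\<bar>) \<partial>lborel) = ennreal (pi / 2 * norm z)"
proof -
  have "norm z = norm (norm z *\<^sub>R axis 3 1 :: real^3)" by simp
  then obtain f :: "real^3 \<Rightarrow> real^3" where f: "orthogonal_transformation f" "f z = norm z *\<^sub>R axis 3 1"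
    by (rule orthogonal_transformation_exists)
  let ?G = "\<lambda>u::real^3. ennreal (norm z) * ennreal (indicator (cball 0 1) u * \<bar>u$3\<bar>)"
  have "indicator (cball 0 1) u * \<bar>u \<bullet> z\<bar> = norm z * (indicator (cball 0 1) (f u) * \<bar>f u $ 3\<bar>)" for u
  proof -
    have "u \<bullet> z = f u \<bullet> f z" using f(1) by (simp add: orthogonal_transformation_def)
    then have "\<bar>u \<bullet> z\<bar> = norm z * \<bar>f u $ 3\<bar>" by (simp add: f(2) inner_axis abs_mult)
    moreover have "norm (f u) = norm u" using f(1) by (rule orthogonal_transformation_norm)
    ultimately show ?thesis by (simp add: indicator_def)
  qed
  then have "(\<integral>\<^sup>+u. ennreal (indicator (cball 0 1) u * \<bar>u \<bullet> z\<bar>) \<partial>lborel) = (\<integral>\<^sup>+u. ?G (f u) \<partial>lborel)"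
    by (simp add: ennreal_mult')
  also have "\<dots> = (\<integral>\<^sup>+u. ?G u \<partial>lborel)"
    by (rule nn_integral_orthogonal[OF f(1)]) simp
  also have "\<dots> = ennreal (norm z) * ennreal (pi / 2)"
    by (subst nn_integral_cmult) (simp_all add: nn_integral_ball_height)
  finally show ?thesis by (simp add: ennreal_mult'[symmetric] mult.commute)
qed

lemma nn_integral_half_spaces:
  assumes [measurable]: "F \<in> borel_measurable borel"
  shows "(\<integral>\<^sup>+\<omega>. F \<omega> \<partial>half_space_measure)
    = (\<integral>\<^sup>+u. \<integral>\<^sup>+s. indicator (cball 0 1) u * indicator {- norm u..norm u} s * F (u, s) \<partial>lborel \<partial>lborel)"
proof -
  have "(\<integral>\<^sup>+\<omega>. F \<omega> \<partial>half_space_measure) = (\<integral>\<^sup>+\<omega>. F \<omega> * indicator half_spaces \<omega> \<partial>lborel)"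
    by (rule nn_integral_restrict_space) simp
  also have "\<dots> = (\<integral>\<^sup>+\<omega>. F \<omega> * indicator half_spaces \<omega> \<partial>(lborel \<Otimes>\<^sub>M lborel))" by (simp add: lborel_prod)
  also have "\<dots> = (\<integral>\<^sup>+u. \<integral>\<^sup>+s. F (u, s) * indicator half_spaces (u, s) \<partial>lborel \<partial>lborel)"
    by (rule lborel.nn_integral_fst[symmetric]) (simp add: lborel_prod)
  also have "\<dots> = (\<integral>\<^sup>+u. \<integral>\<^sup>+s. indicator (cball 0 1) u * indicator {- norm u..norm u} s
      * F (u, s) \<partial>lborel \<partial>lborel)"
    by (intro nn_integral_cong) (auto simp: half_spaces_def indicator_def abs_le_iff)
  finally show ?thesis .
qed

lemma emeasure_half_space_measure: "emeasure half_space_measure (space half_space_measure) = ennreal (2 * pi)"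
proof -
  have "emeasure half_space_measure (space half_space_measure) = (\<integral>\<^sup>+\<omega>. 1 \<partial>half_space_measure)" by simp
  also have "\<dots> = (\<integral>\<^sup>+u. \<integral>\<^sup>+s. indicator (cball 0 1) (u::real^3)
      * indicator {- norm u..norm u} s \<partial>lborel \<partial>lborel)"
    by (subst nn_integral_half_spaces) simp_all
  also have "\<dots> = (\<integral>\<^sup>+u. 2 * ennreal (indicator (cball 0 1) (u::real^3) * norm u) \<partial>lborel)"
  proof (rule nn_integral_cong)
    fix u :: "real^3"
    have "(\<integral>\<^sup>+s. indicator (cball 0 1) u * indicator {- norm u..norm u} s \<partial>lborel)
      = indicator (cball 0 1) u * ennreal (2 * norm u)"
      by (subst nn_integral_cmult) simp_all
    then show "(\<integral>\<^sup>+s. indicator (cball 0 1) u * indicator {- norm u..norm u} s \<partial>lborel)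
      = 2 * ennreal (indicator (cball 0 1) u * norm u)"
      by (auto simp: indicator_def ennreal_mult')
  qed
  also have "\<dots> = 2 * ennreal pi" by (subst nn_integral_cmult) (simp_all only: nn_integral_ball_norm, measurable)
  finally show ?thesis by (simp add: ennreal_mult')
qed

lemma finite_half_space_measure: "finite_measure half_space_measure"
  by (rule finite_measureI) (use emeasure_half_space_measure in simp)

text \<open>Crofton's formula.\<close>

lemma dist_half_spaces:
  fixes x y :: "real^3"
  assumes x: "x \<in> cball 0 1" and y: "y \<in> cball 0 1"
  shows "(\<integral>\<omega>. in_half_space \<omega> x * (1 - in_half_space \<omega> y) + (1 - in_half_space \<omega> x) * in_half_space \<omega> y
      \<partial>half_space_measure) = pi / 2 * dist x y"
proof -
  define k where "k \<omega> = in_half_space \<omega> x * (1 - in_half_space \<omega> y) + (1 - in_half_space \<omega> x)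
      * in_half_space \<omega> y" for \<omega>
  have am: "(\<lambda>\<omega>. in_half_space \<omega> z) \<in> borel_measurable borel" for z
    using measurable_compose[OF _ in_half_space_measurable, of "\<lambda>\<omega>. (\<omega>, z)" borel] by simp
  have km: "k \<in> borel_measurable borel" unfolding k_def using am[of x] am[of y] by simp
  have k0: "0 \<le> k \<omega>" for \<omega> using in_half_space_bounds[of \<omega> x] in_half_space_bounds[of \<omega> y] by (simp add: k_def)
  \<comment> \<open>For fixed u, the half-spaces separating x and y are those with s between u
    \<bullet> x and u \<bullet> y. Since x and y are in the unit ball, this interval lies inside the
    allowed range of s.\<close>
  have inner: "(\<integral>\<^sup>+s. indicator (cball 0 1) u * indicator {- norm u..norm u} s * ennreal (k (u, s)) \<partial>lborel)
    = ennreal (indicator (cball 0 1) u * \<bar>u \<bullet> (x - y)\<bar>)" for u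
  proof -
    have b: "\<bar>u \<bullet> z\<bar> \<le> norm u" if "z \<in> cball 0 1" for z
      using Cauchy_Schwarz_ineq2[of u z] that mult_left_le[of "norm z" "norm u"] by simp
    have "(\<integral>\<^sup>+s. indicator (cball 0 1) u * indicator {- norm u..norm u} s * ennreal (k (u, s)) \<partial>lborel)
      = (\<integral>\<^sup>+s. indicator (cball 0 1) u * indicator {min (u \<bullet> x) (u \<bullet> y)..<max (u \<bullet> x) (u \<bullet> y)} s \<partial>lborel)"
      using b[OF x] b[OF y]
      by (intro nn_integral_cong) (auto simp: k_def in_half_space_def indicator_def abs_le_iff)
    also have "\<dots> = indicator (cball 0 1) u * ennreal (max (u \<bullet> x) (u \<bullet> y) - min (u \<bullet> x) (u \<bullet> y))"
      by (subst nn_integral_cmult) simp_all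
    also have "max (u \<bullet> x) (u \<bullet> y) - min (u \<bullet> x) (u \<bullet> y) = \<bar>u \<bullet> (x - y)\<bar>" by (simp add: inner_diff_right)
    finally show ?thesis by (simp add: indicator_def)
  qed
  have "(\<integral>\<^sup>+\<omega>. ennreal (k \<omega>) \<partial>half_space_measure) = ennreal (pi / 2 * dist x y)"
    using km by (subst nn_integral_half_spaces) (simp_all add: inner nn_integral_ball_inner dist_norm)
  moreover have "k \<in> borel_measurable half_space_measure" using km by (simp add: measurable_restrict_space1)
  ultimately show ?thesis
    unfolding k_def[symmetric] using k0 by (subst integral_eq_nn_integral) auto
qed

lemma finite_measure_swap:
  fixes f :: "'a \<Rightarrow> 'b \<Rightarrow> real"
  assumes M1: "finite_measure M1" and M2: "finite_measure M2"
    and f: "(\<lambda>p. f (fst p) (snd p)) \<in> borel_measurable (M1 \<Otimes>\<^sub>M M2)" and C: "\<And>x y. \<bar>f x y\<bar> \<le> C"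
  shows "(\<integral>y. (\<integral>x. f x y \<partial>M1) \<partial>M2) = (\<integral>x. (\<integral>y. f x y \<partial>M2) \<partial>M1)"
proof -
  interpret M1: finite_measure M1 by fact
  interpret M2: finite_measure M2 by fact
  interpret P: pair_sigma_finite M1 M2 ..
  interpret F: finite_measure "M1 \<Otimes>\<^sub>M M2" by (rule finite_measure_pair_measure) fact+
  have "integrable (M1 \<Otimes>\<^sub>M M2) (case_prod f)"
    using f C by (intro F.integrable_const_bound[where B = C]) (auto simp: case_prod_unfold)
  then show ?thesis by (rule P.Fubini_integral)
qed

lemma finite_measure_integrable:
  fixes f :: "'a \<Rightarrow> real"
  assumes "finite_measure M" "f \<in> borel_measurable M" "\<And>x. \<bar>f x\<bar> \<le> C"
  shows "integrable M f"
  using assms by (intro finite_measure.integrable_const_bound[where B = C]) auto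

definition half_space_mass :: "(real^3) measure \<Rightarrow> (real^3) \<times> real \<Rightarrow> real" where
  "half_space_mass \<mu> \<omega> = (\<integral>x. in_half_space \<omega> x \<partial>\<mu>)"

context
  fixes \<mu> :: "(real^3) measure"
  assumes \<mu>: "finite_borel_measure_on (cball 0 1) \<mu>"
begin

lemma borel_on_finite: "finite_measure \<mu>"
  using \<mu> by (simp add: finite_borel_measure_on_def)

lemma borel_on_space: "space \<mu> = cball 0 1"
  using \<mu> sets_eq_imp_space_eq[of \<mu> "restrict_space borel (cball 0 1)"]
  by (simp add: finite_borel_measure_on_def space_restrict_space)

lemma borel_on_measurable:
  assumes "f \<in> borel \<rightarrow>\<^sub>M M"
  shows "f \<in> \<mu> \<rightarrow>\<^sub>M M"
proof -
  have "sets \<mu> = sets (restrict_space borel (cball 0 1))"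
    using \<mu> by (simp only: finite_borel_measure_on_def)
  from measurable_cong_sets[OF this refl, of M] show ?thesis
    using measurable_restrict_space1[OF assms, of "cball 0 1"] by (simp only:)
qed

lemma in_half_space_measurable_pair:
  "(\<lambda>p. in_half_space (fst p) (snd p)) \<in> borel_measurable (half_space_measure \<Otimes>\<^sub>M \<mu>)"
proof -
  have 1: "(\<lambda>\<omega>. \<omega>) \<in> half_space_measure \<rightarrow>\<^sub>M borel" by (rule measurable_restrict_space1) simp
  have 2: "(\<lambda>x. x) \<in> \<mu> \<rightarrow>\<^sub>M borel" by (rule borel_on_measurable) simp
  have "(\<lambda>p. (fst p, snd p)) \<in> half_space_measure \<Otimes>\<^sub>M \<mu> \<rightarrow>\<^sub>M borel \<Otimes>\<^sub>M borel"
    by (rule measurable_Pair[OF measurable_compose[OF measurable_fst 1]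
        measurable_compose[OF measurable_snd 2]])
  from measurable_compose[OF this in_half_space_measurable] show ?thesis by simp
qed

lemma in_half_space_measurable_snd: "in_half_space \<omega> \<in> borel_measurable \<mu>"
proof -
  have "(\<lambda>x. in_half_space \<omega> x) \<in> borel_measurable borel"
    using measurable_compose[OF _ in_half_space_measurable, of "\<lambda>x. (\<omega>, x)" borel] by simp
  then show ?thesis by (rule borel_on_measurable)
qed

lemma in_half_space_integrable: "integrable \<mu> (in_half_space \<omega>)"
  by (rule finite_measure_integrable[OF borel_on_finite in_half_space_measurable_snd in_half_space_bounds(3)])

lemma half_space_mass_measurable: "half_space_mass \<mu> \<in> borel_measurable half_space_measure"
proof -
  interpret finite_measure \<mu> by (rule borel_on_finite)
  show ?thesis unfolding half_space_mass_def[abs_def]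
    using in_half_space_measurable_pair
      by (intro borel_measurable_lebesgue_integral) (simp add: case_prod_unfold)
qed

lemma half_space_mass_bounds: "0 \<le> half_space_mass \<mu> \<omega>" "half_space_mass \<mu> \<omega> \<le> measure \<mu> (cball 0 1)"
proof -
  show "0 \<le> half_space_mass \<mu> \<omega>" unfolding half_space_mass_def
    by (rule Bochner_Integration.integral_nonneg) (simp add: in_half_space_bounds)
  interpret finite_measure \<mu> by (rule borel_on_finite)
  have "half_space_mass \<mu> \<omega> \<le> (\<integral>x. 1 \<partial>\<mu>)" unfolding half_space_mass_def
    by (rule integral_mono[OF in_half_space_integrable]) (simp_all add: in_half_space_bounds)
  then show "half_space_mass \<mu> \<omega> \<le> measure \<mu> (cball 0 1)" by (simp add: borel_on_space)
qed

lemma integral_1_minus_half_space: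
  "(\<integral>x. c * (1 - in_half_space \<omega> x) + d * in_half_space \<omega> x \<partial>\<mu>)
    = c * (measure \<mu> (cball 0 1) - half_space_mass \<mu> \<omega>) + d * half_space_mass \<mu> \<omega>"
proof -
  interpret finite_measure \<mu> by (rule borel_on_finite)
  show ?thesis using in_half_space_integrable by (simp add: half_space_mass_def borel_on_space)
qed

end

text \<open>Crofton's formula is inserted for the distance and Fubini's theorem is applied twice,
  once for each measure; everything is bounded and all measures are finite.\<close>

lemma mutual_energy_half_spaces:
  assumes \<mu>: "finite_borel_measure_on (cball 0 1) \<mu>" and \<nu>: "finite_borel_measure_on (cball 0 1) \<nu>"
  shows "pi / 2 * mutual_energy \<mu> \<nu>
    = (\<integral>\<omega>. half_space_mass \<mu> \<omega> * (measure \<nu> (cball 0 1) - half_space_mass \<nu> \<omega>)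
        + (measure \<mu> (cball 0 1) - half_space_mass \<mu> \<omega>) * half_space_mass \<nu> \<omega> \<partial>half_space_measure)"
proof -
  let ?a = in_half_space and ?N = half_space_measure
  let ?m = "measure \<nu> (cball 0 1)" and ?A = "half_space_mass \<nu>"
  note fin = finite_half_space_measure borel_on_finite[OF \<mu>] borel_on_finite[OF \<nu>]
  have am: "(\<lambda>\<omega>. ?a \<omega> x) \<in> borel_measurable ?N" for x
  proof -
    have "(\<lambda>\<omega>. ?a \<omega> x) \<in> borel_measurable borel"
      using measurable_compose[OF _ in_half_space_measurable, of "\<lambda>\<omega>. (\<omega>, x)" borel] by simp
    then show ?thesis by (simp add: measurable_restrict_space1)
  qed
  have inner: "pi / 2 * (\<integral>y. dist x y \<partial>\<nu>) = (\<integral>\<omega>. ?a \<omega> x * (?m - ?A \<omega>) + (1 - ?a \<omega> x) * ?A \<omega> \<partial>?N)"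
    if x: "x \<in> cball 0 1" for x
  proof -
    have "pi / 2 * (\<integral>y. dist x y \<partial>\<nu>) = (\<integral>y. pi / 2 * dist x y \<partial>\<nu>)" by simp
    also have "\<dots> = (\<integral>y. (\<integral>\<omega>. ?a \<omega> x * (1 - ?a \<omega> y) + (1 - ?a \<omega> x) * ?a \<omega> y \<partial>?N) \<partial>\<nu>)"
      by (intro Bochner_Integration.integral_cong refl dist_half_spaces[symmetric] x)
         (simp add: borel_on_space[OF \<nu>])
    also have "\<dots> = (\<integral>\<omega>. (\<integral>y. ?a \<omega> x * (1 - ?a \<omega> y) + (1 - ?a \<omega> x) * ?a \<omega> y \<partial>\<nu>) \<partial>?N)"
    proof (rule finite_measure_swap[OF fin(1,3), where C = 1])
      show "(\<lambda>p. ?a (fst p) x * (1 - ?a (fst p) (snd p)) + (1 - ?a (fst p) x) * ?a (fst p) (snd p))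
          \<in> borel_measurable (?N \<Otimes>\<^sub>M \<nu>)"
        using in_half_space_measurable_pair[OF \<nu>] measurable_compose[OF measurable_fst am]
        by (intro borel_measurable_add borel_measurable_times borel_measurable_diff borel_measurable_const)
      show "\<bar>?a \<omega> x * (1 - ?a \<omega> y) + (1 - ?a \<omega> x) * ?a \<omega> y\<bar> \<le> 1" for \<omega> y by (simp add: in_half_space_def)
    qed
    also have "\<dots> = (\<integral>\<omega>. ?a \<omega> x * (?m - ?A \<omega>) + (1 - ?a \<omega> x) * ?A \<omega> \<partial>?N)"
      by (simp only: integral_1_minus_half_space[OF \<nu>])
    finally show ?thesis .
  qed
  have "pi / 2 * mutual_energy \<mu> \<nu> = (\<integral>x. pi / 2 * (\<integral>y. dist x y \<partial>\<nu>) \<partial>\<mu>)" by (simp add: mutual_energy_def)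
  also have "\<dots> = (\<integral>x. (\<integral>\<omega>. ?a \<omega> x * (?m - ?A \<omega>) + (1 - ?a \<omega> x) * ?A \<omega> \<partial>?N) \<partial>\<mu>)"
    by (intro Bochner_Integration.integral_cong refl inner) (simp add: borel_on_space[OF \<mu>])
  also have "\<dots> = (\<integral>\<omega>. (\<integral>x. ?a \<omega> x * (?m - ?A \<omega>) + (1 - ?a \<omega> x) * ?A \<omega> \<partial>\<mu>) \<partial>?N)"
  proof (rule finite_measure_swap[OF fin(1,2), where C = ?m])
    have "(\<lambda>p. ?A (fst p)) \<in> borel_measurable (?N \<Otimes>\<^sub>M \<mu>)"
      by (rule measurable_compose[OF measurable_fst half_space_mass_measurable[OF \<nu>]])
    then show "(\<lambda>p. ?a (fst p) (snd p) * (?m - ?A (fst p)) + (1 - ?a (fst p) (snd p)) * ?A (fst p))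
        \<in> borel_measurable (?N \<Otimes>\<^sub>M \<mu>)"
      using in_half_space_measurable_pair[OF \<mu>]
      by (intro borel_measurable_add borel_measurable_times borel_measurable_diff borel_measurable_const)
    show "\<bar>?a \<omega> x * (?m - ?A \<omega>) + (1 - ?a \<omega> x) * ?A \<omega>\<bar> \<le> ?m" for \<omega> x
      using half_space_mass_bounds[OF \<nu>, of \<omega>] by (simp add: in_half_space_def)
  qed
  also have "\<dots> = (\<integral>\<omega>. (\<integral>x. ?A \<omega> * (1 - ?a \<omega> x) + (?m - ?A \<omega>) * ?a \<omega> x \<partial>\<mu>) \<partial>?N)"
    by (simp only: mult.commute add.commute)
  also have "\<dots> = (\<integral>\<omega>. half_space_mass \<mu> \<omega> * (?m - ?A \<omega>) + (measure \<mu> (cball 0 1) - half_space_mass \<mu> \<omega>)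
      * ?A \<omega> \<partial>?N)"
    unfolding integral_1_minus_half_space[OF \<mu>] by (simp only: mult.commute add.commute)
  finally show ?thesis .
qed

definition signed_energy :: "(real^3) measure \<Rightarrow> (real^3) measure \<Rightarrow> real" where
  "signed_energy \<mu> \<nu> = mutual_energy \<mu> \<mu> - mutual_energy \<mu> \<nu> - mutual_energy \<nu> \<mu> + mutual_energy \<nu> \<nu>"

context
  fixes \<mu> \<nu> :: "(real^3) measure"
  assumes \<mu>: "finite_borel_measure_on (cball 0 1) \<mu>" and \<nu>: "finite_borel_measure_on (cball 0 1) \<nu>"
    and mass: "measure \<mu> (cball 0 1) - measure \<nu> (cball 0 1) = 1"
begin

text \<open>For a signed measure m of mass 1 the four terms combine to 2 * m(H) * (1 - m(H)), here
  with the square completed so that the deviation of m(H) from 1 / 2 is visible.\<close>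

lemma signed_energy_half_spaces:
  "signed_energy \<mu> \<nu> = 2 / pi * (\<integral>\<omega>. 1 / 2 - 2 * (half_space_mass \<mu> \<omega> - half_space_mass \<nu> \<omega>
      - 1 / 2)\<^sup>2 \<partial>half_space_measure)"
proof -
  let ?N = half_space_measure
  define K where "K \<mu> \<nu> \<omega> = half_space_mass \<mu> \<omega> * (measure \<nu> (cball 0 1) - half_space_mass \<nu> \<omega>)
        + (measure \<mu> (cball 0 1) - half_space_mass \<mu> \<omega>) * half_space_mass \<nu> \<omega>" for \<mu> \<nu> \<omega>
  have E: "pi / 2 * mutual_energy \<mu>1 \<mu>2 = (\<integral>\<omega>. K \<mu>1 \<mu>2 \<omega> \<partial>?N)" and I: "integrable ?N (K \<mu>1 \<mu>2)"
    if "finite_borel_measure_on (cball 0 1) \<mu>1" "finite_borel_measure_on (cball 0 1) \<mu>2" for \<mu>1 \<mu>2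
  proof -
    show "pi / 2 * mutual_energy \<mu>1 \<mu>2 = (\<integral>\<omega>. K \<mu>1 \<mu>2 \<omega> \<partial>?N)"
      unfolding K_def by (rule mutual_energy_half_spaces[OF that])
    let ?C = "2 * (measure \<mu>1 (cball 0 1) * measure \<mu>2 (cball 0 1))"
    show "integrable ?N (K \<mu>1 \<mu>2)"
    proof (rule finite_measure_integrable[OF finite_half_space_measure, where C = ?C])
      show "K \<mu>1 \<mu>2 \<in> borel_measurable ?N"
        unfolding K_def using half_space_mass_measurable[OF that(1)] half_space_mass_measurable[OF that(2)]
        by (intro borel_measurable_add borel_measurable_times borel_measurable_diff borel_measurable_const)
      fix \<omega>
      note b = half_space_mass_bounds[OF that(1), of \<omega>] half_space_mass_bounds[OF that(2), of \<omega>]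
      have "half_space_mass \<mu>1 \<omega> * (measure \<mu>2 (cball 0 1) - half_space_mass \<mu>2 \<omega>)
          \<le> measure \<mu>1 (cball 0 1) * measure \<mu>2 (cball 0 1)"
        "(measure \<mu>1 (cball 0 1) - half_space_mass \<mu>1 \<omega>) * half_space_mass \<mu>2 \<omega>
            \<le> measure \<mu>1 (cball 0 1) * measure \<mu>2 (cball 0 1)"
        using b by (intro mult_mono; simp)+
      moreover have "0 \<le> half_space_mass \<mu>1 \<omega> * (measure \<mu>2 (cball 0 1) - half_space_mass \<mu>2 \<omega>)"
        "0 \<le> (measure \<mu>1 (cball 0 1) - half_space_mass \<mu>1 \<omega>) * half_space_mass \<mu>2 \<omega>"
        using b by simp_all
      ultimately show "\<bar>K \<mu>1 \<mu>2 \<omega>\<bar> \<le> ?C" unfolding K_def by linarith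
    qed
  qed
  have "pi / 2 * signed_energy \<mu> \<nu> = pi / 2 * mutual_energy \<mu> \<mu> - pi / 2 * mutual_energy \<mu> \<nu>
      - pi / 2 * mutual_energy \<nu> \<mu> + pi / 2 * mutual_energy \<nu> \<nu>"
    by (simp add: signed_energy_def right_diff_distrib distrib_left)
  also have "\<dots> = (\<integral>\<omega>. K \<mu> \<mu> \<omega> - K \<mu> \<nu> \<omega> - K \<nu> \<mu> \<omega> + K \<nu> \<nu> \<omega> \<partial>?N)"
    unfolding E[OF \<mu> \<mu>] E[OF \<mu> \<nu>] E[OF \<nu> \<mu>] E[OF \<nu> \<nu>]
    using I[OF \<mu> \<mu>] I[OF \<mu> \<nu>] I[OF \<nu> \<mu>] I[OF \<nu> \<nu>] by simp
  also have "\<dots> = (\<integral>\<omega>. 1 / 2 - 2 * (half_space_mass \<mu> \<omega> - half_space_mass \<nu> \<omega> - 1 / 2)\<^sup>2 \<partial>?N)"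
  proof (rule Bochner_Integration.integral_cong[OF refl])
    fix \<omega>
    have m: "measure \<mu> (cball 0 1) = 1 + measure \<nu> (cball 0 1)" using mass by simp
    show "K \<mu> \<mu> \<omega> - K \<mu> \<nu> \<omega> - K \<nu> \<mu> \<omega> + K \<nu> \<nu> \<omega>
      = 1 / 2 - 2 * (half_space_mass \<mu> \<omega> - half_space_mass \<nu> \<omega> - 1 / 2)\<^sup>2"
      unfolding K_def m by (simp add: power2_eq_square algebra_simps)
  qed
  finally show ?thesis by (simp add: field_simps)
qed

lemma signed_energy_le: "signed_energy \<mu> \<nu> \<le> 2"
proof -
  let ?N = half_space_measure and ?f = "\<lambda>\<omega>. 1 / 2 - 2 * (half_space_mass \<mu> \<omega> - half_space_mass \<nu> \<omega> - 1 / 2)\<^sup>2"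
  interpret finite_measure ?N by (rule finite_half_space_measure)
  have "(\<integral>\<omega>. ?f \<omega> \<partial>?N) \<le> (\<integral>\<omega>. 1 / 2 \<partial>?N)"
  \<comment> \<open>If the integrand were not integrable, its integral would be 0 by convention and
    the bound would hold trivially.\<close>
  proof (cases "integrable ?N ?f")
    case True
    then show ?thesis by (rule integral_mono) simp_all
  next
    case False
    then show ?thesis by (simp add: not_integrable_integral_eq)
  qed
  also have "\<dots> = pi" using emeasure_half_space_measure by (simp add: measure_def)
  finally have "2 / pi * (\<integral>\<omega>. ?f \<omega> \<partial>?N) \<le> 2 / pi * pi" by (intro mult_left_mono) auto
  then show ?thesis by (simp add: signed_energy_half_spaces)
qed

end

section \<open>Radial signed measures with nearly equal half-space masses\<close>

definition power_measure :: "real \<Rightarrow> nat \<Rightarrow> (real^3) measure" where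
  "power_measure C k = density (restrict_space lborel (cball 0 1)) (\<lambda>y. ennreal (C * norm y ^ (2 * k)))"

text \<open>The mass below height \<sigma> for the density |y|^(2 * k) on the unit ball.\<close>

definition slice :: "nat \<Rightarrow> real \<Rightarrow> real" where
  "slice k \<sigma> = pi / (k + 1) * ((\<sigma> + 1) - (\<sigma> ^ (2 * k + 3) + 1) / (2 * k + 3))"

lemma nn_integral_slice:
  assumes "\<bar>\<sigma>\<bar> \<le> 1"
  shows "(\<integral>\<^sup>+y. ennreal (indicator (cball 0 1) y * (norm y) ^ (2 * k) * of_bool ((y::real^3)$3 \<le> \<sigma>)) \<partial>lborel)
    = ennreal (slice k \<sigma>)"
proof -
  let ?G = "\<lambda>z::real. pi / (k + 1) * (z - z ^ (2 * k + 3) / (2 * k + 3))"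
  have I: "((\<lambda>z. pi / (k + 1) * (1 - z ^ (2 * k + 2))) has_integral ?G \<sigma> - ?G (-1)) {-1..\<sigma>}"
  proof (rule fundamental_theorem_of_calculus)
    fix z :: real
    have "((\<lambda>z::real. z ^ (2 * k + 3) / (2 * k + 3)) has_real_derivative
        (real (2 * k + 3) * z ^ (2 * k + 2)) / (2 * k + 3)) (at z within {-1..\<sigma>})"
      by (rule derivative_eq_intros refl | simp)+
    moreover have "(real (2 * k + 3) * z ^ (2 * k + 2)) / (2 * k + 3) = z ^ (2 * k + 2)" by simp
    ultimately have "((\<lambda>z::real. z ^ (2 * k + 3) / (2 * k + 3)) has_real_derivative z ^ (2 * k
        + 2)) (at z within {-1..\<sigma>})"
      by (simp only:)
    from DERIV_cmult[OF DERIV_diff[OF DERIV_ident this], of "pi / (k + 1)"]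
    show "(?G has_vector_derivative pi / (k + 1) * (1 - z ^ (2 * k + 2))) (at z within {-1..\<sigma>})"
      unfolding has_real_derivative_iff_has_vector_derivative[symmetric] .
  qed (use assms in auto)
  have m1: "(-1::real) ^ (2 * k + 3) = -1" by (simp add: power_add)
  have "c * (\<sigma> - P / d) - c * (-1 - (-1) / d) = c * ((\<sigma> + 1) - (P + 1) / d)" for c P d :: real
    by (simp add: algebra_simps add_divide_distrib)
  then have "?G \<sigma> - ?G (-1) = slice k \<sigma>" unfolding slice_def m1 by blast
  with I have I: "((\<lambda>z. pi / (k + 1) * (1 - z ^ (2 * k + 2))) has_integral slice k \<sigma>) {-1..\<sigma>}" by simp
  have m: "(\<lambda>z. of_bool (z \<le> \<sigma>) :: real) \<in> borel_measurable borel"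
    using borel_measurable_indicator[of "{..\<sigma>}" borel] by (simp add: indicator_def)
  have "(\<integral>\<^sup>+y. ennreal (indicator (cball 0 1) y * (norm y) ^ (2 * k) * of_bool ((y::real^3)$3 \<le> \<sigma>)) \<partial>lborel)
    = (\<integral>\<^sup>+z. ennreal (indicator {-1..1} z * (pi / (k + 1) * (1 - z ^ (2 * k + 2)) * of_bool (z \<le> \<sigma>))) \<partial>lborel)"
    by (rule nn_integral_cylinder_ball[OF m]) simp
  also have "\<dots> = (\<integral>\<^sup>+z. ennreal (indicator {-1..\<sigma>} z * (pi / (k + 1) * (1 - z ^ (2 * k + 2)))) \<partial>lborel)"
    using assms by (intro nn_integral_cong) (auto simp: indicator_def)
  also have "\<dots> = ennreal (slice k \<sigma>)"
  proof (rule nn_integral_has_integral_lebesgue[OF _ I])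
    fix z assume z: "z \<in> {-1..\<sigma>}"
    then have "\<bar>z\<bar> \<le> 1" using assms by auto
    then have "\<bar>z ^ (2 * k + 2)\<bar> \<le> 1" unfolding power_abs by (rule power_le_one[rotated]) simp_all
    then show "0 \<le> pi / (k + 1) * (1 - z ^ (2 * k + 2))" by (intro mult_nonneg_nonneg) auto
  qed
  finally show ?thesis .
qed

lemma slice_nonneg:
  assumes "\<bar>\<sigma>\<bar> \<le> 1"
  shows "0 \<le> slice k \<sigma>"
proof -
  have "slice k (-1) \<le> slice k \<sigma>"
  proof (rule DERIV_nonneg_imp_nondecreasing[where f = "slice k"])
    show "-1 \<le> \<sigma>" using assms by simp
    fix x :: real assume x: "-1 \<le> x" "x \<le> \<sigma>"
    then have "\<bar>x\<bar> \<le> 1" using assms by auto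
    then have "\<bar>x ^ (2 * k + 2)\<bar> \<le> 1" unfolding power_abs by (rule power_le_one[rotated]) simp_all
    then have p: "0 \<le> pi / (k + 1) * (1 - x ^ (2 * k + 2))" by (intro mult_nonneg_nonneg) auto
    have "((\<lambda>z::real. (z ^ (2 * k + 3) + 1) / (2 * k + 3)) has_real_derivative
        (real (2 * k + 3) * x ^ (2 * k + 2)) / (2 * k + 3)) (at x)"
      by (rule derivative_eq_intros refl | simp)+
    moreover have "(real (2 * k + 3) * x ^ (2 * k + 2)) / (2 * k + 3) = x ^ (2 * k + 2)" by simp
    ultimately have d: "((\<lambda>z::real. (z ^ (2 * k + 3) + 1) / (2 * k + 3)) has_real_derivative x ^ (2 * k
        + 2)) (at x)"
      by (simp only:)
    have "((\<lambda>z::real. z + 1) has_real_derivative 1) (at x)" by (auto intro!: derivative_eq_intros)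
    from DERIV_cmult[OF DERIV_diff[OF this d], of "pi / (k + 1)"]
    have "(slice k has_real_derivative pi / (k + 1) * (1 - x ^ (2 * k + 2))) (at x)"
      unfolding slice_def[abs_def] .
    then show "\<exists>y. (slice k has_real_derivative y) (at x) \<and> 0 \<le> y" using p by blast
  qed
  moreover have "(-1::real) ^ (2 * k + 3) = -1" by (simp add: power_add)
  then have "slice k (-1) = 0" by (simp add: slice_def)
  ultimately show ?thesis by simp
qed

lemma power_measurable:
  "(\<lambda>y::real^3. ennreal (C * norm y ^ (2 * k))) \<in> borel_measurable (restrict_space lborel (cball 0 1))"
  by (rule measurable_restrict_space1) simp

lemma nn_integral_power_measure:
  assumes F: "F \<in> borel_measurable borel" and C: "0 \<le> C"
  shows "(\<integral>\<^sup>+y. ennreal (F y) \<partial>power_measure C k)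
    = ennreal C * (\<integral>\<^sup>+y. ennreal (indicator (cball 0 1) y * (norm y) ^ (2 * k) * F y) \<partial>lborel)"
proof -
  have Fm: "(\<lambda>y. ennreal (F y)) \<in> borel_measurable (restrict_space lborel (cball 0 1))"
    using F by (intro measurable_restrict_space1) simp
  have cb: "cball (0::real^3) 1 \<inter> space lborel \<in> sets lborel" by simp
  have "(\<integral>\<^sup>+y. ennreal (F y) \<partial>power_measure C k)
    = (\<integral>\<^sup>+y. ennreal (C * norm y ^ (2 * k)) * ennreal (F y) \<partial>restrict_space lborel (cball 0 1))"
    unfolding power_measure_def by (rule nn_integral_density[OF power_measurable Fm])
  also have "\<dots> = (\<integral>\<^sup>+y. ennreal (C * norm y ^ (2 * k)) * ennreal (F y) * indicator (cball 0 1) y \<partial>lborel)"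
    by (rule nn_integral_restrict_space[OF cb])
  also have "\<dots> = (\<integral>\<^sup>+y. ennreal C * ennreal (indicator (cball 0 1) y * (norm y) ^ (2 * k) * F y) \<partial>lborel)"
  proof (rule nn_integral_cong)
    fix y :: "real^3"
    have "ennreal (C * norm y ^ (2 * k)) * ennreal (F y) = ennreal C * ennreal (norm y ^ (2 * k) * F y)"
      using C by (simp add: ennreal_mult' mult.assoc)
    then show "ennreal (C * norm y ^ (2 * k)) * ennreal (F y) * indicator (cball 0 1) y
      = ennreal C * ennreal (indicator (cball 0 1) y * (norm y) ^ (2 * k) * F y)"
      by (cases "y \<in> cball 0 1") simp_all
  qed
  also have "\<dots> = ennreal C * (\<integral>\<^sup>+y. ennreal (indicator (cball 0 1) y * (norm y) ^ (2 * k) * F y) \<partial>lborel)"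
    using F by (intro nn_integral_cmult) measurable
  finally show ?thesis .
qed

lemma space_power_measure: "space (power_measure C k) = cball 0 1"
  by (simp add: power_measure_def space_restrict_space)

lemma power_measure_mass:
  assumes "0 \<le> C"
  shows "emeasure (power_measure C k) (cball 0 1) = ennreal (C * slice k 1)"
proof -
  have "emeasure (power_measure C k) (cball 0 1) = emeasure (power_measure C k) (space (power_measure C k))"
    by (simp only: space_power_measure)
  also have "\<dots> = (\<integral>\<^sup>+y. ennreal 1 \<partial>power_measure C k)" by simp
  also have "\<dots> = ennreal C * (\<integral>\<^sup>+y. ennreal (indicator (cball (0::real^3) 1) y * (norm y) ^ (2 * k)
      * 1) \<partial>lborel)"
    by (rule nn_integral_power_measure[OF _ assms]) simp
  also have "(\<integral>\<^sup>+y. ennreal (indicator (cball (0::real^3) 1) y * (norm y) ^ (2 * k) * 1) \<partial>lborel)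
    = (\<integral>\<^sup>+y. ennreal (indicator (cball 0 1) y * (norm y) ^ (2 * k) * of_bool ((y::real^3)$3 \<le> 1)) \<partial>lborel)"
  proof (rule nn_integral_cong)
    fix y :: "real^3"
    show "ennreal (indicator (cball (0::real^3) 1) y * (norm y) ^ (2 * k) * 1)
      = ennreal (indicator (cball 0 1) y * (norm y) ^ (2 * k) * of_bool (y$3 \<le> 1))"
    proof (cases "y \<in> cball 0 1")
      case True
      then have "y$3 \<le> 1" using component_le_norm_cart[of y 3] by simp
      then show ?thesis by simp
    qed simp
  qed
  also have "\<dots> = ennreal (slice k 1)" by (rule nn_integral_slice) simp
  finally show ?thesis using assms by (simp add: ennreal_mult')
qed

lemma power_measure_borel_on:
  assumes "0 \<le> C"
  shows "finite_borel_measure_on (cball 0 1) (power_measure C k)"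
proof -
  have "finite_measure (power_measure C k)"
    by (rule finite_measureI) (use power_measure_mass[OF assms, of k] in \<open>simp add: space_power_measure\<close>)
  moreover have "sets (power_measure C k) = sets (restrict_space borel (cball 0 1))"
    unfolding power_measure_def sets_density by (rule sets_restrict_space_cong) simp
  ultimately show ?thesis by (simp add: finite_borel_measure_on_def)
qed

text \<open>The measure is invariant under rotations, so u may be turned to the third axis; only the
  normalised height s / |u| remains.\<close>

lemma power_measure_half_space:
  assumes C: "0 \<le> C" and us: "u \<noteq> 0" "\<bar>s\<bar> \<le> norm u"
  shows "half_space_mass (power_measure C k) (u, s) = C * slice k (s / norm u)"
proof -
  have "norm u = norm (norm u *\<^sub>R axis 3 1 :: real^3)" by simp
  then obtain f :: "real^3 \<Rightarrow> real^3" where f: "orthogonal_transformation f" "f u = norm u *\<^sub>R axis 3 1"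
    by (rule orthogonal_transformation_exists)
  define \<sigma> where "\<sigma> = s / norm u"
  have \<sigma>: "\<bar>\<sigma>\<bar> \<le> 1" using us by (simp add: \<sigma>_def)
  have am: "in_half_space (u, s) \<in> borel_measurable borel"
    using measurable_compose[OF _ in_half_space_measurable, of "\<lambda>x. ((u, s), x)" borel] by simp
  let ?G = "\<lambda>y::real^3. ennreal (indicator (cball 0 1) y * (norm y) ^ (2 * k) * of_bool (y$3 \<le> \<sigma>))"
  have a: "in_half_space (u, s) y = of_bool (f y $ 3 \<le> \<sigma>)" for y
  proof -
    have "u \<bullet> y = f u \<bullet> f y" using f(1) by (simp add: orthogonal_transformation_def)
    also have "\<dots> = norm u * f y $ 3" by (simp add: f(2) inner_axis inner_commute[of "axis 3 1"])
    finally show ?thesis using us(1) by (simp add: in_half_space_def \<sigma>_def field_simps)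
  qed
  have nf: "norm (f y) = norm y" for y using f(1) by (rule orthogonal_transformation_norm)
  have Gm: "?G \<in> borel_measurable borel"
  proof -
    have [measurable]: "(\<lambda>y::real^3. of_bool (y$3 \<le> \<sigma>) :: real) \<in> borel_measurable borel"
      using measurable_compose[OF _ borel_measurable_indicator[of "{..\<sigma>}" borel], of "\<lambda>y::real^3. y$3" borel]
      by (simp add: indicator_def)
    show ?thesis by measurable
  qed
  have "(\<integral>\<^sup>+y. ennreal (in_half_space (u, s) y) \<partial>power_measure C k)
    = ennreal C * (\<integral>\<^sup>+y. ennreal (indicator (cball 0 1) y * (norm y) ^ (2 * k) * in_half_space (u, s) y)
        \<partial>lborel)"
    by (rule nn_integral_power_measure[OF am C])
  also have "(\<integral>\<^sup>+y. ennreal (indicator (cball 0 1) y * (norm y) ^ (2 * k) * in_half_space (u, s) y) \<partial>lborel)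
      = (\<integral>\<^sup>+y. ?G (f y) \<partial>lborel)"
    by (simp add: a nf indicator_def)
  also have "\<dots> = (\<integral>\<^sup>+y. ?G y \<partial>lborel)" by (rule nn_integral_orthogonal[OF f(1) Gm])
  also have "\<dots> = ennreal (slice k \<sigma>)" by (rule nn_integral_slice[OF \<sigma>])
  finally have "(\<integral>\<^sup>+y. ennreal (in_half_space (u, s) y) \<partial>power_measure C k) = ennreal (C * slice k \<sigma>)"
    using C by (simp add: ennreal_mult')
  then show ?thesis
    unfolding half_space_mass_def \<sigma>_def[symmetric]
    using C slice_nonneg[OF \<sigma>] in_half_space_measurable_snd[OF power_measure_borel_on[OF C]]
    by (subst integral_eq_nn_integral) (simp_all add: in_half_space_bounds)
qed

text \<open>The factor (k + 1) / pi normalises \<open>slice\<close>, and (2 j + 3) * (2 j + 5) / 4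
  gives the difference of the measures for k = j + 1 and k = j total mass 1. For growing j this
  difference concentrates near the sphere and sends a radial monomial |y|^n to a quantity tending to
  1 + n, its value plus its normal derivative on the sphere.\<close>

definition dipole_const :: "nat \<Rightarrow> nat \<Rightarrow> real" where
  "dipole_const j k = (2 * j + 3) * (2 * j + 5) / 4 * (k + 1) / pi"

definition dipole_error :: "nat \<Rightarrow> real \<Rightarrow> real" where
  "dipole_error j \<sigma> = ((2 * j + 5) * \<sigma> ^ (2 * j + 3) - (2 * j + 3) * \<sigma> ^ (2 * j + 5)) / 4"

text \<open>After normalisation both slices contain the same linear term in \<sigma>, which cancels.
  What remains besides 1 / 2 are high powers of \<sigma>.\<close>

lemma dipole_slice:
  "dipole_const j (j + 1) * slice (j + 1) \<sigma> - dipole_const j j * slice j \<sigma> = 1 / 2 + dipole_error j \<sigma>"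
proof -
  define a :: real where "a = 2 * j + 3"
  have a: "a > 0" by (simp add: a_def)
  have s: "dipole_const j k * slice k \<sigma> = a * (a + 2) / 4 * ((\<sigma> + 1) - (\<sigma> ^ (2 * k + 3) + 1) / (2 * k + 3))"
      for k
  proof -
    have k: "real k + 1 \<noteq> 0" by linarith
    have "dipole_const j k * (pi / (k + 1)) = a * (a + 2) / 4 * ((real k + 1) / (real k + 1))"
      by (simp add: dipole_const_def a_def ac_simps)
    then have c: "dipole_const j k * (pi / (k + 1)) = a * (a + 2) / 4" using k by simp
    show ?thesis unfolding slice_def mult.assoc[symmetric] c ..
  qed
  have e: "real (2 * (j + 1) + 3) = a + 2" "real (2 * j + 3) = a" "real (2 * j + 5) = a + 2"
      "2 * (j + 1) + 3 = 2 * j + 5"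
    by (simp_all add: a_def)
  define P where "P = \<sigma> ^ (2 * j + 3)"
  define Q where "Q = \<sigma> ^ (2 * j + 5)"
  have e': "2 * real (j + 1) + 3 = a + 2" "2 * real j + 3 = a" "2 * real j + 5 = a + 2" by (simp_all add: a_def)
  have "dipole_const j (j + 1) * slice (j + 1) \<sigma> - dipole_const j j * slice j \<sigma>
    = a * (a + 2) / 4 * ((P + 1) / a - (Q + 1) / (a + 2))"
  proof -
    have s1: "dipole_const j (j + 1) * slice (j + 1) \<sigma> = a * (a + 2) / 4 * ((\<sigma> + 1) - (Q + 1) / (a + 2))"
      unfolding s[of "j + 1"] e e' Q_def ..
    have s0: "dipole_const j j * slice j \<sigma> = a * (a + 2) / 4 * ((\<sigma> + 1) - (P + 1) / a)"
      unfolding s[of j] e e' P_def ..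
    have "c * (X - Y) - c * (X - Z) = c * (Z - Y)" for c X Y Z :: real by (simp add: algebra_simps)
    then show ?thesis unfolding s1 s0 .
  qed
  also have "\<dots> = 1 / 2 + ((a + 2) * P - a * Q) / 4"
  proof -
    have "a * b / 4 * ((P + 1) / a - (Q + 1) / b) = (b * (P + 1) - a * (Q + 1)) / 4" if "b > 0" for b
      using a that by (simp add: field_simps)
    from this[of "a + 2"] show ?thesis using a by (simp add: field_simps)
  qed
  finally show ?thesis by (simp add: dipole_error_def P_def Q_def e e')
qed

text \<open>The derivative is a multiple of \<sigma>^(2 * j + 2) * (1 - \<sigma>^2), so the error
  increases from - 1 / 2 to 1 / 2. This bound provides the dominating function for the limit of the
  energies.\<close>

lemma dipole_error_bound:
  assumes "\<bar>\<sigma>\<bar> \<le> 1"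
  shows "\<bar>dipole_error j \<sigma>\<bar> \<le> 1 / 2"
proof -
  have D: "\<exists>y. (dipole_error j has_real_derivative y) (at x) \<and> 0 \<le> y" if "\<bar>x\<bar> \<le> 1" for x
  proof -
    have p: "((\<lambda>\<sigma>::real. \<sigma> ^ n) has_real_derivative real n * x ^ (n - 1)) (at x)" for n
      using DERIV_pow[of n x] by simp
    have "(dipole_error j has_real_derivative ((2 * real j + 5) * (real (2 * j + 3) * x ^ (2 * j + 3 - 1))
        - (2 * real j + 3) * (real (2 * j + 5) * x ^ (2 * j + 5 - 1))) / 4) (at x)"
      unfolding dipole_error_def[abs_def] by (intro DERIV_cdivide DERIV_diff DERIV_cmult p)
    moreover have "0 \<le> ((2 * real j + 5) * (real (2 * j + 3) * x ^ (2 * j + 3 - 1))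
        - (2 * real j + 3) * (real (2 * j + 5) * x ^ (2 * j + 5 - 1))) / 4"
    proof -
      have x2: "x\<^sup>2 \<le> 1" using that by (simp add: abs_square_le_1)
      have pw: "x ^ (2 * j + 3 - 1) = (x ^ (j + 1))\<^sup>2" "x ^ (2 * j + 5 - 1) = (x ^ (j + 1))\<^sup>2 * x\<^sup>2"
      proof -
        have "2 * j + 3 - 1 = (j + 1) * 2" "2 * j + 5 - 1 = (j + 1) * 2 + 2" by simp_all
        then show "x ^ (2 * j + 3 - 1) = (x ^ (j + 1))\<^sup>2" "x ^ (2 * j + 5 - 1) = (x ^ (j + 1))\<^sup>2 * x\<^sup>2"
          by (simp_all only: power_mult power_add)
      qed
      have "0 \<le> (2 * j + 5) * real (2 * j + 3) * ((x ^ (j + 1))\<^sup>2 * (1 - x\<^sup>2)) / 4" using x2 by simp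
      then show ?thesis unfolding pw by (simp add: algebra_simps)
    qed
    ultimately show ?thesis by blast
  qed
  have "dipole_error j (-1) \<le> dipole_error j \<sigma>"
    by (rule DERIV_nonneg_imp_nondecreasing[where f =
        "dipole_error j"]) (use assms D in \<open>auto simp: abs_le_iff\<close>)
  moreover have "dipole_error j \<sigma> \<le> dipole_error j 1"
    by (rule DERIV_nonneg_imp_nondecreasing[where f =
        "dipole_error j"]) (use assms D in \<open>auto simp: abs_le_iff\<close>)
  moreover have "(-1::real) ^ (2 * j + 3) = -1" "(-1::real) ^ (2 * j + 5) = -1" by (simp_all add: power_add)
  then have "dipole_error j (-1) = - 1 / 2" "dipole_error j 1 = 1 / 2"
    unfolding dipole_error_def by (simp_all add: field_simps)
  ultimately show ?thesis by (simp add: abs_le_iff)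
qed

lemma dipole_error_tendsto:
  assumes "\<bar>\<sigma>\<bar> < 1"
  shows "(\<lambda>j. dipole_error j \<sigma>) \<longlonglongrightarrow> 0"
proof -
  have s: "\<bar>\<sigma>\<^sup>2\<bar> < 1" using assms by (simp add: abs_square_less_1)
  have p: "(\<lambda>j. (\<sigma>\<^sup>2) ^ j) \<longlonglongrightarrow> 0" using s by (intro LIMSEQ_power_zero) simp
  have np: "(\<lambda>j. real j * (\<sigma>\<^sup>2) ^ j) \<longlonglongrightarrow> 0" using s by (intro powser_times_n_limit_0) simp
  have "(\<lambda>j. (((2 * (real j * (\<sigma>\<^sup>2) ^ j) + 5 * (\<sigma>\<^sup>2) ^ j) * \<sigma> ^ 3 - (2 * (real j * (\<sigma>\<^sup>2) ^ j) + 3 * (\<sigma>\<^sup>2) ^ j)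
      * \<sigma> ^ 5)) / 4)
    \<longlonglongrightarrow> (((2 * 0 + 5 * 0) * \<sigma> ^ 3 - (2 * 0 + 3 * 0) * \<sigma> ^ 5)) / 4"
    by (intro tendsto_intros p np) simp
  moreover have "dipole_error j \<sigma> = (((2 * (real j * (\<sigma>\<^sup>2) ^ j) + 5 * (\<sigma>\<^sup>2) ^ j) * \<sigma> ^ 3
      - (2 * (real j * (\<sigma>\<^sup>2) ^ j) + 3 * (\<sigma>\<^sup>2) ^ j) * \<sigma> ^ 5)) / 4" for j
  proof -
    have "\<sigma> ^ (2 * j + 3) = (\<sigma>\<^sup>2) ^ j * \<sigma> ^ 3" "\<sigma> ^ (2 * j + 5) = (\<sigma>\<^sup>2) ^ j * \<sigma> ^ 5"
      by (simp_all only: power_add power_mult)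
    then show ?thesis unfolding dipole_error_def by (simp add: algebra_simps)
  qed
  ultimately have "(\<lambda>j. dipole_error j \<sigma>) \<longlonglongrightarrow> (((2 * 0 + 5 * 0) * \<sigma> ^ 3 - (2 * 0 + 3 * 0) * \<sigma> ^ 5)) / 4"
    by (simp only:)
  then show ?thesis by simp
qed

definition dipole_plus :: "nat \<Rightarrow> (real^3) measure" where
  "dipole_plus j = power_measure (dipole_const j (j + 1)) (j + 1)"

definition dipole_minus :: "nat \<Rightarrow> (real^3) measure" where
  "dipole_minus j = power_measure (dipole_const j j) j"

lemma dipole_const_nonneg: "0 \<le> dipole_const j k" by (simp add: dipole_const_def)

lemma dipole_borel_on:
  "finite_borel_measure_on (cball 0 1) (dipole_plus j)" "finite_borel_measure_on (cball 0 1) (dipole_minus j)"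
  unfolding dipole_plus_def dipole_minus_def by (intro power_measure_borel_on dipole_const_nonneg)+

lemma dipole_mass: "measure (dipole_plus j) (cball 0 1) - measure (dipole_minus j) (cball 0 1) = 1"
proof -
  have m: "measure (power_measure (dipole_const j k) k) (cball 0 1) = dipole_const j k * slice k 1" for k
    using power_measure_mass[OF dipole_const_nonneg, of j k k] slice_nonneg[of 1 k] dipole_const_nonneg[of j k]
    by (simp add: measure_def)
  have "dipole_error j 1 = 1 / 2" unfolding dipole_error_def by (simp add: field_simps)
  then show ?thesis unfolding dipole_plus_def dipole_minus_def m dipole_slice by simp
qed

text \<open>The deviation from half mass tends to 0 for almost every half-space and is at most 1 /
  2, so the integrand stays between 0 and 1 / 2; the total measure of half-spaces is 2 * pi.\<close>

lemma signed_energy_dipole: "(\<lambda>j. signed_energy (dipole_plus j) (dipole_minus j)) \<longlonglongrightarrow> 2"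
proof -
  let ?N = half_space_measure
  define \<beta> where "\<beta> j \<omega> = half_space_mass (dipole_plus j) \<omega> - half_space_mass (dipole_minus j) \<omega> - 1 / 2"
      for j \<omega>
  interpret N: finite_measure ?N by (rule finite_half_space_measure)
  have bm: "\<beta> j \<in> borel_measurable ?N" for j
    unfolding \<beta>_def[abs_def] using half_space_mass_measurable[OF dipole_borel_on(1)[of j]]
      half_space_mass_measurable[OF dipole_borel_on(2)[of j]]
    by (intro borel_measurable_diff borel_measurable_const)
  \<comment> \<open>Half-spaces bounded by tangent planes are set aside: there \<sigma> = 1 or - 1,
    and the error keeps absolute value 1 / 2.\<close>
  have ne: "AE \<omega> in lborel. norm (fst \<omega> :: real^3) \<noteq> \<bar>snd \<omega> :: real\<bar>"
  proof -
    have "closed {\<omega>. norm (fst \<omega> :: real^3) = \<bar>snd \<omega> :: real\<bar>}" by (intro closed_Collect_eq continuous_intros)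
    then have "- {\<omega>. norm (fst \<omega> :: real^3) = \<bar>snd \<omega> :: real\<bar>} \<in> sets borel" by (intro borel_open) auto
    moreover have "- {\<omega>. norm (fst \<omega> :: real^3) = \<bar>snd \<omega> :: real\<bar>}
      = {\<omega> \<in> space (lborel \<Otimes>\<^sub>M lborel). norm (fst \<omega> :: real^3) \<noteq> \<bar>snd \<omega> :: real\<bar>}"
      by (auto simp: space_pair_measure)
    moreover have "sets (lborel \<Otimes>\<^sub>M lborel) = sets (borel :: ((real^3) \<times> real) measure)"
      by (simp only: lborel_prod sets_lborel)
    ultimately have "{\<omega> \<in> space (lborel \<Otimes>\<^sub>M lborel). norm (fst \<omega> :: real^3) \<noteq> \<bar>snd \<omega> :: real\<bar>} \<in> sets
        (lborel \<Otimes>\<^sub>M lborel)"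
      by (simp only:)
    moreover have "AE u in lborel. AE s in lborel. norm (fst (u :: real^3, s)) \<noteq> \<bar>snd (u, s :: real)\<bar>"
    proof (rule AE_I2)
      fix u :: "real^3"
      have "AE s in lborel. s \<noteq> norm u" "AE s in lborel. s \<noteq> - norm u" by (rule AE_lborel_singleton)+
      then show "AE s in lborel. norm (fst (u, s)) \<noteq> \<bar>snd (u, s :: real)\<bar>"
        by eventually_elim (auto simp: abs_if)
    qed
    ultimately have "AE \<omega> in lborel \<Otimes>\<^sub>M lborel. norm (fst \<omega> :: real^3) \<noteq> \<bar>snd \<omega> :: real\<bar>"
      by (rule lborel_pair.AE_pair_measure)
    then show ?thesis by (simp only: lborel_prod)
  qed
  have ae: "AE \<omega> in ?N. fst \<omega> \<noteq> 0 \<and> \<bar>snd \<omega>\<bar> < norm (fst \<omega>)"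
  proof (subst AE_restrict_space_iff)
    show "AE \<omega> in lborel. \<omega> \<in> half_spaces \<longrightarrow> fst \<omega> \<noteq> 0 \<and> \<bar>snd \<omega>\<bar> < norm (fst \<omega>)"
      using ne by eventually_elim (auto simp: half_spaces_def)
  qed simp
  have \<beta>: "\<beta> j \<omega> = dipole_error j (snd \<omega> / norm (fst \<omega>))" if "fst \<omega> \<noteq> 0" "\<bar>snd \<omega>\<bar> < norm (fst \<omega>)" for j \<omega>
    using power_measure_half_space[OF dipole_const_nonneg that(1) less_imp_le[OF that(2)]] dipole_slice
    by (simp add: \<beta>_def dipole_plus_def dipole_minus_def)
  have "(\<lambda>j. \<integral>\<omega>. 1 / 2 - 2 * (\<beta> j \<omega>)\<^sup>2 \<partial>?N) \<longlonglongrightarrow> (\<integral>\<omega>. 1 / 2 \<partial>?N)"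
  proof (rule integral_dominated_convergence[where w = "\<lambda>_. 1 / 2"])
    show "AE \<omega> in ?N. (\<lambda>j. 1 / 2 - 2 * (\<beta> j \<omega>)\<^sup>2) \<longlonglongrightarrow> 1 / 2"
      using ae
    proof eventually_elim
      case (elim \<omega>)
      then have "\<bar>snd \<omega> / norm (fst \<omega>)\<bar> < 1" by simp
      then have "(\<lambda>j. 1 / 2 - 2 * (dipole_error j (snd \<omega> / norm (fst \<omega>)))\<^sup>2) \<longlonglongrightarrow> 1 / 2 - 2 * 0\<^sup>2"
        by (intro tendsto_intros dipole_error_tendsto)
      then show ?case using elim by (simp add: \<beta>)
    qed
    show "AE \<omega> in ?N. norm (1 / 2 - 2 * (\<beta> j \<omega>)\<^sup>2) \<le> 1 / 2" for j
      using ae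
    proof eventually_elim
      case (elim \<omega>)
      then have "\<bar>\<beta> j \<omega>\<bar> \<le> 1 / 2" using dipole_error_bound[of "snd \<omega> / norm (fst \<omega>)" j] by (simp add: \<beta>)
      then have "(\<beta> j \<omega>)\<^sup>2 \<le> (1 / 2)\<^sup>2" using abs_le_square_iff[of "\<beta> j \<omega>" "1 / 2"] by simp
      then have "(\<beta> j \<omega>)\<^sup>2 \<le> 1 / 4" by (simp add: power2_eq_square)
      moreover have "0 \<le> (\<beta> j \<omega>)\<^sup>2" by simp
      ultimately show ?case unfolding real_norm_def by linarith
    qed
    show "(\<lambda>\<omega>. 1 / 2 - 2 * (\<beta> j \<omega>)\<^sup>2) \<in> borel_measurable ?N" for j
      using bm[of j] by (intro borel_measurable_diff borel_measurable_times borel_measurable_power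
          borel_measurable_const)
  qed simp_all
  also have "(\<integral>\<omega>. 1 / 2 \<partial>?N) = pi" using emeasure_half_space_measure by (simp add: measure_def)
  finally have "(\<lambda>j. 2 / pi * (\<integral>\<omega>. 1 / 2 - 2 * (\<beta> j \<omega>)\<^sup>2 \<partial>?N)) \<longlonglongrightarrow> 2 / pi * pi" by (intro tendsto_intros)
  then show ?thesis
    by (simp add: signed_energy_half_spaces[OF dipole_borel_on dipole_mass] \<beta>_def)
qed

lemma max_energy_unit_ball: "max_energy (cball 0 1 :: (real^3) set) = 2"
proof (rule antisym)
  show "max_energy (cball 0 1 :: (real^3) set) \<le> 2"
    unfolding max_energy_def
  proof (rule Sup_least, safe)
    fix \<mu> \<nu> :: "(real^3) measure"
    assume "finite_borel_measure_on (cball 0 1) \<mu>" "finite_borel_measure_on (cball 0 1) \<nu>"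
      "measure \<mu> (cball 0 1) - measure \<nu> (cball 0 1) = 1"
    from signed_energy_le[OF this]
    show "ereal (mutual_energy \<mu> \<mu> - mutual_energy \<mu> \<nu> - mutual_energy \<nu> \<mu> + mutual_energy \<nu> \<nu>) \<le> 2"
      by (simp add: signed_energy_def)
  qed
  have le: "ereal (signed_energy (dipole_plus j) (dipole_minus j)) \<le> max_energy (cball 0 1 :: (real^3) set)"
      for j
    unfolding max_energy_def signed_energy_def
    by (rule Sup_upper) (intro CollectI exI[of _ "dipole_plus j"] exI[of _ "dipole_minus j"]
        conjI refl dipole_borel_on dipole_mass)
  have "(\<lambda>j. ereal (signed_energy (dipole_plus j) (dipole_minus j))) \<longlonglongrightarrow> ereal 2"
    using signed_energy_dipole by simp
  from LIMSEQ_le_const2[OF this] le show "2 \<le> max_energy (cball 0 1 :: (real^3) set)" by auto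
qed

theorem theorem6p9:
  fixes h :: H2 and k :: "real^3 \<Rightarrow> H2" and w :: Hm2
  assumes "\<exists>U. open U \<and> cball 0 1 \<subseteq> U \<and> (\<forall>x\<in>U. H2_fun h x = 1)"
    and "\<forall>b\<in>interior (cball 0 1). \<exists>U. open U \<and> sphere 0 1 \<subseteq> U \<and> (\<forall>x\<in>U. H2_fun (k b) x = dist b x)"
    and "is_microscopic_weighting (cball 0 1) w"
  shows "blinfun_apply w h = 1 \<and>
    (\<forall>b\<in>interior (cball 0 1). ereal (blinfun_apply w (k b)) = max_energy (cball 0 1 :: (real^3) set))"
proof (intro conjI ballI)
  obtain U where U: "open U" "cball 0 1 \<subseteq> U" "\<And>x. x \<in> U \<Longrightarrow> H2_fun h x = 1"
    using assms(1) by blast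
  show "blinfun_apply w h = 1"
    by (rule microscopic_weighting_one[OF U assms(3)])
  fix b :: "real^3" assume b: "b \<in> interior (cball 0 1)"
  obtain V where V: "open V" "sphere 0 1 \<subseteq> V" "\<And>x. x \<in> V \<Longrightarrow> H2_fun (k b) x = dist b x"
    using bspec[OF assms(2) b] by blast
  have "norm b < 1" using b by (simp add: interior_cball)
  from microscopic_weighting_dist[OF U assms(3) this V]
  show "ereal (blinfun_apply w (k b)) = max_energy (cball 0 1 :: (real^3) set)"
    by (simp add: max_energy_unit_ball)
qed

end
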